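(* For every $d\in\mathbb{N}$ let $C_\gamma\ge\gamma_{d,1}\ge\cdots\ge\gamma_{d,d}>0$ ($C_\gamma$ independent of $d$) be generators of product weights $\gamma_{\boldsymbol\alpha}=\prod_{j=1}^d(\gamma_{d,j})^{\alpha_j}$, and let $(\mathcal{F}_d^\gamma)_{d\in\mathbb{N}}$ be a sequence of Banach spaces of real-valued functions on $[0,1]^d$. Suppose that there are absolute constants $a>0$, $b\ge0$ and a parameter $t\in(0,1]$, independent of $d$ and $\gamma$, such that for all $d\in\mathbb{N}$ the space $\mathcal{F}_d^\gamma$ is continuously embedded into the unanchored weighted Sobolev space $\mathcal{H}_d^\gamma$ with embedding norm $$C_{2,d}\le a\cdot\exp\Big(b\sum_{j=1}^d(\gamma_{d,j})^t\Big).$$ Consider the uniform approximation problem $\mathrm{App}_d\colon\mathcal{F}_d^\gamma\to L_\infty([0,1]^d)$, $\mathrm{App}_d(f)=f$, $d\in\mathbb{N}$, in the worst case setting with respect to the class of linear algorithms using continuous linear functionals and the absolute error criterion. Then - $q(\gamma)<t$ implies polynomial tractability, - $p(\gamma)<t$ implies strong polynomial tractability.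
   Context: Unanchored Sobolev space: for $\gamma>0$, $\mathcal{H}_1^\gamma$ is the space of absolutely continuous $f\colon[0,1]\to\mathbb{R}$ with $f'\in L_2([0,1])$ and inner product $\langle f,g\rangle=\langle f,g\rangle_{L_2([0,1])}+\gamma^{-1}\langle f',g'\rangle_{L_2([0,1])}$. For $d\in\mathbb{N}$, $\mathcal{H}_d^\gamma=\bigotimes_{k=1}^d\mathcal{H}_1^{\gamma_{d,k}}$ (Hilbert space tensor product), so that $\|f\mid\mathcal{H}_d^\gamma\|^2=\sum_{\boldsymbol\alpha\in\{0,1\}^d}\frac1{\gamma_{\boldsymbol\alpha}}\int_{[0,1]^d}|D^{\boldsymbol\alpha}f(\boldsymbol x)|^2\,d\boldsymbol x$. Sum exponents: $p(\gamma)=\inf\{\kappa\ge0\mid\limsup_{d\to\infty}\sum_{j=1}^d(\gamma_{d,j})^\kappa<\infty\}$, $q(\gamma)=\inf\{\kappa\ge0\mid\limsup_{d\to\infty}\sum_{j=1}^d(\gamma_{d,j})^\kappa/\ln(d+1)<\infty\}$, $\inf\emptyset=\infty$. $e(n,d)=\inf_A\sup_{\|f\mid\mathcal{F}_d^\gamma\|\le1}\|f-Af\mid L_\infty([0,1]^d)\|$, the infimum over linear algorithms $Af=\sum_{j=1}^nL_j(f)g_j$ with continuous linear functionals $L_j$ on $\mathcal{F}_d^\gamma$ and $g_j\in L_\infty([0,1]^d)$; $n(\varepsilon,d)=\min\{n\in\mathbb{N}_0\mid e(n,d)\le\varepsilon\}$. Polynomial tractability: there are $C,p>0$, $q\ge0$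 with $n(\varepsilon,d)\le C\varepsilon^{-p}d^q$ for all $\varepsilon\in(0,1]$, $d\in\mathbb{N}$; strong polynomial tractability: this holds with $q=0$. *)

theory Defs
  imports "HOL-Probability.Essential_Supremum"
begin

section \<open>The univariate unanchored Sobolev space\<close>

definition absolutely_continuous_on01 :: "(real \<Rightarrow> real) \<Rightarrow> bool" where
  "absolutely_continuous_on01 f \<longleftrightarrow>
     (\<forall>\<epsilon>>0. \<exists>\<delta>>0. \<forall>I :: (real \<times> real) set.
        finite I \<longrightarrow>
        (\<forall>(u, v)\<in>I. 0 \<le> u \<and> u \<le> v \<and> v \<le> 1) \<longrightarrow>
        disjoint_family_on (\<lambda>(u, v). {u<..<v}) I \<longrightarrow>
        (\<Sum>(u, v)\<in>I. v - u) < \<delta> \<longrightarrow>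
        (\<Sum>(u, v)\<in>I. \<bar>f v - f u\<bar>) < \<epsilon>)"

text \<open>Only the values on \<open>[0,1]\<close> matter. The almost everywhere differentiability is implied
  by absolute continuity (Lebesgue); it is listed because it is what makes the almost everywhere
  defined function \<open>f'\<close> agree with \<^term>\<open>deriv f\<close>, whose values at other points are arbitrary.\<close>

definition sobolev1 :: "(real \<Rightarrow> real) set" where
  "sobolev1 = {f. absolutely_continuous_on01 f \<and>
     (AE x in lebesgue_on {0..1}. f field_differentiable at x) \<and>
     deriv f \<in> borel_measurable (lebesgue_on {0..1}) \<and>
     integrable (lebesgue_on {0..1}) (\<lambda>x. (deriv f x)\<^sup>2)}"

definition sobolev1_inner :: "real \<Rightarrow> (real \<Rightarrow> real) \<Rightarrow> (real \<Rightarrow> real) \<Rightarrow> real" where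
  "sobolev1_inner c f g =
     (\<integral>x. f x * g x \<partial>lebesgue_on {0..1}) + (1 / c) * (\<integral>x. deriv f x * deriv g x \<partial>lebesgue_on {0..1})"

section \<open>The cube and its essentially bounded functions\<close>

definition cube :: "nat \<Rightarrow> (nat \<Rightarrow> real) set" where
  "cube d = {1..d} \<rightarrow>\<^sub>E {0..1}"

text \<open>The completion turns the Borel product measure into Lebesgue measure on the cube.\<close>

definition cube_measure :: "nat \<Rightarrow> (nat \<Rightarrow> real) measure" where
  "cube_measure d = completion (\<Pi>\<^sub>M k\<in>{1..d}. restrict_space lborel {0..1})"

definition Linfty_norm :: "nat \<Rightarrow> ((nat \<Rightarrow> real) \<Rightarrow> real) \<Rightarrow> ereal" where
  "Linfty_norm d f = esssup (cube_measure d) (\<lambda>x. ereal \<bar>f x\<bar>)"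

definition Linfty :: "nat \<Rightarrow> ((nat \<Rightarrow> real) \<Rightarrow> real) set" where
  "Linfty d = {f \<in> borel_measurable (cube_measure d). Linfty_norm d f < \<infinity>}"

section \<open>The Hilbert space tensor product of univariate Sobolev spaces\<close>

text \<open>A list of elementary tensors represents their sum; an elementary tensor is given by its
  factors \<open>\<phi> 1, \<dots>, \<phi> d\<close>. The inner product on the algebraic tensor product is the
  bilinear extension of the product formula for elementary tensors, and it does not depend on the
  representations chosen.\<close>

type_synonym tensor = "(nat \<Rightarrow> real \<Rightarrow> real) list"

definition algebraic_tensors :: "nat \<Rightarrow> tensor set" where
  "algebraic_tensors d = {u. \<forall>\<phi>\<in>set u. \<forall>k\<in>{1..d}. \<phi> k \<in> sobolev1}"

definition tensor_eval :: "nat \<Rightarrow> tensor \<Rightarrow> (nat \<Rightarrow> real) \<Rightarrow> real" where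
  "tensor_eval d u x = (\<Sum>\<phi>\<leftarrow>u. \<Prod>k=1..d. \<phi> k (x k))"

definition tensor_inner :: "(nat \<Rightarrow> real) \<Rightarrow> nat \<Rightarrow> tensor \<Rightarrow> tensor \<Rightarrow> real" where
  "tensor_inner \<gamma> d u v =
     (\<Sum>\<phi>\<leftarrow>u. \<Sum>\<psi>\<leftarrow>v. \<Prod>k=1..d. sobolev1_inner (\<gamma> k) (\<phi> k) (\<psi> k))"

definition tensor_dist :: "(nat \<Rightarrow> real) \<Rightarrow> nat \<Rightarrow> tensor \<Rightarrow> tensor \<Rightarrow> real" where
  "tensor_dist \<gamma> d u v =
     sqrt (tensor_inner \<gamma> d u u - 2 * tensor_inner \<gamma> d u v + tensor_inner \<gamma> d v v)"

definition product_weight :: "(nat \<Rightarrow> real) \<Rightarrow> nat \<Rightarrow> (nat \<Rightarrow> nat) \<Rightarrow> real" where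
  "product_weight \<gamma> d \<alpha> = (\<Prod>j=1..d. \<gamma> j ^ \<alpha> j)"

text \<open>This is the formula
  \<open>\<Sum>\<^sub>\<alpha> 1/\<gamma>\<^sub>\<alpha> \<integral> D\<^sup>\<alpha>f D\<^sup>\<alpha>g\<close> with \<open>\<alpha>\<close> ranging over \<open>{0,1}\<^sup>d\<close>, for elementary tensors
  \<open>f\<close> and \<open>g\<close>.\<close>

lemma prod_sobolev1_inner:
  "(\<Prod>k=1..d. sobolev1_inner (\<gamma> k) (\<phi> k) (\<psi> k)) =
   (\<Sum>\<alpha>\<in>{1..d} \<rightarrow>\<^sub>E {0, 1}. 1 / product_weight \<gamma> d \<alpha> *
      (\<Prod>k=1..d. \<integral>x. (deriv ^^ \<alpha> k) (\<phi> k) x * (deriv ^^ \<alpha> k) (\<psi> k) x \<partial>lebesgue_on {0..1}))"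
proof -
  have "sobolev1_inner c f g = (\<Sum>i\<in>{0, 1}. (1 / c ^ i) *
      (\<integral>x. (deriv ^^ i) f x * (deriv ^^ i) g x \<partial>lebesgue_on {0..1}))" for c f g
    by (simp add: sobolev1_inner_def)
  then show ?thesis
    by (simp add: prod_sum_PiE product_weight_def prod.distrib prod_dividef del: sum.insert)
qed

text \<open>Members of function spaces on the cube are total functions that vanish off the cube. The
  completion is realised as a space of functions: point evaluations are continuous, so a Cauchy
  sequence of algebraic tensors converges pointwise, and its limit function determines the element
  of the completion, in particular the limit of the norms.\<close>

definition tensor_approximates ::
    "(nat \<Rightarrow> real) \<Rightarrow> nat \<Rightarrow> (nat \<Rightarrow> tensor) \<Rightarrow> ((nat \<Rightarrow> real) \<Rightarrow> real) \<Rightarrow> bool" where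
  "tensor_approximates \<gamma> d u f \<longleftrightarrow>
     (\<forall>n. u n \<in> algebraic_tensors d) \<and>
     (\<forall>\<epsilon>>0. \<exists>N. \<forall>m\<ge>N. \<forall>n\<ge>N. tensor_dist \<gamma> d (u m) (u n) < \<epsilon>) \<and>
     (\<forall>x\<in>cube d. (\<lambda>n. tensor_eval d (u n) x) \<longlonglongrightarrow> f x)"

definition sobolev :: "(nat \<Rightarrow> real) \<Rightarrow> nat \<Rightarrow> ((nat \<Rightarrow> real) \<Rightarrow> real) set" where
  "sobolev \<gamma> d = {f. (\<forall>x. x \<notin> cube d \<longrightarrow> f x = 0) \<and> (\<exists>u. tensor_approximates \<gamma> d u f)}"

definition sobolev_norm :: "(nat \<Rightarrow> real) \<Rightarrow> nat \<Rightarrow> ((nat \<Rightarrow> real) \<Rightarrow> real) \<Rightarrow> real" where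
  "sobolev_norm \<gamma> d f =
     (THE r. \<exists>u. tensor_approximates \<gamma> d u f \<and> (\<lambda>n. sqrt (tensor_inner \<gamma> d (u n) (u n))) \<longlonglongrightarrow> r)"

section \<open>Banach spaces of functions on the cube\<close>

definition norm_dist :: "(('a \<Rightarrow> real) \<Rightarrow> real) \<Rightarrow> ('a \<Rightarrow> real) \<Rightarrow> ('a \<Rightarrow> real) \<Rightarrow> real" where
  "norm_dist N f g = N (\<lambda>x. f x - g x)"

definition banach_function_space ::
    "'a set \<Rightarrow> ('a \<Rightarrow> real) set \<Rightarrow> (('a \<Rightarrow> real) \<Rightarrow> real) \<Rightarrow> bool" where
  "banach_function_space X F N \<longleftrightarrow>
     (\<forall>f\<in>F. \<forall>x. x \<notin> X \<longrightarrow> f x = 0) \<and>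
     (\<lambda>x. 0) \<in> F \<and>
     (\<forall>f\<in>F. \<forall>g\<in>F. (\<lambda>x. f x + g x) \<in> F) \<and>
     (\<forall>c. \<forall>f\<in>F. (\<lambda>x. c * f x) \<in> F) \<and>
     (\<forall>f\<in>F. 0 \<le> N f \<and> (N f = 0 \<longleftrightarrow> f = (\<lambda>x. 0))) \<and>
     (\<forall>f\<in>F. \<forall>g\<in>F. N (\<lambda>x. f x + g x) \<le> N f + N g) \<and>
     (\<forall>c. \<forall>f\<in>F. N (\<lambda>x. c * f x) = \<bar>c\<bar> * N f) \<and>
     (\<forall>s. (\<forall>n. s n \<in> F) \<longrightarrow>
        (\<forall>\<epsilon>>0. \<exists>M. \<forall>m\<ge>M. \<forall>n\<ge>M. norm_dist N (s m) (s n) < \<epsilon>) \<longrightarrow>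
        (\<exists>f\<in>F. (\<lambda>n. norm_dist N (s n) f) \<longlonglongrightarrow> 0))"

definition continuous_linear_functional ::
    "('a \<Rightarrow> real) set \<Rightarrow> (('a \<Rightarrow> real) \<Rightarrow> real) \<Rightarrow> (('a \<Rightarrow> real) \<Rightarrow> real) \<Rightarrow> bool" where
  "continuous_linear_functional F N L \<longleftrightarrow>
     (\<forall>f\<in>F. \<forall>g\<in>F. L (\<lambda>x. f x + g x) = L f + L g) \<and>
     (\<forall>c. \<forall>f\<in>F. L (\<lambda>x. c * f x) = c * L f) \<and>
     (\<exists>C. \<forall>f\<in>F. \<bar>L f\<bar> \<le> C * N f)"

definition continuously_embedded ::
    "('a \<Rightarrow> real) set \<Rightarrow> (('a \<Rightarrow> real) \<Rightarrow> real) \<Rightarrow>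
     ('a \<Rightarrow> real) set \<Rightarrow> (('a \<Rightarrow> real) \<Rightarrow> real) \<Rightarrow> bool" where
  "continuously_embedded F N G N' \<longleftrightarrow> F \<subseteq> G \<and> (\<exists>C. \<forall>f\<in>F. N' f \<le> C * N f)"

definition embedding_norm ::
    "('a \<Rightarrow> real) set \<Rightarrow> (('a \<Rightarrow> real) \<Rightarrow> real) \<Rightarrow> (('a \<Rightarrow> real) \<Rightarrow> real) \<Rightarrow> ereal" where
  "embedding_norm F N N' = (SUP f\<in>{f\<in>F. N f \<le> 1}. ereal (N' f))"

section \<open>Uniform approximation and tractability\<close>

definition linear_algorithms ::
    "nat \<Rightarrow> ((nat \<Rightarrow> real) \<Rightarrow> real) set \<Rightarrow> (((nat \<Rightarrow> real) \<Rightarrow> real) \<Rightarrow> real) \<Rightarrow> nat \<Rightarrow>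
     (((nat \<Rightarrow> real) \<Rightarrow> real) \<Rightarrow> ((nat \<Rightarrow> real) \<Rightarrow> real)) set" where
  "linear_algorithms d F N n =
     {(\<lambda>f x. \<Sum>j=1..n. L j f * g j x) | L g.
        \<forall>j\<in>{1..n}. continuous_linear_functional F N (L j) \<and> g j \<in> Linfty d}"

definition worst_case_error ::
    "nat \<Rightarrow> ((nat \<Rightarrow> real) \<Rightarrow> real) set \<Rightarrow> (((nat \<Rightarrow> real) \<Rightarrow> real) \<Rightarrow> real) \<Rightarrow>
     (((nat \<Rightarrow> real) \<Rightarrow> real) \<Rightarrow> ((nat \<Rightarrow> real) \<Rightarrow> real)) \<Rightarrow> ereal" where
  "worst_case_error d F N A = (SUP f\<in>{f\<in>F. N f \<le> 1}. Linfty_norm d (\<lambda>x. f x - A f x))"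

definition minimal_error ::
    "nat \<Rightarrow> ((nat \<Rightarrow> real) \<Rightarrow> real) set \<Rightarrow> (((nat \<Rightarrow> real) \<Rightarrow> real) \<Rightarrow> real) \<Rightarrow> nat \<Rightarrow> ereal" where
  "minimal_error d F N n = (INF A\<in>linear_algorithms d F N n. worst_case_error d F N A)"

text \<open>The information complexity is \<open>\<infinity>\<close> if no \<open>n\<close> is large enough.\<close>

definition information_complexity ::
    "(nat \<Rightarrow> ((nat \<Rightarrow> real) \<Rightarrow> real) set) \<Rightarrow> (nat \<Rightarrow> ((nat \<Rightarrow> real) \<Rightarrow> real) \<Rightarrow> real) \<Rightarrow>
     real \<Rightarrow> nat \<Rightarrow> enat" where
  "information_complexity F N \<epsilon> d =
     (INF n\<in>{n. minimal_error d (F d) (N d) n \<le> ereal \<epsilon>}. enat n)"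

definition polynomially_bounded :: "(real \<Rightarrow> nat \<Rightarrow> enat) \<Rightarrow> real \<Rightarrow> bool" where
  "polynomially_bounded n q \<longleftrightarrow>
     (\<exists>C>0. \<exists>p>0. \<forall>\<epsilon>\<in>{0<..1}. \<forall>d\<ge>1.
        ereal_of_enat (n \<epsilon> d) \<le> ereal (C * \<epsilon> powr (- p) * real d powr q))"

definition polynomially_tractable ::
    "(nat \<Rightarrow> ((nat \<Rightarrow> real) \<Rightarrow> real) set) \<Rightarrow> (nat \<Rightarrow> ((nat \<Rightarrow> real) \<Rightarrow> real) \<Rightarrow> real) \<Rightarrow> bool" where
  "polynomially_tractable F N \<longleftrightarrow> (\<exists>q\<ge>0. polynomially_bounded (information_complexity F N) q)"

definition strongly_polynomially_tractable ::
    "(nat \<Rightarrow> ((nat \<Rightarrow> real) \<Rightarrow> real) set) \<Rightarrow> (nat \<Rightarrow> ((nat \<Rightarrow> real) \<Rightarrow> real) \<Rightarrow> real) \<Rightarrow> bool" where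
  "strongly_polynomially_tractable F N \<longleftrightarrow> polynomially_bounded (information_complexity F N) 0"

section \<open>Sum exponents\<close>

definition sum_exponent_p :: "(nat \<Rightarrow> nat \<Rightarrow> real) \<Rightarrow> ereal" where
  "sum_exponent_p \<gamma> =
     Inf {ereal \<kappa> | \<kappa>. 0 \<le> \<kappa> \<and> limsup (\<lambda>d. ereal (\<Sum>j=1..d. \<gamma> d j powr \<kappa>)) < \<infinity>}"

definition sum_exponent_q :: "(nat \<Rightarrow> nat \<Rightarrow> real) \<Rightarrow> ereal" where
  "sum_exponent_q \<gamma> =
     Inf {ereal \<kappa> | \<kappa>. 0 \<le> \<kappa> \<and>
       limsup (\<lambda>d. ereal ((\<Sum>j=1..d. \<gamma> d j powr \<kappa>) / ln (real d + 1))) < \<infinity>}"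

end

theory Submission
  imports Defs "HOL-Probability.Probability_Measure"
begin

text \<open>
  The functions \<open>1\<close> and \<open>\<surd>2 cos (\<pi> k x)\<close> are orthogonal in \<open>L\<^sub>2\<close> and in the univariate Sobolev
  space, where their squared norms are \<open>1\<close> and \<open>1 + (\<pi> k)\<^sup>2 / \<gamma>\<close>. Their normalised products form
  an orthonormal basis of the tensor product space, so by Cauchy-Schwarz truncating the expansion of
  \<open>f\<close> to a finite index set \<open>A\<close> costs, uniformly in \<open>x\<close>, at most \<open>\<parallel>f\<parallel>\<close> times the square root of the sum
  of \<open>\<rho>\<^sub>k\<close> over \<open>k \<notin> A\<close>, where \<open>\<rho>\<^sub>k = \<Prod>\<^sub>j \<rho>(\<gamma>\<^sub>j, k\<^sub>j)\<close> with \<open>\<rho>(\<gamma>, 0) = 1\<close> and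
  \<open>\<rho>(\<gamma>, k) = 2 / (1 + (\<pi> k)\<^sup>2 / \<gamma>)\<close> bounds the square of the \<open>k\<close>-th basis function. For \<open>1/2 < s < 1\<close>
  the sum of all \<open>\<rho>\<^sub>k\<^sup>s\<close> is at most \<open>S = exp (c\<^sub>s \<Sum>\<^sub>j \<gamma>\<^sub>j\<^sup>s)\<close>. Taking \<open>A = {k. \<rho>\<^sub>k > \<delta>}\<close> gives
  \<open>|A| \<le> \<delta>\<^sup>-\<^sup>s S\<close> and a tail of at most \<open>\<delta>\<^sup>1\<^sup>-\<^sup>s S\<close>, so \<open>n(\<epsilon>, d)\<close> is bounded by a power of \<open>1/\<epsilon>\<close> times
  powers of \<open>S\<close> and of the embedding norm. If \<open>\<kappa> < t\<close> is admissible in the definition of the sum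
  exponent, then for \<open>s > \<kappa>\<close> both are exponentials of \<open>O(ln (d+1))\<close> or of \<open>O(1)\<close>.
\<close>

section \<open>Absolutely continuous functions\<close>

text \<open>The derivative is expanded in sines: they vanish at 0 and 1, so integration by parts
  leaves no boundary terms and \<open>sine.coeff (deriv f) k\<close> is a multiple of
  \<open>cosine.coeff f (Suc k)\<close> without any boundary condition on f. Parseval in both
  systems then diagonalises the inner product. In d variables the obstacle is that an element of the
  completion is given by its point values alone, and its norm by a definite description over all
  approximating sequences. Coefficients arise as limits along one such sequence, and they must be
  shown to depend on the function only. This reduces to the uniqueness of absolutely convergent
  cosine series on the cube; it makes the norm computable and the coefficients linear functionals
  that an algorithm may use. The restrictions on s have separate origins: s > 1/2 makes the sum of
  k^(-2s) finite, s < 1 leaves a positive power of \<delta> in the tail. An admissible \<kappa>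
  satisfies \<kappa> < t \<le> 1, so some s < 1 exceeds both \<kappa> and 1/2, and boundedness of
  the weights controls the sums with exponents s and t by the one with exponent \<kappa>.\<close>

text \<open>As in the fundamental theorem of calculus for gauge integrals, except that tags in the
  exceptional null set are given a gauge inside an open set of small measure, so that absolute
  continuity controls the increments over their intervals.\<close>

lemma absolutely_continuous_imp_has_integral:
  assumes ac: "absolutely_continuous_on01 f"
    and ab: "0 \<le> a" "a \<le> b" "b \<le> 1"
    and S: "negligible S"
    and f': "\<And>x. x \<in> {a..b} - S \<Longrightarrow> (f has_real_derivative f' x) (at x)"
  shows "(f' has_integral (f b - f a)) {a..b}"
proof (cases "a = b")
  case True
  then show ?thesis by (simp add: has_integral_refl)
next
  case False
  with ab have "a < b" by simp
  \<comment> \<open>With the value 0 on S, a tag in S contributes to the error of the Riemann sum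
    nothing but the increment of f over its interval.\<close>
  define g where "g = (\<lambda>x. if x \<in> S then 0 else f' x)"
  have "(g has_integral (f b - f a)) (cbox a b)"
    unfolding has_integral_factor_content
  proof safe
    fix e :: real
    assume "e > 0"
    have "\<forall>x. \<exists>d>0. x \<in> {a..b} - S \<longrightarrow>
         (\<forall>y\<in>UNIV. norm (y-x) < d \<longrightarrow> norm (f y - f x - (y-x) *\<^sub>R f' x) \<le> e / 2 * norm (y-x))"
    proof
      fix x
      show "\<exists>d>0. x \<in> {a..b} - S \<longrightarrow>
         (\<forall>y\<in>UNIV. norm (y-x) < d \<longrightarrow> norm (f y - f x - (y-x) *\<^sub>R f' x) \<le> e / 2 * norm (y-x))"
      proof (cases "x \<in> {a..b} - S")
        case True
        from f'[OF this] have "(f has_vector_derivative f' x) (at x)"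
          by (simp add: has_real_derivative_iff_has_vector_derivative)
        then show ?thesis
          using \<open>e > 0\<close> unfolding has_vector_derivative_def has_derivative_within_alt
          by (meson half_gt_zero)
      qed (auto intro: exI[of _ 1])
    qed
    then obtain d where d: "\<And>x. 0 < d x"
      "\<And>x y. \<lbrakk>x \<in> {a..b} - S; norm (y-x) < d x\<rbrakk>
          \<Longrightarrow> norm (f y - f x - (y-x) *\<^sub>R f' x) \<le> e / 2 * norm (y-x)"
      by (metis UNIV_I)
    \<comment> \<open>Half of the allowed error \<open>e * (b - a)\<close>; the other half is spent
      on the tags outside S, at rate \<open>e / 2\<close> per unit length.\<close>
    define e2 where "e2 = e * (b - a) / 2"
    have "e2 > 0" using \<open>e > 0\<close> \<open>a < b\<close> by (simp add: e2_def)
    then obtain \<delta> where "\<delta> > 0" and \<delta>: "\<And>I :: (real \<times> real) set. finite I \<Longrightarrow>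
        (\<forall>(u, v)\<in>I. 0 \<le> u \<and> u \<le> v \<and> v \<le> 1) \<Longrightarrow>
        disjoint_family_on (\<lambda>(u, v). {u<..<v}) I \<Longrightarrow>
        (\<Sum>(u, v)\<in>I. v - u) < \<delta> \<Longrightarrow> (\<Sum>(u, v)\<in>I. \<bar>f v - f u\<bar>) < e2"
      using ac unfolding absolutely_continuous_on01_def by meson
    have S0: "S \<in> null_sets lebesgue"
      using S negligible_iff_null_sets by blast
    obtain U where U: "open U" "S \<subseteq> U" "U - S \<in> lmeasurable" "emeasure lebesgue (U - S) < ennreal \<delta>"
      using sets_lebesgue_outer_open[OF null_setsD2[OF S0] \<open>\<delta> > 0\<close>] by metis
    have "emeasure lebesgue U = emeasure lebesgue (U - S)"
      using U(1) S0 by (simp add: emeasure_Diff_null_set)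
    then have Ule: "emeasure lebesgue U < ennreal \<delta>" and Um: "U \<in> lmeasurable"
      using U by (auto simp: fmeasurable_def less_top[symmetric])
    then have Umd: "measure lebesgue U < \<delta>"
      using \<open>\<delta> > 0\<close> by (simp add: emeasure_eq_measure2 ennreal_less_iff)
    define G where "G x = (if x \<in> S then U else ball x (d x))" for x
    show "\<exists>d. gauge d \<and> (\<forall>p. p tagged_division_of (cbox a b) \<and> d fine p \<longrightarrow>
      norm ((\<Sum>(x, k)\<in>p. measure lborel k *\<^sub>R g x) - (f b - f a)) \<le> e * measure lborel (cbox a b))"
    proof (rule exI, safe)
      show "gauge G"
        using U d(1) by (auto simp: gauge_def G_def)
    next
      fix p
      assume ptag: "p tagged_division_of cbox a b" and finep: "G fine p"
      have finp: "finite p" using ptag by blast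
      have fb: "f b - f a = (\<Sum>(x,K)\<in>p. f(Sup K) - f(Inf K))"
        using additive_tagged_division_1[of a b p f] \<open>a < b\<close> ptag by simp
      have ba: "b - a = (\<Sum>(x,K)\<in>p. Sup K - Inf K)"
        using additive_tagged_division_1[of a b p "\<lambda>x. x"] \<open>a < b\<close> ptag by simp
      have K: "Inf K \<le> Sup K \<and> K = {Inf K..Sup K} \<and> x \<in> K \<and> a \<le> Inf K \<and> Sup K \<le> b \<and> K \<subseteq> G x"
        if xK: "(x, K) \<in> p" for x K
      proof -
        obtain u v where k: "K = cbox u v" and "x \<in> K" and kab: "K \<subseteq> cbox a b"
          using tagged_division_ofD(2,3,4)[OF ptag xK] by metis
        moreover have "K \<subseteq> G x" using finep xK by blast
        moreover have "u \<le> v" using \<open>x \<in> K\<close> unfolding k by auto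
        ultimately show ?thesis by auto
      qed
      define q where "q = {n\<in>p. fst n \<in> S}"
      define h where "h = (\<lambda>(x::real,K::real set). measure lborel K *\<^sub>R g x - (f (Sup K) - f (Inf K)))"
      have reg: "norm (h n) \<le> e / 2 * (case n of (x, k) \<Rightarrow> Sup k - Inf k)" if "n \<in> p - q" for n
      proof -
        obtain x L where n: "n = (x, L)" by force
        have nS: "x \<notin> S" using that n by (auto simp: q_def)
        define u v where "u = Inf L" and "v = Sup L"
        have uv: "u \<le> v" "L = {u..v}" "x \<in> L" "a \<le> u" "v \<le> b" "L \<subseteq> ball x (d x)"
          using K[of x L] that nS by (auto simp: n u_def v_def G_def)
        have xab: "x \<in> {a..b} - S" using uv nS by auto
        have "u \<in> L" "v \<in> L" using uv by auto
        then have in_ball: "u \<in> ball x (d x)" "v \<in> ball x (d x)" using uv(6) by blast+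
        have "norm (h n) = norm ((v - u) *\<^sub>R f' x - (f v - f u))"
          using uv nS by (simp add: h_def n g_def u_def[symmetric] v_def[symmetric])
        also have "\<dots> = norm (f u - f x - (u - x) *\<^sub>R f' x - (f v - f x - (v - x) *\<^sub>R f' x))"
          by (auto simp: algebra_simps)
        also have "\<dots> \<le> norm (f u - f x - (u - x) *\<^sub>R f' x) + norm (f v - f x - (v - x) *\<^sub>R f' x)"
          by (rule norm_triangle_ineq4)
        also have "\<dots> \<le> e / 2 * norm (u - x) + e / 2 * norm (v - x)"
          by (intro add_mono d(2)[OF xab]) (use in_ball in \<open>auto simp: dist_real_def\<close>)
        also have "\<dots> = e / 2 * (v - u)"
          using uv by (simp add: field_simps)
        finally show ?thesis by (simp add: n u_def v_def)
      qed
      have sub: "(\<Sum>(x,K)\<in>p - q. Sup K - Inf K) \<le> (\<Sum>(x,K)\<in>p. Sup K - Inf K)"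
        using K by (intro sum_mono2 finp) auto
      have regsum: "norm (\<Sum>n\<in>p - q. h n) \<le> e / 2 * (b - a)"
      proof -
        have "norm (\<Sum>n\<in>p - q. h n) \<le> (\<Sum>n\<in>p - q. e / 2 * (case n of (x, k) \<Rightarrow> Sup k - Inf k))"
          by (rule sum_norm_le) (rule reg)
        also have "\<dots> = e / 2 * (\<Sum>(x,K)\<in>p - q. Sup K - Inf K)"
          by (simp add: sum_distrib_left)
        also have "\<dots> \<le> e / 2 * (b - a)"
          using sub ba \<open>e > 0\<close> by (intro mult_left_mono) auto
        finally show ?thesis .
      qed
      define F where "F = (\<lambda>(x::real,K::real set). (Inf K, Sup K))"
      have disj: "n = n' \<or> {Inf (snd n)<..<Sup (snd n)} \<inter> {Inf (snd n')<..<Sup (snd n')} = {}"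
        if nn: "n \<in> q" "n' \<in> q" for n n'
      proof (rule disjCI)
        assume *: "{Inf (snd n)<..<Sup (snd n)} \<inter> {Inf (snd n')<..<Sup (snd n')} \<noteq> {}"
        obtain x L x' L' where n: "n = (x, L)" "n' = (x', L')" by force
        have "interior L = {Inf L<..<Sup L}" "interior L' = {Inf L'<..<Sup L'}"
          using K[of x L] K[of x' L'] nn interior_atLeastAtMost_real
          unfolding n q_def by (metis (no_types, lifting) mem_Collect_eq)+
        then have "interior L \<inter> interior L' \<noteq> {}" using * by (simp add: n)
        then show "n = n'"
          using tagged_division_ofD(5)[OF ptag] nn unfolding n q_def by blast
      qed
      \<comment> \<open>Absolute continuity speaks of a set of endpoint pairs, so distinct tagged
        intervals must not collapse to one pair. A degenerate interval determines its tag, and two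
        nondegenerate ones with equal ends would overlap.\<close>
      have inj: "inj_on F q"
      proof (rule inj_onI)
        fix n n' assume nn: "n \<in> q" "n' \<in> q" "F n = F n'"
        obtain x L x' L' where n: "n = (x, L)" "n' = (x', L')" by force
        have i: "Inf L = Inf L'" "Sup L = Sup L'" using nn by (auto simp: F_def n)
        have k: "Inf L \<le> Sup L" "L = {Inf L..Sup L}" "x \<in> L" "L' = {Inf L'..Sup L'}" "x' \<in> L'"
          using K[of x L] K[of x' L'] nn unfolding n q_def by auto
        show "n = n'"
        proof (cases "Inf L = Sup L")
          case True
          then show ?thesis using k i n by (metis atLeastAtMost_singleton singletonD)
        next
          case False
          then have "{Inf (snd n)<..<Sup (snd n)} \<inter> {Inf (snd n')<..<Sup (snd n')} \<noteq> {}"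
            using i k by (simp add: n)
          then show ?thesis using disj[OF nn(1,2)] by blast
        qed
      qed
      have finq: "finite q" using finp by (simp add: q_def)
      have df: "disjoint_family_on (\<lambda>(u, v). {u<..<v}) (F ` q)"
        unfolding disjoint_family_on_def using disj inj
        by (fastforce simp: F_def split: prod.splits)
      have "(\<Sum>(u, v)\<in>F ` q. \<bar>f v - f u\<bar>) < e2"
      proof (rule \<delta>)
        show "finite (F ` q)" using finq by simp
        show "\<forall>(u, v)\<in>F ` q. 0 \<le> u \<and> u \<le> v \<and> v \<le> 1"
          using K ab by (fastforce simp: F_def q_def)
        show "disjoint_family_on (\<lambda>(u, v). {u<..<v}) (F ` q)" by (rule df)
        have "(\<Sum>(u, v)\<in>F ` q. v - u) = (\<Sum>n\<in>F ` q. measure lebesgue ((\<lambda>(u, v). {u<..<v}) n))"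
          using K by (intro sum.cong refl) (fastforce simp: F_def q_def)
        also have "\<dots> = measure lebesgue (\<Union>n\<in>F ` q. (\<lambda>(u, v). {u<..<v}) n)"
          by (rule measure_finite_Union[symmetric])
            (use df finq in \<open>auto simp: box_real[symmetric] less_imp_neq[OF emeasure_lborel_box_finite,
              unfolded infinity_ennreal_def] simp del: box_real\<close>)
        also have "\<dots> \<le> measure lebesgue U"
        proof (rule measure_mono_fmeasurable)
          show "(\<Union>n\<in>F ` q. (\<lambda>(u, v). {u<..<v}) n) \<subseteq> U"
          proof (rule UN_least, elim imageE, clarify)
            fix y x L u v assume xL: "(x, L) \<in> q" and y: "y \<in> {u<..<v}" and uv: "(u, v) = F (x, L)"
            have "x \<in> S" "L \<subseteq> G x" "L = {Inf L..Sup L}" using K[of x L] xL by (auto simp: q_def)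
            moreover have "y \<in> {Inf L..Sup L}" using y uv by (simp add: F_def)
            ultimately show "y \<in> U" by (metis G_def subsetD)
          qed
          show "(\<Union>n\<in>F ` q. (\<lambda>(u, v). {u<..<v}) n) \<in> sets lebesgue"
            using finq by (intro sets.finite_UN) (auto split: prod.splits)
        qed (rule Um)
        finally show "(\<Sum>(u, v)\<in>F ` q. v - u) < \<delta>" using Umd by simp
      qed
      also have "(\<Sum>(u, v)\<in>F ` q. \<bar>f v - f u\<bar>) = (\<Sum>n\<in>q. norm (h n))"
        by (subst sum.reindex[OF inj]) (auto intro!: sum.cong simp: F_def h_def q_def g_def)
      finally have singsum: "norm (\<Sum>n\<in>q. h n) \<le> e2"
        by (intro order.trans[OF norm_sum]) simp
      have "(\<Sum>(x, k)\<in>p. measure lborel k *\<^sub>R g x) - (f b - f a) = (\<Sum>n\<in>p. h n)"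
        unfolding fb h_def sum_subtractf[symmetric] by (intro sum.cong) auto
      also have "\<dots> = (\<Sum>n\<in>p - q. h n) + (\<Sum>n\<in>q. h n)"
        using finp by (intro sum.subset_diff) (auto simp: q_def)
      finally show "norm ((\<Sum>(x, k)\<in>p. measure lborel k *\<^sub>R g x) - (f b - f a)) \<le> e * measure lborel (cbox a b)"
        using norm_triangle_mono[OF regsum singsum] \<open>a < b\<close> by (simp add: e2_def field_simps)
    qed
  qed
  then have "(g has_integral (f b - f a)) {a..b}" by simp
  then show ?thesis
    by (rule has_integral_spike[OF S, rotated]) (simp add: g_def)
qed

lemma absolutely_continuous_imp_continuous_on:
  assumes ac: "absolutely_continuous_on01 f"
  shows "continuous_on {0..1} f"
  unfolding continuous_on_iff
proof safe
  fix x e :: real assume x: "x \<in> {0..1}" and "e > 0"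
  then obtain \<delta> where "\<delta> > 0" and \<delta>: "\<And>I :: (real \<times> real) set. finite I \<Longrightarrow>
        (\<forall>(u, v)\<in>I. 0 \<le> u \<and> u \<le> v \<and> v \<le> 1) \<Longrightarrow>
        disjoint_family_on (\<lambda>(u, v). {u<..<v}) I \<Longrightarrow>
        (\<Sum>(u, v)\<in>I. v - u) < \<delta> \<Longrightarrow> (\<Sum>(u, v)\<in>I. \<bar>f v - f u\<bar>) < e"
    using ac unfolding absolutely_continuous_on01_def by meson
  have "dist (f y) (f x) < e" if "y \<in> {0..1}" "dist y x < \<delta>" for y
    using \<delta>[of "{(min x y, max x y)}"] x that
    by (cases "x \<le> y") (auto simp: disjoint_family_on_def dist_real_def abs_minus_commute)
  then show "\<exists>d>0. \<forall>x'\<in>{0..1}. dist x' x < d \<longrightarrow> dist (f x') (f x) < e"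
    using \<open>\<delta> > 0\<close> by blast
qed

text \<open>In the uses below the Lipschitz factor is a trigonometric or affine function, or a
  continuously differentiable one multiplied by the constant 1.\<close>

lemma absolutely_continuous_mult:
  assumes f: "absolutely_continuous_on01 f" and h: "L-lipschitz_on {0..1} h"
  shows "absolutely_continuous_on01 (\<lambda>x. f x * h x)"
proof -
  have "bounded (f ` {0..1})" "bounded (h ` {0..1})"
    using absolutely_continuous_imp_continuous_on[OF f] lipschitz_on_continuous_on[OF h]
    by (simp_all add: compact_continuous_image compact_imp_bounded)
  then obtain B B' where B: "B > 0" "\<And>x. x \<in> {0..1} \<Longrightarrow> \<bar>f x\<bar> \<le> B"
      and B': "B' > 0" "\<And>x. x \<in> {0..1} \<Longrightarrow> \<bar>h x\<bar> \<le> B'"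
    by (fastforce simp: bounded_pos)
  have L: "0 \<le> L" using h by (rule lipschitz_on_nonneg)
  show ?thesis
    unfolding absolutely_continuous_on01_def
  proof (intro allI impI)
    fix e :: real assume "e > 0"
    then have "e / (2 * B') > 0" using B' by simp
    then obtain \<delta> where "\<delta> > 0" and \<delta>: "\<And>I :: (real \<times> real) set. finite I \<Longrightarrow>
        (\<forall>(u, v)\<in>I. 0 \<le> u \<and> u \<le> v \<and> v \<le> 1) \<Longrightarrow>
        disjoint_family_on (\<lambda>(u, v). {u<..<v}) I \<Longrightarrow>
        (\<Sum>(u, v)\<in>I. v - u) < \<delta> \<Longrightarrow> (\<Sum>(u, v)\<in>I. \<bar>f v - f u\<bar>) < e / (2 * B')"
      using f unfolding absolutely_continuous_on01_def by meson
    \<comment> \<open>The second bound limits the contribution of the increments of h to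
      \<open>e / 2\<close>; the summand 1 keeps the denominator positive when L = 0.\<close>
    define \<delta>' where "\<delta>' = min \<delta> (e / (2 * (B * L + 1)))"
    have BL: "B * L \<ge> 0" using B L by simp
    have "\<delta>' > 0" using \<open>\<delta> > 0\<close> \<open>e > 0\<close> BL by (simp add: \<delta>'_def)
    moreover have "(\<Sum>(u, v)\<in>I. \<bar>f v * h v - f u * h u\<bar>) < e"
      if I: "finite I" "\<forall>(u, v)\<in>I. 0 \<le> u \<and> u \<le> v \<and> v \<le> 1"
        "disjoint_family_on (\<lambda>(u, v). {u<..<v}) I" "(\<Sum>(u, v)\<in>I. v - u) < \<delta>'" for I :: "(real \<times> real) set"
    proof -
      have "\<bar>f v * h v - f u * h u\<bar> \<le> B * L * (v - u) + B' * \<bar>f v - f u\<bar>" if "(u, v) \<in> I" for u v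
      proof -
        have uv: "u \<in> {0..1}" "v \<in> {0..1}" "u \<le> v" using I that by force+
        have "f v * h v - f u * h u = f v * (h v - h u) + h u * (f v - f u)" by (simp add: algebra_simps)
        then have "\<bar>f v * h v - f u * h u\<bar> \<le> \<bar>f v\<bar> * \<bar>h v - h u\<bar> + \<bar>h u\<bar> * \<bar>f v - f u\<bar>"
          by (metis abs_mult abs_triangle_ineq)
        also have "\<dots> \<le> B * (L * (v - u)) + B' * \<bar>f v - f u\<bar>"
          using B B' uv lipschitz_onD[OF h uv(2,1)] L
          by (intro add_mono mult_mono) (auto simp: dist_real_def)
        finally show ?thesis by simp
      qed
      then have "(\<Sum>(u, v)\<in>I. \<bar>f v * h v - f u * h u\<bar>) \<le> (\<Sum>(u, v)\<in>I. B * L * (v - u) + B' * \<bar>f v - f u\<bar>)"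
        by (intro sum_mono) auto
      also have "\<dots> = B * L * (\<Sum>(u, v)\<in>I. v - u) + B' * (\<Sum>(u, v)\<in>I. \<bar>f v - f u\<bar>)"
        by (simp add: sum.distrib sum_distrib_left split_def)
      also have "\<dots> < e / 2 + e / 2"
      proof (rule add_le_less_mono)
        have "B * L * (\<Sum>(u, v)\<in>I. v - u) \<le> B * L * (e / (2 * (B * L + 1)))"
          using I(4) BL by (intro mult_left_mono) (auto simp: \<delta>'_def)
        also have "\<dots> \<le> e / 2" using BL \<open>e > 0\<close> by (simp add: field_simps)
        finally show "B * L * (\<Sum>(u, v)\<in>I. v - u) \<le> e / 2" .
        have "(\<Sum>(u, v)\<in>I. \<bar>f v - f u\<bar>) < e / (2 * B')"
          using I by (intro \<delta>) (auto simp: \<delta>'_def)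
        then show "B' * (\<Sum>(u, v)\<in>I. \<bar>f v - f u\<bar>) < e / 2" using B' by (simp add: field_simps)
      qed
      finally show ?thesis by simp
    qed
    ultimately show "\<exists>\<delta>>0. \<forall>I :: (real \<times> real) set. finite I \<longrightarrow>
        (\<forall>(u, v)\<in>I. 0 \<le> u \<and> u \<le> v \<and> v \<le> 1) \<longrightarrow>
        disjoint_family_on (\<lambda>(u, v). {u<..<v}) I \<longrightarrow>
        (\<Sum>(u, v)\<in>I. v - u) < \<delta> \<longrightarrow>
        (\<Sum>(u, v)\<in>I. \<bar>f v * h v - f u * h u\<bar>) < e"
      by blast
  qed
qed

section \<open>Complete orthonormal systems\<close>

text \<open>Measurability of f is a separate condition because the square forgets the sign.\<close>

definition sq_integrable :: "'a measure \<Rightarrow> ('a \<Rightarrow> real) \<Rightarrow> bool" where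
  "sq_integrable M f \<longleftrightarrow> f \<in> borel_measurable M \<and> integrable M (\<lambda>x. (f x)\<^sup>2)"

lemma sq_integrable_bound:
  assumes "f \<in> borel_measurable M" "sq_integrable M g" "\<And>x. x \<in> space M \<Longrightarrow> \<bar>f x\<bar> \<le> \<bar>g x\<bar>"
  shows "sq_integrable M f"
  unfolding sq_integrable_def
proof
  show "integrable M (\<lambda>x. (f x)\<^sup>2)"
  proof (rule Bochner_Integration.integrable_bound)
    show "integrable M (\<lambda>x. (g x)\<^sup>2)" using assms(2) by (simp add: sq_integrable_def)
    show "AE x in M. norm ((f x)\<^sup>2) \<le> norm ((g x)\<^sup>2)"
      using assms(3) by (intro AE_I2) (simp add: abs_le_square_iff)
  qed (use assms(1) in simp)
qed (rule assms)

lemma abs_mult_le_sum_squares: "\<bar>a * b\<bar> \<le> a\<^sup>2 + (b::real)\<^sup>2"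
proof -
  have "2 * \<bar>a * b\<bar> \<le> a\<^sup>2 + b\<^sup>2"
    using sum_squares_bound[of "\<bar>a\<bar>" "\<bar>b\<bar>"] by (simp add: abs_mult mult.assoc)
  then show ?thesis using abs_ge_zero[of "a * b"] by linarith
qed

lemma integrable_mult_sq_integrable:
  assumes "sq_integrable M f" "sq_integrable M g"
  shows "integrable M (\<lambda>x. f x * g x)"
proof (rule Bochner_Integration.integrable_bound)
  show "integrable M (\<lambda>x. (f x)\<^sup>2 + (g x)\<^sup>2)" using assms by (simp add: sq_integrable_def)
  show "AE x in M. norm (f x * g x) \<le> norm ((f x)\<^sup>2 + (g x)\<^sup>2)"
    by (intro AE_I2) (simp add: abs_mult_le_sum_squares)
qed (use assms in \<open>auto simp: sq_integrable_def\<close>)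

lemma sq_integrable_add:
  assumes "sq_integrable M f" "sq_integrable M g"
  shows "sq_integrable M (\<lambda>x. f x + g x)"
  using assms integrable_mult_sq_integrable[OF assms]
  by (auto simp: sq_integrable_def power2_sum mult.assoc)

lemma sq_integrable_cmult: "sq_integrable M f \<Longrightarrow> sq_integrable M (\<lambda>x. c * f x)"
  by (auto simp: sq_integrable_def power_mult_distrib)

lemma sq_integrable_diff:
  assumes "sq_integrable M f" "sq_integrable M g"
  shows "sq_integrable M (\<lambda>x. f x - g x)"
  using sq_integrable_add[OF assms(1) sq_integrable_cmult[OF assms(2), of "-1"]] by simp

lemma integral_square_add_le:
  assumes "sq_integrable M f" "sq_integrable M g"
  shows "(\<integral>x. (f x + g x)\<^sup>2 \<partial>M) \<le> 2 * (\<integral>x. (f x)\<^sup>2 \<partial>M) + 2 * (\<integral>x. (g x)\<^sup>2 \<partial>M)"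
proof -
  have "(f x + g x)\<^sup>2 \<le> 2 * (f x)\<^sup>2 + 2 * (g x)\<^sup>2" for x
    using sum_squares_bound[of "f x" "g x"] by (simp add: power2_sum)
  then have "(\<integral>x. (f x + g x)\<^sup>2 \<partial>M) \<le> (\<integral>x. 2 * (f x)\<^sup>2 + 2 * (g x)\<^sup>2 \<partial>M)"
    using assms sq_integrable_add[OF assms] by (intro integral_mono) (auto simp: sq_integrable_def)
  also have "\<dots> = 2 * (\<integral>x. (f x)\<^sup>2 \<partial>M) + 2 * (\<integral>x. (g x)\<^sup>2 \<partial>M)"
    using assms by (subst Bochner_Integration.integral_add) (auto simp: sq_integrable_def)
  finally show ?thesis .
qed

text \<open>Instantiated for the cosines and for the sines. Completeness is expressed as mean-square
  density of finite combinations, the form that Weierstrass approximation delivers.\<close>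

locale complete_orthonormal =
  fixes M :: "'a measure" and e :: "nat \<Rightarrow> 'a \<Rightarrow> real"
  assumes sq_integrable_basis: "sq_integrable M (e k)"
    and orthonormal: "(\<integral>x. e j x * e k x \<partial>M) = (if j = k then 1 else 0)"
    and dense: "sq_integrable M g \<Longrightarrow> 0 < \<epsilon> \<Longrightarrow> \<exists>n a. (\<integral>x. (g x - (\<Sum>k<n. a k * e k x))\<^sup>2 \<partial>M) < \<epsilon>"
begin

definition coeff :: "('a \<Rightarrow> real) \<Rightarrow> nat \<Rightarrow> real" where
  "coeff g k = (\<integral>x. g x * e k x \<partial>M)"

text \<open>Completing the square separates the error into the Bessel defect and the distance of a
  from the true coefficients. Hence any approximant supplied by \<open>dense\<close> bounds the
  Bessel defect.\<close>

lemma integral_square_diff: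
  assumes g: "sq_integrable M g"
  shows "(\<integral>x. (g x - (\<Sum>k<n. a k * e k x))\<^sup>2 \<partial>M) =
    (\<integral>x. (g x)\<^sup>2 \<partial>M) - (\<Sum>k<n. (coeff g k)\<^sup>2) + (\<Sum>k<n. (coeff g k - a k)\<^sup>2)"
proof -
  have i1: "integrable M (\<lambda>x. g x * e k x)" for k
    using g sq_integrable_basis by (rule integrable_mult_sq_integrable)
  have i2: "integrable M (\<lambda>x. e j x * e k x)" for j k
    using sq_integrable_basis by (intro integrable_mult_sq_integrable)
  have i0: "integrable M (\<lambda>x. (g x)\<^sup>2)" using g by (simp add: sq_integrable_def)
  have "(g x - (\<Sum>k<n. a k * e k x))\<^sup>2 = (g x)\<^sup>2 - (\<Sum>k<n. 2 * a k * (g x * e k x)) +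
      (\<Sum>j<n. \<Sum>k<n. a j * a k * (e j x * e k x))" for x
    unfolding power2_diff power2_eq_square[of "\<Sum>k<n. a k * e k x"] sum_product
    by (simp add: sum_distrib_left ac_simps)
  then have "(\<integral>x. (g x - (\<Sum>k<n. a k * e k x))\<^sup>2 \<partial>M) =
      (\<integral>x. (g x)\<^sup>2 - (\<Sum>k<n. 2 * a k * (g x * e k x)) +
        (\<Sum>j<n. \<Sum>k<n. a j * a k * (e j x * e k x)) \<partial>M)"
    by simp
  also have "\<dots> = (\<integral>x. (g x)\<^sup>2 \<partial>M) - (\<Sum>k<n. 2 * a k * coeff g k) +
        (\<Sum>j<n. \<Sum>k<n. a j * a k * (if j = k then 1 else 0))"
    using i0 i1 i2 by (simp add: coeff_def orthonormal)
  also have "(\<Sum>j<n. \<Sum>k<n. a j * a k * (if j = k then 1 else 0)) = (\<Sum>k<n. (a k)\<^sup>2)"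
    by (simp add: if_distrib power2_eq_square cong: if_cong)
  finally show ?thesis
    by (simp add: power2_diff sum.distrib sum_subtractf algebra_simps)
qed

lemma parseval_square:
  assumes g: "sq_integrable M g"
  shows "(\<lambda>k. (coeff g k)\<^sup>2) sums (\<integral>x. (g x)\<^sup>2 \<partial>M)"
proof -
  let ?I = "\<integral>x. (g x)\<^sup>2 \<partial>M" and ?S = "\<lambda>n. \<Sum>k<n. (coeff g k)\<^sup>2"
  have le: "?S n \<le> ?I" for n
  proof -
    have "0 \<le> (\<integral>x. (g x - (\<Sum>k<n. coeff g k * e k x))\<^sup>2 \<partial>M)" by simp
    then show ?thesis by (simp add: integral_square_diff[OF g])
  qed
  have "\<exists>no. \<forall>n\<ge>no. norm (?S n - ?I) < r" if r: "r > 0" for r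
  proof -
    obtain n a where "(\<integral>x. (g x - (\<Sum>k<n. a k * e k x))\<^sup>2 \<partial>M) < r"
      using dense[OF g r] by blast
    moreover have "(\<Sum>k<n. (coeff g k - a k)\<^sup>2) \<ge> 0" by (simp add: sum_nonneg)
    ultimately have n: "?I - ?S n < r" by (simp add: integral_square_diff[OF g])
    have "norm (?S m - ?I) < r" if "m \<ge> n" for m
    proof -
      have "?S n \<le> ?S m" using that by (intro sum_mono2) auto
      then show ?thesis using n le[of m] by simp
    qed
    then show ?thesis by blast
  qed
  then show ?thesis unfolding sums_def by (rule LIMSEQ_I)
qed

lemma coeff_add:
  "sq_integrable M g \<Longrightarrow> sq_integrable M h \<Longrightarrow> coeff (\<lambda>x. g x + h x) k = coeff g k + coeff h k"
  unfolding coeff_def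
  by (simp add: distrib_right integrable_mult_sq_integrable sq_integrable_basis)

text \<open>Polarisation of \<open>parseval_square\<close>.\<close>

lemma parseval:
  assumes g: "sq_integrable M g" and h: "sq_integrable M h"
  shows "(\<lambda>k. coeff g k * coeff h k) sums (\<integral>x. g x * h x \<partial>M)"
proof -
  have "(\<lambda>k. ((coeff g k + coeff h k)\<^sup>2 - (coeff g k)\<^sup>2 - (coeff h k)\<^sup>2) / 2) sums
    (((\<integral>x. (g x + h x)\<^sup>2 \<partial>M) - (\<integral>x. (g x)\<^sup>2 \<partial>M) - (\<integral>x. (h x)\<^sup>2 \<partial>M)) / 2)"
    using parseval_square[OF sq_integrable_add[OF g h]] parseval_square[OF g] parseval_square[OF h]
    by (intro sums_divide sums_diff) (simp_all add: coeff_add g h)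
  moreover have "(\<integral>x. (g x + h x)\<^sup>2 \<partial>M) =
      (\<integral>x. (g x)\<^sup>2 \<partial>M) + (\<integral>x. (h x)\<^sup>2 \<partial>M) + 2 * (\<integral>x. g x * h x \<partial>M)"
    using g h integrable_mult_sq_integrable[OF g h]
    by (simp add: power2_sum sq_integrable_def mult.assoc)
  ultimately show ?thesis by (simp add: power2_sum)
qed

lemma summable_coeff_product:
  assumes g: "sq_integrable M g" and h: "sq_integrable M h"
  shows "summable (\<lambda>k. \<bar>coeff g k * coeff h k\<bar>)"
proof (rule summable_comparison_test)
  show "summable (\<lambda>k. (coeff g k)\<^sup>2 + (coeff h k)\<^sup>2)"
    using parseval_square[OF g] parseval_square[OF h] by (intro summable_add) (auto simp: sums_iff)
  show "\<exists>N. \<forall>n\<ge>N. norm \<bar>coeff g n * coeff h n\<bar> \<le> (coeff g n)\<^sup>2 + (coeff h n)\<^sup>2"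
    by (simp add: abs_mult_le_sum_squares)
qed

end

section \<open>Lebesgue measure on the unit interval and density of weighted cosine
  polynomials\<close>

abbreviation I01 :: "real measure" where "I01 \<equiv> lebesgue_on {0..1}"

lemma space_I01: "space I01 = {0..1}" by (simp add: space_restrict_space)

lemma emeasure_I01: "emeasure I01 (space I01) = 1"
  by (simp add: space_restrict_space emeasure_restrict_space)

lemma prob_space_I01: "prob_space I01"
  by (rule prob_spaceI) (rule emeasure_I01)

lemma continuous_measurable_I01: "continuous_on {0..1} f \<Longrightarrow> f \<in> borel_measurable I01"
  by (rule continuous_imp_measurable_on_sets_lebesgue) auto

lemma continuous_integrable_I01:
  assumes "continuous_on {0..1} f" shows "integrable I01 (f :: real \<Rightarrow> real)"
  using assms by (rule continuous_imp_integrable_real)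

lemma sq_integrable_continuous:
  assumes "continuous_on {0..1} f" shows "sq_integrable I01 f"
  using assms unfolding sq_integrable_def
  by (auto intro!: continuous_measurable_I01 continuous_integrable_I01 continuous_intros)

lemma integral_I01_square_le:
  fixes f :: "real \<Rightarrow> real"
  assumes "f \<in> borel_measurable I01" "\<And>x. x \<in> {0..1} \<Longrightarrow> \<bar>f x\<bar> \<le> c"
  shows "(\<integral>x. (f x)\<^sup>2 \<partial>I01) \<le> c\<^sup>2"
proof -
  interpret prob_space I01 by (rule prob_space_I01)
  have c: "0 \<le> c" using assms(2)[of 0] abs_ge_zero[of "f 0"] by simp
  have "(\<integral>x. (f x)\<^sup>2 \<partial>I01) \<le> (\<integral>x. c\<^sup>2 \<partial>I01)"
  proof (rule Bochner_Integration.integral_mono)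
    have le: "(f x)\<^sup>2 \<le> c\<^sup>2" if "x \<in> space I01" for x
      using assms(2)[of x] that c by (simp add: space_I01 abs_le_square_iff[symmetric])
    then show "(f x)\<^sup>2 \<le> c\<^sup>2" if "x \<in> space I01" for x using that .
    show "integrable I01 (\<lambda>x. (f x)\<^sup>2)"
      using le by (intro integrable_const_bound[of _ "c\<^sup>2"]) (use assms(1) in auto)
  qed simp
  then show ?thesis using prob_space by (simp add: space_I01)
qed

text \<open>The weight \<open>w = 1\<close> gives the density of the cosines, and \<open>w = sin (\<pi> x)\<close> that of the sines,
  since \<open>sin (\<pi> x) q(cos (\<pi> x))\<close> is a combination of sines.\<close>

lemma weighted_cosine_polynomial_dense:
  fixes G w :: "real \<Rightarrow> real"
  assumes G: "G \<in> borel_measurable I01" and w: "continuous_on {0..1} w" "\<And>x. \<bar>w x\<bar> \<le> 1"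
    and wG: "sq_integrable I01 (\<lambda>x. w x * G x)" and \<epsilon>: "0 < \<epsilon>"
  shows "\<exists>q. (\<integral>x. (w x * G x - w x * poly q (cos (pi * x)))\<^sup>2 \<partial>I01) < \<epsilon>"
proof -
  interpret prob_space I01 by (rule prob_space_I01)
  \<comment> \<open>Truncation to [-b, b]. It makes the target bounded, so that dominated
    convergence also applies to its continuous approximants.\<close>
  define T :: "real \<Rightarrow> real \<Rightarrow> real" where "T b y = max (- b) (min b y)" for b y
  have wm [measurable]: "w \<in> borel_measurable I01" by (rule continuous_measurable_I01[OF w(1)])
  note G [measurable]
  have Tm [measurable]: "(\<lambda>x. T b (f x)) \<in> borel_measurable I01" if [measurable]: "f \<in> borel_measurable I01" for b f
    unfolding T_def by measurable
  have "(\<lambda>n. \<integral>x. (w x * G x - w x * T (real n) (G x))\<^sup>2 \<partial>I01) \<longlonglongrightarrow> (\<integral>x. 0 \<partial>I01)"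
  proof (rule integral_dominated_convergence)
    show "integrable I01 (\<lambda>x. (w x * G x)\<^sup>2)" using wG by (simp add: sq_integrable_def)
    show "AE x in I01. (\<lambda>n. (w x * G x - w x * T (real n) (G x))\<^sup>2) \<longlonglongrightarrow> 0"
    proof (rule AE_I2)
      fix x
      obtain N where N: "\<bar>G x\<bar> \<le> real N" using real_arch_simple by blast
      have "(w x * G x - w x * T (real n) (G x))\<^sup>2 = 0" if "n \<ge> N" for n
      proof -
        have "- real n \<le> G x" "G x \<le> real n" using N that by linarith+
        then have "T (real n) (G x) = G x" by (simp only: T_def min_absorb2 max_absorb2)
        then show ?thesis by simp
      qed
      then show "(\<lambda>n. (w x * G x - w x * T (real n) (G x))\<^sup>2) \<longlonglongrightarrow> 0"
        by (intro tendsto_eventually eventually_sequentiallyI[of N])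
    qed
    have "\<bar>y - T (real n) y\<bar> \<le> \<bar>y\<bar>" for n y by (simp add: T_def)
    then show "AE x in I01. norm ((w x * G x - w x * T (real n) (G x))\<^sup>2) \<le> (w x * G x)\<^sup>2" for n
      by (intro AE_I2) (simp add: right_diff_distrib[symmetric] power_mult_distrib mult_left_mono abs_le_square_iff[symmetric])
  qed measurable
  \<comment> \<open>At the end \<open>integral_square_add_le\<close> is used twice, so the three
    errors enter with factors 2, 4 and 4; bounds of \<open>\<epsilon> / 16\<close> keep the total
    below \<epsilon>.\<close>
  then have "eventually (\<lambda>n. (\<integral>x. (w x * G x - w x * T (real n) (G x))\<^sup>2 \<partial>I01) < \<epsilon> / 16) sequentially"
    using \<epsilon> by (intro order_tendstoD(2)[where y = "\<integral>x. 0 \<partial>I01"]) auto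
  then obtain b :: nat where b: "(\<integral>x. (w x * G x - w x * T (real b) (G x))\<^sup>2 \<partial>I01) < \<epsilon> / 16"
    by (auto simp: eventually_sequentially)
  define H where "H x = T (real b) (G x)" for x
  have Hm [measurable]: "H \<in> borel_measurable I01" unfolding H_def by measurable
  have "(\<lambda>x. if x \<in> {0..1} then H x else 0) \<in> borel_measurable lebesgue"
    using Hm by (subst borel_measurable_if) auto
  then have "(\<lambda>x. if x \<in> {0..1} then H x else 0) measurable_on {0..1}"
    by (intro lebesgue_measurable_imp_measurable_on_real) auto
  then obtain N g where N: "negligible N" and g: "\<And>n. continuous_on UNIV (g n)"
    and lim: "\<And>x. x \<notin> N \<Longrightarrow> (\<lambda>n. g n x) \<longlonglongrightarrow> (if x \<in> {0..1} then H x else 0)"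
    unfolding measurable_on_def by (auto cong: if_cong)
  \<comment> \<open>Truncating the continuous approximants gives a bound uniform in n and preserves
    the limit, because H already lies in [-b, b].\<close>
  define h where "h n x = T (real b) (g n x)" for n x
  have hc: "continuous_on {0..1} (h n)" for n
    unfolding h_def T_def by (intro continuous_intros continuous_on_subset[OF g]) auto
  then have hm [measurable]: "h n \<in> borel_measurable I01" for n by (rule continuous_measurable_I01)
  have Tb: "\<bar>T (real b) y\<bar> \<le> real b" for y by (auto simp: T_def)
  have bound: "\<bar>w x * H x - w x * h n x\<bar> \<le> 2 * real b" for n x
  proof -
    have "\<bar>H x - h n x\<bar> \<le> 2 * real b"
      using Tb[of "G x"] Tb[of "g n x"] unfolding H_def h_def by linarith
    then have "\<bar>w x\<bar> * \<bar>H x - h n x\<bar> \<le> 1 * (2 * real b)"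
      using w(2)[of x] by (intro mult_mono) auto
    then show ?thesis by (simp add: right_diff_distrib[symmetric] abs_mult)
  qed
  have "(\<lambda>n. \<integral>x. (w x * H x - w x * h n x)\<^sup>2 \<partial>I01) \<longlonglongrightarrow> (\<integral>x. 0 \<partial>I01)"
  proof (rule integral_dominated_convergence)
    show "integrable I01 (\<lambda>x. (2 * real b)\<^sup>2)" by simp
    show "AE x in I01. norm ((w x * H x - w x * h n x)\<^sup>2) \<le> (2 * real b)\<^sup>2" for n
      proof (intro AE_I2)
      fix x
      have "\<bar>w x * H x - w x * h n x\<bar> \<le> \<bar>2 * real b\<bar>" using bound[of x n] by simp
      then show "norm ((w x * H x - w x * h n x)\<^sup>2) \<le> (2 * real b)\<^sup>2"
        by (simp only: abs_le_square_iff real_norm_def abs_power2)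
    qed
    have "AE x in lebesgue. x \<notin> N"
      using N by (simp add: negligible_iff_null_sets AE_not_in)
    then have "AE x in I01. x \<notin> N"
      by (subst AE_restrict_space_iff) (auto elim: eventually_mono)
    then show "AE x in I01. (\<lambda>n. (w x * H x - w x * h n x)\<^sup>2) \<longlonglongrightarrow> 0"
    proof (rule AE_mp, intro AE_I2 impI)
      fix x assume "x \<in> space I01" "x \<notin> N"
      then have "(\<lambda>n. g n x) \<longlonglongrightarrow> H x" using lim[of x] by (simp add: space_I01)
      then have "(\<lambda>n. h n x) \<longlonglongrightarrow> T (real b) (H x)" unfolding h_def T_def
        by (intro tendsto_intros)
      moreover have "T (real b) (H x) = H x" by (auto simp: H_def T_def)
      ultimately have "(\<lambda>n. (w x * H x - w x * h n x)\<^sup>2) \<longlonglongrightarrow> (w x * H x - w x * H x)\<^sup>2"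
        by (intro tendsto_intros) simp
      then show "(\<lambda>n. (w x * H x - w x * h n x)\<^sup>2) \<longlonglongrightarrow> 0" by simp
    qed
  qed measurable
  then have "eventually (\<lambda>n. (\<integral>x. (w x * H x - w x * h n x)\<^sup>2 \<partial>I01) < \<epsilon> / 16) sequentially"
    using \<epsilon> by (intro order_tendstoD(2)[where y = "\<integral>x. 0 \<partial>I01"]) auto
  then obtain n where n: "(\<integral>x. (w x * H x - w x * h n x)\<^sup>2 \<partial>I01) < \<epsilon> / 16"
    by (auto simp: eventually_sequentially)
  define \<eta> where "\<eta> = sqrt (\<epsilon> / 16)"
  have \<eta>: "\<eta> > 0" "\<eta>\<^sup>2 = \<epsilon> / 16" using \<epsilon> by (auto simp: \<eta>_def)
  \<comment> \<open>Polynomials in cos (pi x) form an algebra containing the constants, and they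
    separate points of [0, 1] because cos is injective on [0, pi].\<close>
  have "\<exists>p. (\<exists>q. \<forall>x. p x = poly q (cos (pi * x))) \<and> (\<forall>x\<in>{0..1}. \<bar>h n x - p x\<bar> < \<eta>)"
  proof (rule Stone_Weierstrass_HOL[where S = "{0..1::real}" and e = \<eta>
        and P = "\<lambda>p. \<exists>q. \<forall>x. p x = poly q (cos (pi * x))"])
    show "\<exists>q. \<forall>x. c = poly q (cos (pi * x))" for c :: real
      by (rule exI[of _ "[:c:]"]) simp
    show "continuous_on {0..1} f" if ex: "\<exists>q. \<forall>x. f x = poly q (cos (pi * x))" for f :: "real \<Rightarrow> real"
    proof -
      obtain q where "f = (\<lambda>x. poly q (cos (pi * x)))" using ex by auto
      then show ?thesis by (auto intro!: continuous_intros)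
    qed
    show "\<exists>q. \<forall>x. f x + g x = poly q (cos (pi * x))"
      if "(\<exists>q. \<forall>x. f x = poly q (cos (pi * x))) \<and> (\<exists>q. \<forall>x. g x = poly q (cos (pi * x)))"
      for f g :: "real \<Rightarrow> real"
      using that by (metis poly_add)
    show "\<exists>q. \<forall>x. f x * g x = poly q (cos (pi * x))"
      if "(\<exists>q. \<forall>x. f x = poly q (cos (pi * x))) \<and> (\<exists>q. \<forall>x. g x = poly q (cos (pi * x)))"
      for f g :: "real \<Rightarrow> real"
      using that by (metis poly_mult)
    show "\<exists>f. (\<exists>q. \<forall>x. f x = poly q (cos (pi * x))) \<and> f x \<noteq> f y"
      if "x \<in> {0..1} \<and> y \<in> {0..1} \<and> x \<noteq> y" for x y
    proof (intro exI conjI allI)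
      show "cos (pi * z) = poly [:0, 1:] (cos (pi * z))" for z by simp
      show "cos (pi * x) \<noteq> cos (pi * y)"
        using that cos_inj_pi[of "pi * x" "pi * y"] by auto
    qed
  qed (use hc \<eta> in auto)
  then obtain q where q: "\<And>x. x \<in> {0..1} \<Longrightarrow> \<bar>h n x - poly q (cos (pi * x))\<bar> < \<eta>" by metis
  define r where "r x = poly q (cos (pi * x))" for x
  have rc: "continuous_on {0..1} r" unfolding r_def by (intro continuous_intros)
  have rm [measurable]: "r \<in> borel_measurable I01" using rc by (rule continuous_measurable_I01)
  have "(\<integral>x. (w x * h n x - w x * r x)\<^sup>2 \<partial>I01) \<le> \<eta>\<^sup>2"
  proof (rule integral_I01_square_le)
    fix x :: real assume x: "x \<in> {0..1}"
    have "\<bar>w x\<bar> * \<bar>h n x - r x\<bar> \<le> 1 * \<eta>"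
      using w(2)[of x] q[OF x] by (intro mult_mono) (auto simp: r_def)
    then show "\<bar>w x * h n x - w x * r x\<bar> \<le> \<eta>" by (simp add: right_diff_distrib[symmetric] abs_mult)
  qed measurable
  then have i3: "(\<integral>x. (w x * h n x - w x * r x)\<^sup>2 \<partial>I01) \<le> \<epsilon> / 16" by (simp add: \<eta>)
  have s2: "sq_integrable I01 (\<lambda>x. w x * h n x - w x * r x)"
    using w(1) hc rc by (intro sq_integrable_continuous continuous_intros)
  have s1: "sq_integrable I01 (\<lambda>x. w x * H x - w x * h n x)"
    proof (rule sq_integrable_bound[of _ _ "\<lambda>x. 2 * real b"])
    show "sq_integrable I01 (\<lambda>x. 2 * real b)" by (simp add: sq_integrable_def)
  qed (use bound[of _ n] in simp_all)
  have s0: "sq_integrable I01 (\<lambda>x. w x * G x - w x * H x)"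
    unfolding sq_integrable_def
  proof
    have "sq_integrable I01 (\<lambda>x. w x * H x)"
      proof (rule sq_integrable_bound[OF _ wG])
      have "\<bar>H x\<bar> \<le> \<bar>G x\<bar>" for x by (simp add: H_def T_def)
      then show "\<bar>w x * H x\<bar> \<le> \<bar>w x * G x\<bar>" for x by (simp add: abs_mult mult_left_mono)
    qed measurable
    from sq_integrable_diff[OF wG this] show "integrable I01 (\<lambda>x. (w x * G x - w x * H x)\<^sup>2)"
      by (simp add: sq_integrable_def)
  qed measurable
  have "(\<integral>x. (w x * G x - w x * r x)\<^sup>2 \<partial>I01) =
      (\<integral>x. ((w x * G x - w x * H x) + ((w x * H x - w x * h n x) + (w x * h n x - w x * r x)))\<^sup>2 \<partial>I01)"
    by simp
  also have "\<dots> \<le> 2 * (\<integral>x. (w x * G x - w x * H x)\<^sup>2 \<partial>I01) +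
      2 * (\<integral>x. ((w x * H x - w x * h n x) + (w x * h n x - w x * r x))\<^sup>2 \<partial>I01)"
    by (rule integral_square_add_le[OF s0 sq_integrable_add[OF s1 s2]])
  also have "(\<integral>x. ((w x * H x - w x * h n x) + (w x * h n x - w x * r x))\<^sup>2 \<partial>I01) \<le>
      2 * (\<integral>x. (w x * H x - w x * h n x)\<^sup>2 \<partial>I01) + 2 * (\<integral>x. (w x * h n x - w x * r x)\<^sup>2 \<partial>I01)"
    by (rule integral_square_add_le[OF s1 s2])
  finally have "(\<integral>x. (w x * G x - w x * r x)\<^sup>2 \<partial>I01) < \<epsilon>"
    using b[folded H_def] n i3 \<epsilon> by simp
  then show ?thesis unfolding r_def by blast
qed

section \<open>The cosine and sine systems on the unit interval\<close>

lemma integral_I01_FTC: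
  assumes "continuous_on {0..1} f" "\<And>x. (F has_real_derivative f x) (at x)"
  shows "(\<integral>x. f x \<partial>I01) = F 1 - F 0"
proof -
  have "(f has_integral (F 1 - F 0)) {0..1}"
    using assms(2) by (intro fundamental_theorem_of_calculus)
      (auto simp: has_real_derivative_iff_has_vector_derivative has_vector_derivative_at_within)
  then have "integral {0..1} f = F 1 - F 0" by (rule integral_unique)
  moreover have "(\<integral>x. f x \<partial>I01) = integral {0..1} f"
    using continuous_integrable_I01[OF assms(1)] by (intro lebesgue_integral_eq_integral) auto
  ultimately show ?thesis by simp
qed

lemma integral_cos_of_int: "(\<integral>x. cos (pi * of_int m * x) \<partial>I01) = (if m = 0 then 1 else 0)"
proof (cases "m = 0")
  case True
  then show ?thesis using integral_I01_FTC[of "\<lambda>x. 1" "\<lambda>x. x"] by simp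
next
  case False
  have "(\<integral>x. cos (pi * of_int m * x) \<partial>I01) =
      sin (pi * of_int m * 1) / (pi * of_int m) - sin (pi * of_int m * 0) / (pi * of_int m)"
    by (rule integral_I01_FTC)
      (use False in \<open>auto intro!: continuous_intros derivative_eq_intros simp: field_simps\<close>)
  also have "sin (pi * of_int m * 1) = 0" by (metis mult.commute mult.right_neutral sin_npi_int)
  finally show ?thesis using False by simp
qed

lemma integrable_cos_I01: "integrable I01 (\<lambda>x. cos (a * x))"
  by (intro continuous_integrable_I01 continuous_intros)

text \<open>The second summand appears only for j = k = 0, where both frequencies in the
  product-to-sum formula vanish.\<close>

lemma integral_cos_cos:
  "(\<integral>x. cos (pi * real j * x) * cos (pi * real k * x) \<partial>I01) =
    ((if j = k then 1 else 0) + (if j + k = 0 then 1 else 0)) / 2"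
proof -
  have "cos (pi * real j * x) * cos (pi * real k * x) =
      (cos (pi * of_int (int j - int k) * x) + cos (pi * of_int (int j + int k) * x)) / 2" for x
    by (simp add: cos_times_cos algebra_simps)
  then have "(\<integral>x. cos (pi * real j * x) * cos (pi * real k * x) \<partial>I01) =
      ((\<integral>x. cos (pi * of_int (int j - int k) * x) \<partial>I01) +
        (\<integral>x. cos (pi * of_int (int j + int k) * x) \<partial>I01)) / 2"
    by (simp only: integral_divide_zero Bochner_Integration.integral_add integrable_cos_I01)
  then show ?thesis unfolding integral_cos_of_int by auto
qed

lemma integral_sin_sin:
  "(\<integral>x. sin (pi * real j * x) * sin (pi * real k * x) \<partial>I01) =
    ((if j = k then 1 else 0) - (if j + k = 0 then 1 else 0)) / 2"
proof -
  have "sin (pi * real j * x) * sin (pi * real k * x) =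
      (cos (pi * of_int (int j - int k) * x) - cos (pi * of_int (int j + int k) * x)) / 2" for x
    by (simp add: sin_times_sin algebra_simps)
  then have "(\<integral>x. sin (pi * real j * x) * sin (pi * real k * x) \<partial>I01) =
      ((\<integral>x. cos (pi * of_int (int j - int k) * x) \<partial>I01) -
        (\<integral>x. cos (pi * of_int (int j + int k) * x) \<partial>I01)) / 2"
    by (simp only: integral_divide_zero Bochner_Integration.integral_diff integrable_cos_I01)
  then show ?thesis unfolding integral_cos_of_int by auto
qed

definition cos_basis :: "nat \<Rightarrow> real \<Rightarrow> real" where
  "cos_basis k x = (if k = 0 then 1 else sqrt 2 * cos (pi * real k * x))"

text \<open>The frequency is shifted by one because sin 0 is the zero function; thus
  \<open>sin_basis k\<close> is paired with \<open>cos_basis (Suc k)\<close>.\<close>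

definition sin_basis :: "nat \<Rightarrow> real \<Rightarrow> real" where
  "sin_basis k x = sqrt 2 * sin (pi * real (Suc k) * x)"

section \<open>Finite linear combinations of a function system\<close>

definition finite_combination :: "(nat \<Rightarrow> real \<Rightarrow> real) \<Rightarrow> (real \<Rightarrow> real) \<Rightarrow> bool" where
  "finite_combination e g \<longleftrightarrow> (\<exists>n a. \<forall>x. g x = (\<Sum>k<n. a k * e k x))"

lemma finite_combination_basis: "finite_combination e (\<lambda>x. c * e k x)"
proof -
  have "(\<Sum>j<Suc k. (if j = k then c else 0) * e j x) = c * e k x" for x
    by (simp add: if_distrib[where f="\<lambda>y. y * _"] cong: if_cong)
  then show ?thesis unfolding finite_combination_def by metis
qed

lemma finite_combination_add:
  assumes "finite_combination e f" "finite_combination e g"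
  shows "finite_combination e (\<lambda>x. f x + g x)"
proof -
  obtain n a m b where f: "\<And>x. f x = (\<Sum>k<n. a k * e k x)" and g: "\<And>x. g x = (\<Sum>k<m. b k * e k x)"
    using assms unfolding finite_combination_def by metis
  have "(\<Sum>k<max n m. (if k < p then c k else 0) * e k x) = (\<Sum>k<p. c k * e k x)"
    if "p \<le> max n m" for p x and c :: "nat \<Rightarrow> real"
    by (rule sum.mono_neutral_cong_right) (use that in auto)
  then have "f x + g x = (\<Sum>k<max n m. ((if k < n then a k else 0) + (if k < m then b k else 0)) * e k x)" for x
    by (simp add: f g distrib_right sum.distrib)
  then show ?thesis unfolding finite_combination_def
    by (intro exI[of _ "max n m"] exI[of _ "\<lambda>k. (if k < n then a k else 0) + (if k < m then b k else 0)"]) simp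
qed

lemma finite_combination_sum:
  "(\<And>k. k < n \<Longrightarrow> finite_combination e (f k)) \<Longrightarrow> finite_combination e (\<lambda>x. \<Sum>k<(n::nat). f k x)"
proof (induction n)
  case 0
  show ?case unfolding finite_combination_def by (rule exI[of _ 0]) simp
qed (simp add: finite_combination_add)

lemma finite_combination_cmult:
  assumes "finite_combination e f" shows "finite_combination e (\<lambda>x. c * f x)"
proof -
  obtain n a where f: "\<And>x. f x = (\<Sum>k<n. a k * e k x)"
    using assms unfolding finite_combination_def by metis
  then have "c * f x = (\<Sum>k<n. (c * a k) * e k x)" for x
    by (simp add: sum_distrib_left mult.assoc)
  then show ?thesis unfolding finite_combination_def by metis
qed

text \<open>Horner's scheme: the hypothesis makes the span closed under multiplication by cos (pi
  x). The factor \<open>e 0\<close> is 1 for the cosines and a multiple of sin (pi x) for the sines,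
  so one induction serves both systems.\<close>

lemma finite_combination_poly_cos:
  assumes e: "\<And>k. finite_combination e (\<lambda>x. cos (pi * x) * e k x)"
  shows "finite_combination e (\<lambda>x. e 0 x * poly q (cos (pi * x)))"
proof (induction q)
  case 0
  show ?case using finite_combination_basis[of e 0 0] by simp
next
  case (pCons c q)
  obtain n a where q: "\<And>x. e 0 x * poly q (cos (pi * x)) = (\<Sum>k<n. a k * e k x)"
    using pCons(2) unfolding finite_combination_def by metis
  have "e 0 x * poly (pCons c q) (cos (pi * x)) =
      c * e 0 x + cos (pi * x) * (e 0 x * poly q (cos (pi * x)))" for x
    by (simp add: algebra_simps)
  also have "\<dots> x = c * e 0 x + (\<Sum>k<n. a k * (cos (pi * x) * e k x))" for x
    unfolding q by (simp add: sum_distrib_left mult.left_commute)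
  finally show ?case
    by (simp add: finite_combination_add finite_combination_basis finite_combination_sum
        finite_combination_cmult e)
qed

lemma continuous_cos_basis [continuous_intros]: "continuous_on S (cos_basis k)"
  unfolding cos_basis_def by (cases "k = 0") (auto intro!: continuous_intros)

lemma continuous_sin_basis [continuous_intros]: "continuous_on S (sin_basis k)"
  unfolding sin_basis_def by (intro continuous_intros)

lemma sq_integrable_eq_AE:
  assumes "f \<in> borel_measurable M" "sq_integrable M g" "AE x in M. f x = g x"
  shows "sq_integrable M f"
  unfolding sq_integrable_def
proof
  have "integrable M (\<lambda>x. (f x)\<^sup>2) \<longleftrightarrow> integrable M (\<lambda>x. (g x)\<^sup>2)"
    by (rule integrable_cong_AE) (use assms in \<open>auto simp: sq_integrable_def\<close>)
  then show "integrable M (\<lambda>x. (f x)\<^sup>2)" using assms(2) by (simp add: sq_integrable_def)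
qed (rule assms)

interpretation cosine: complete_orthonormal I01 cos_basis
proof
  show "sq_integrable I01 (cos_basis k)" for k
    by (intro sq_integrable_continuous continuous_intros)
  have "cos_basis j x * cos_basis k x = (if j = 0 then 1 else sqrt 2) * (if k = 0 then 1 else sqrt 2) *
      (cos (pi * real j * x) * cos (pi * real k * x))" for j k x
    by (simp add: cos_basis_def)
  then show "(\<integral>x. cos_basis j x * cos_basis k x \<partial>I01) = (if j = k then 1 else 0)" for j k
    by (simp add: integral_cos_cos)
  fix g :: "real \<Rightarrow> real" and \<epsilon> :: real
  assume g: "sq_integrable I01 g" and \<epsilon>: "\<epsilon> > 0"
  obtain q where q: "(\<integral>x. (1 * g x - 1 * poly q (cos (pi * x)))\<^sup>2 \<partial>I01) < \<epsilon>"
    using weighted_cosine_polynomial_dense[of g "\<lambda>x. 1" \<epsilon>] g \<epsilon> by (auto simp: sq_integrable_def)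
  have "finite_combination cos_basis (\<lambda>x. cos (pi * x) * cos_basis k x)" for k
  proof -
    \<comment> \<open>The constant function lacks the factor sqrt 2, so the product formula changes
      its coefficients wherever index 0 takes part, that is, for k = 0 and k = 1.\<close>
    consider "k = 0" | "k = 1" | m where "k = Suc (Suc m)" by (metis One_nat_def not0_implies_Suc)
    then show ?thesis
    proof cases
      case 1
      then have "cos (pi * x) * cos_basis k x = (1 / sqrt 2) * cos_basis 1 x" for x
        by (simp add: cos_basis_def)
      then show ?thesis by (simp only: finite_combination_basis)
    next
      case 2
      have "cos (pi * x) * cos_basis k x = (1 / 2) * cos_basis 2 x + (sqrt 2 / 2) * cos_basis 0 x" for x
      proof -
        have h: "cos (pi * x) * cos (pi * x) = (cos (pi * real 2 * x) + 1) / 2"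
          using cos_double_cos[of "pi * x"] by (simp add: power2_eq_square ac_simps)
        have "cos (pi * x) * cos_basis k x = sqrt 2 * (cos (pi * x) * cos (pi * x))"
          by (simp add: cos_basis_def 2)
        then show ?thesis unfolding h by (simp add: cos_basis_def field_simps)
      qed
      then show ?thesis by (simp only: finite_combination_basis finite_combination_add)
    next
      case (3 m)
      have "cos (pi * x) * cos_basis k x =
          (1 / 2) * cos_basis (Suc k) x + (1 / 2) * cos_basis (Suc m) x" for x
      proof -
        have "pi * x + pi * real k * x = pi * real (Suc k) * x"
            "pi * x - pi * real k * x = - (pi * real (Suc m) * x)"
          by (simp_all add: 3 algebra_simps)
        then have h: "cos (pi * x) * cos (pi * real k * x) =
            (cos (pi * real (Suc k) * x) + cos (pi * real (Suc m) * x)) / 2"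
          by (simp only: cos_times_cos cos_minus add.commute)
        have "cos (pi * x) * cos_basis k x = sqrt 2 * (cos (pi * x) * cos (pi * real k * x))"
          by (simp add: cos_basis_def 3)
        then show ?thesis unfolding h by (simp add: cos_basis_def field_simps)
      qed
      then show ?thesis by (simp only: finite_combination_basis finite_combination_add)
    qed
  qed
  from finite_combination_poly_cos[OF this, of q] obtain n a where
    na: "\<And>x. poly q (cos (pi * x)) = (\<Sum>k<n. a k * cos_basis k x)"
    unfolding finite_combination_def by (auto simp: cos_basis_def)
  show "\<exists>n a. (\<integral>x. (g x - (\<Sum>k<n. a k * cos_basis k x))\<^sup>2 \<partial>I01) < \<epsilon>"
    using q unfolding na by auto
qed

interpretation sine: complete_orthonormal I01 sin_basis
proof
  show "sq_integrable I01 (sin_basis k)" for k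
    by (intro sq_integrable_continuous continuous_intros)
  have "sin_basis j x * sin_basis k x = 2 * (sin (pi * real (Suc j) * x) * sin (pi * real (Suc k) * x))" for j k x
    by (simp add: sin_basis_def)
  then show "(\<integral>x. sin_basis j x * sin_basis k x \<partial>I01) = (if j = k then 1 else 0)" for j k
    by (simp only: integral_mult_right_zero integral_sin_sin) simp
  fix g :: "real \<Rightarrow> real" and \<epsilon> :: real
  assume g: "sq_integrable I01 g" and \<epsilon>: "\<epsilon> > 0"
  have gm [measurable]: "g \<in> borel_measurable I01" using g by (simp add: sq_integrable_def)
  define w where "w x = sin (pi * x)" for x
  \<comment> \<open>G itself may fail to be square integrable near 0 and 1, which is why the density
    lemma asks this only of w G. On [0, 1] the weight vanishes only at the end points, a null
    set.\<close>
  define G where "G x = g x / w x" for x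
  have wc: "continuous_on {0..1} w" unfolding w_def by (intro continuous_intros)
  have wm [measurable]: "w \<in> borel_measurable I01" using wc by (rule continuous_measurable_I01)
  have Gm [measurable]: "G \<in> borel_measurable I01" unfolding G_def by measurable
  have "AE x in lebesgue. x \<notin> {0, 1}"
    by (intro AE_not_in) (simp add: negligible_iff_null_sets[symmetric])
  then have "AE x in I01. x \<notin> {0, 1}"
    by (subst AE_restrict_space_iff) (auto elim: eventually_mono)
  then have eq: "AE x in I01. w x * G x = g x"
  proof (rule AE_mp, intro AE_I2 impI)
    fix x assume "x \<in> space I01" "x \<notin> {0, 1}"
    then have "0 < pi * x" "pi * x < pi" by (auto simp: space_I01)
    then have "w x > 0" unfolding w_def by (rule sin_gt_zero)
    then show "w x * G x = g x" by (simp add: G_def)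
  qed
  have wG: "sq_integrable I01 (\<lambda>x. w x * G x)"
    by (rule sq_integrable_eq_AE[OF _ g eq]) measurable
  obtain q where q: "(\<integral>x. (w x * G x - w x * poly q (cos (pi * x)))\<^sup>2 \<partial>I01) < \<epsilon>"
    using weighted_cosine_polynomial_dense[OF Gm wc _ wG \<epsilon>] by (auto simp: w_def)
  have "finite_combination sin_basis (\<lambda>x. cos (pi * x) * sin_basis k x)" for k
  proof (cases k)
    case 0
    have "cos (pi * x) * sin_basis k x = (1 / 2) * sin_basis 1 x" for x
      using sin_double[of "pi * x"] by (simp add: sin_basis_def 0 algebra_simps)
    then show ?thesis by (simp only: finite_combination_basis)
  next
    case (Suc m)
    have "cos (pi * x) * sin_basis k x = (1 / 2) * sin_basis (Suc k) x + (1 / 2) * sin_basis m x" for x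
      proof -
      have "pi * real (Suc k) * x + pi * x = pi * real (Suc (Suc k)) * x"
          "pi * real (Suc k) * x - pi * x = pi * real (Suc m) * x"
        by (simp_all add: Suc algebra_simps)
      then have h: "sin (pi * real (Suc k) * x) * cos (pi * x) =
          (sin (pi * real (Suc (Suc k)) * x) + sin (pi * real (Suc m) * x)) / 2"
        by (simp only: sin_times_cos)
      have "cos (pi * x) * sin_basis k x = sqrt 2 * (sin (pi * real (Suc k) * x) * cos (pi * x))"
        by (simp add: sin_basis_def)
      then show ?thesis unfolding h by (simp add: sin_basis_def field_simps)
    qed
    then show ?thesis by (simp only: finite_combination_basis finite_combination_add)
  qed
  \<comment> \<open>The factor \<open>1 / sqrt 2\<close> turns \<open>sin_basis 0\<close> into the
    weight w.\<close>
  from finite_combination_cmult[OF finite_combination_poly_cos[OF this, of q], of "1 / sqrt 2"]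
  have "finite_combination sin_basis (\<lambda>x. w x * poly q (cos (pi * x)))"
    by (simp add: sin_basis_def w_def)
  then obtain n a where na: "\<And>x. w x * poly q (cos (pi * x)) = (\<Sum>k<n. a k * sin_basis k x)"
    unfolding finite_combination_def by blast
  have sm: "(\<lambda>x. \<Sum>k<n. a k * sin_basis k x) \<in> borel_measurable I01"
    by (intro continuous_measurable_I01 continuous_intros)
  have "(\<integral>x. (g x - (\<Sum>k<n. a k * sin_basis k x))\<^sup>2 \<partial>I01) =
      (\<integral>x. (w x * G x - (\<Sum>k<n. a k * sin_basis k x))\<^sup>2 \<partial>I01)"
    proof (rule integral_cong_AE)
    show "AE x in I01. (g x - (\<Sum>k<n. a k * sin_basis k x))\<^sup>2 =
        (w x * G x - (\<Sum>k<n. a k * sin_basis k x))\<^sup>2"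
      using eq by (rule AE_mp) (intro AE_I2 impI, simp)
  qed (use sm in measurable)
  also have "\<dots> < \<epsilon>" using q by (simp only: na)
  finally show "\<exists>n a. (\<integral>x. (g x - (\<Sum>k<n. a k * sin_basis k x))\<^sup>2 \<partial>I01) < \<epsilon>" by blast
qed

section \<open>Cosine expansions of univariate Sobolev functions\<close>

lemma sobolev1_continuous: "f \<in> sobolev1 \<Longrightarrow> continuous_on {0..1} f"
  by (simp add: sobolev1_def absolutely_continuous_imp_continuous_on)

lemma sobolev1_sq_integrable: "f \<in> sobolev1 \<Longrightarrow> sq_integrable I01 f"
  by (intro sq_integrable_continuous sobolev1_continuous)

lemma sobolev1_deriv_sq_integrable: "f \<in> sobolev1 \<Longrightarrow> sq_integrable I01 (deriv f)"
  by (simp add: sobolev1_def sq_integrable_def)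

lemma C1_imp_lipschitz_on_I01:
  fixes h h' :: "real \<Rightarrow> real"
  assumes h: "\<And>x. (h has_real_derivative h' x) (at x)" and c: "continuous_on {0..1} h'"
  obtains L where "L-lipschitz_on {0..1} h"
proof -
  have "bounded (h' ` {0..1})"
    using c by (simp add: compact_continuous_image compact_imp_bounded)
  then obtain B where B: "B > 0" "\<And>x. x \<in> {0..1} \<Longrightarrow> \<bar>h' x\<bar> \<le> B"
    by (fastforce simp: bounded_pos)
  have "B-lipschitz_on {0..1} h"
  proof (rule bounded_derivative_imp_lipschitz)
    show "(h has_derivative (*) (h' x)) (at x within {0..1})" for x
      using h[of x] by (simp add: has_field_derivative_def has_derivative_at_withinI)
    show "onorm ((*) (h' x)) \<le> B" if "x \<in> {0..1}" for x
      using B(2)[OF that] by (intro onorm_le) (simp add: abs_mult mult_right_mono)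
  qed (use B in auto)
  then show ?thesis by (rule that)
qed

lemma C1_imp_sobolev1:
  fixes h h' :: "real \<Rightarrow> real"
  assumes h: "\<And>x. (h has_real_derivative h' x) (at x)" and c: "continuous_on {0..1} h'"
  shows "h \<in> sobolev1"
proof -
  obtain L where L: "L-lipschitz_on {0..1} h" using C1_imp_lipschitz_on_I01[OF assms] .
  \<comment> \<open>Absolute continuity of h is read off from the product lemma with this constant
    factor.\<close>
  have "absolutely_continuous_on01 (\<lambda>x. 1)"
    unfolding absolutely_continuous_on01_def by (auto intro: exI[of _ 1])
  from absolutely_continuous_mult[OF this L] have "absolutely_continuous_on01 h" by simp
  moreover have "deriv h = h'" using h by (intro ext DERIV_imp_deriv)
  moreover have "sq_integrable I01 h'" using c by (rule sq_integrable_continuous)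
  ultimately show ?thesis
    using h by (auto simp: sobolev1_def sq_integrable_def field_differentiable_def)
qed

text \<open>The product f h is absolutely continuous and obeys the product rule off the null set
  where f is not differentiable. Subintervals are allowed because a kernel with a jump will be
  treated separately on both sides of it.\<close>

lemma sobolev1_integral_by_parts:
  assumes f: "f \<in> sobolev1"
    and ab: "0 \<le> a" "a \<le> b" "b \<le> 1"
    and h: "\<And>x. (h has_real_derivative h' x) (at x)" and c: "continuous_on {0..1} h'"
  shows "((\<lambda>x. deriv f x * h x + f x * h' x) has_integral f b * h b - f a * h a) {a..b}"
proof -
  obtain L where L: "L-lipschitz_on {0..1} h" using C1_imp_lipschitz_on_I01[OF h c] .
  have "AE x in lebesgue. x \<in> {0..1} \<longrightarrow> f field_differentiable at x"
    using f by (simp add: sobolev1_def AE_restrict_space_iff)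
  then obtain S where S: "S \<in> null_sets lebesgue"
      "{x. \<not> (x \<in> {0..1} \<longrightarrow> f field_differentiable at x)} \<subseteq> S"
    by (auto simp: eventually_ae_filter)
  show ?thesis
  proof (rule absolutely_continuous_imp_has_integral)
    show "absolutely_continuous_on01 (\<lambda>x. f x * h x)"
      using f L by (intro absolutely_continuous_mult) (auto simp: sobolev1_def)
    show "negligible S" using S by (simp add: negligible_iff_null_sets)
    show "((\<lambda>x. f x * h x) has_real_derivative deriv f x * h x + f x * h' x) (at x)"
      if "x \<in> {a..b} - S" for x
    proof -
      have "x \<in> {0..1}" "x \<notin> S" using that ab by auto
      then have "f field_differentiable at x" using S(2) by blast
      then show ?thesis
        using h by (auto intro!: derivative_eq_intros simp: field_differentiable_derivI)
    qed
  qed (use ab in auto)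
qed

lemma integral_I01_eqI:
  assumes "integrable I01 g" "(g has_integral (v::real)) {0..1}"
  shows "(\<integral>x. g x \<partial>I01) = v"
  using lebesgue_integral_eq_integral[OF assms(1)] integral_unique[OF assms(2)] by simp

lemma sine_coeff_deriv:
  assumes f: "f \<in> sobolev1"
  shows "sine.coeff (deriv f) k = - (pi * real (Suc k)) * cosine.coeff f (Suc k)"
proof -
  let ?c = "pi * real (Suc k)"
  have d: "(sin_basis k has_real_derivative ?c * cos_basis (Suc k) x) (at x)" for x
    unfolding sin_basis_def cos_basis_def by (auto intro!: derivative_eq_intros simp: field_simps)
  have "((\<lambda>x. deriv f x * sin_basis k x + f x * (?c * cos_basis (Suc k) x)) has_integral
      f 1 * sin_basis k 1 - f 0 * sin_basis k 0) {0..1}"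
    by (rule sobolev1_integral_by_parts[OF f _ _ _ d]) (auto intro!: continuous_intros)
  moreover have "sin_basis k 1 = 0" "sin_basis k 0 = 0"
    unfolding sin_basis_def using sin_npi2[of "Suc k"] by simp_all
  ultimately have hi: "((\<lambda>x. deriv f x * sin_basis k x + f x * (?c * cos_basis (Suc k) x)) has_integral 0) {0..1}"
    by simp
  have i1: "integrable I01 (\<lambda>x. deriv f x * sin_basis k x)"
    using sobolev1_deriv_sq_integrable[OF f] sine.sq_integrable_basis by (rule integrable_mult_sq_integrable)
  have i2: "integrable I01 (\<lambda>x. f x * cos_basis (Suc k) x)"
    using sobolev1_sq_integrable[OF f] cosine.sq_integrable_basis by (rule integrable_mult_sq_integrable)
  then have i3: "integrable I01 (\<lambda>x. f x * (?c * cos_basis (Suc k) x))"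
    by (simp only: mult.left_commute[of _ ?c] integrable_mult_right)
  have "(\<integral>x. deriv f x * sin_basis k x + f x * (?c * cos_basis (Suc k) x) \<partial>I01) = 0"
    by (rule integral_I01_eqI[OF Bochner_Integration.integrable_add[OF i1 i3] hi])
  then have "sine.coeff (deriv f) k + (\<integral>x. f x * (?c * cos_basis (Suc k) x) \<partial>I01) = 0"
    by (simp only: Bochner_Integration.integral_add[OF i1 i3] sine.coeff_def)
  also have "(\<lambda>x. f x * (?c * cos_basis (Suc k) x)) = (\<lambda>x. ?c * (f x * cos_basis (Suc k) x))"
    by (auto simp: ac_simps)
  finally show ?thesis
    unfolding cosine.coeff_def by (simp only: integral_mult_right_zero) (simp add: eq_neg_iff_add_eq_0)
qed

text \<open>The derivative of a Sobolev function need not be continuous, so \<open>L\<^sub>2\<close> convergence of its sine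
  series does not directly give pointwise information; pairing the derivative with this kernel does,
  because it represents the evaluation at \<open>y\<close> up to the mean value.\<close>

definition peano_kernel :: "real \<Rightarrow> real \<Rightarrow> real" where
  "peano_kernel y x = (if x \<le> y then x else x - 1)"

lemma peano_kernel_sq_integrable: "sq_integrable I01 (peano_kernel y)"
proof (rule sq_integrable_bound)
  have "peano_kernel y = (\<lambda>x. indicator {..y} x * x + (1 - indicator {..y} x) * (x - 1))"
    by (auto simp: peano_kernel_def)
  then have "peano_kernel y \<in> borel_measurable borel" by simp
  then show "peano_kernel y \<in> borel_measurable I01"
    by (intro measurable_restrict_space1 measurable_completion) simp
  show "sq_integrable I01 (\<lambda>x. 1)" by (intro sq_integrable_continuous continuous_intros)
  show "\<bar>peano_kernel y x\<bar> \<le> \<bar>1\<bar>" if "x \<in> space I01" for x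
    using that by (auto simp: peano_kernel_def space_I01)
qed

text \<open>Integration by parts with the factor x on [0, y] and x - 1 on [y, 1]: both factors
  vanish at the outer end point, and the jump of height 1 at y leaves exactly f y.\<close>

lemma sobolev1_peano:
  assumes f: "f \<in> sobolev1" and y: "y \<in> {0..1}"
  shows "f y = (\<integral>x. f x \<partial>I01) + (\<integral>x. deriv f x * peano_kernel y x \<partial>I01)"
proof -
  have "((\<lambda>x. deriv f x * x + f x * 1) has_integral f y * y - f 0 * 0) {0..y}"
    by (rule sobolev1_integral_by_parts[OF f]) (use y in \<open>auto intro!: continuous_intros derivative_eq_intros\<close>)
  then have "((\<lambda>x. deriv f x * peano_kernel y x + f x) has_integral f y * y - f 0 * 0) {0..y}"
    by (rule has_integral_eq[rotated]) (simp add: peano_kernel_def)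
  moreover have "((\<lambda>x. deriv f x * (x - 1) + f x * 1) has_integral f 1 * (1 - 1) - f y * (y - 1)) {y..1}"
    by (rule sobolev1_integral_by_parts[OF f]) (use y in \<open>auto intro!: continuous_intros derivative_eq_intros\<close>)
  then have "((\<lambda>x. deriv f x * peano_kernel y x + f x) has_integral f 1 * (1 - 1) - f y * (y - 1)) {y..1}"
    \<comment> \<open>At x = y the kernel follows its left branch, so on the right interval the
      integrands differ at that one point.\<close>
    by (rule has_integral_spike[of "{y}", rotated 2]) (simp_all add: peano_kernel_def)
  ultimately have "((\<lambda>x. deriv f x * peano_kernel y x + f x) has_integral
      (f y * y - f 0 * 0) + (f 1 * (1 - 1) - f y * (y - 1))) {0..1}"
    by (rule has_integral_combine[of 0 y 1, rotated 2]) (use y in simp_all)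
  then have hi: "((\<lambda>x. deriv f x * peano_kernel y x + f x) has_integral f y) {0..1}"
    by (simp add: algebra_simps)
  have i1: "integrable I01 (\<lambda>x. deriv f x * peano_kernel y x)"
    using sobolev1_deriv_sq_integrable[OF f] peano_kernel_sq_integrable by (rule integrable_mult_sq_integrable)
  have i2: "integrable I01 f" by (intro continuous_integrable_I01 sobolev1_continuous f)
  show ?thesis
    using integral_I01_eqI[OF Bochner_Integration.integrable_add[OF i1 i2] hi]
      Bochner_Integration.integral_add[OF i1 i2] by simp
qed

lemma sine_coeff_peano_kernel:
  assumes y: "y \<in> {0..1}"
  shows "pi * real (Suc k) * sine.coeff (peano_kernel y) k = - cos_basis (Suc k) y"
  \<comment> \<open>apply the representation of \<open>f y\<close> to the cosine itself\<close>
proof -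
  let ?c = "pi * real (Suc k)"
  have d: "(cos_basis (Suc k) has_real_derivative - ?c * sin_basis k x) (at x)" for x
    unfolding sin_basis_def cos_basis_def by (auto intro!: derivative_eq_intros simp: field_simps)
  have s: "cos_basis (Suc k) \<in> sobolev1"
    by (rule C1_imp_sobolev1[OF d]) (auto intro!: continuous_intros)
  have "deriv (cos_basis (Suc k)) = (\<lambda>x. - ?c * sin_basis k x)"
    using d by (intro ext DERIV_imp_deriv)
  then have "cos_basis (Suc k) y = (\<integral>x. cos_basis (Suc k) x \<partial>I01) +
      (\<integral>x. (- ?c * sin_basis k x) * peano_kernel y x \<partial>I01)"
    using sobolev1_peano[OF s y] by (simp only:)
  also have "(\<integral>x. cos_basis (Suc k) x \<partial>I01) = (\<integral>x. cos_basis (Suc k) x * cos_basis 0 x \<partial>I01)"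
    by (simp add: cos_basis_def)
  also have "\<dots> = 0" by (simp add: cosine.orthonormal)
  also have "(\<lambda>x. (- ?c * sin_basis k x) * peano_kernel y x) = (\<lambda>x. - ?c * (peano_kernel y x * sin_basis k x))"
    by (auto simp: ac_simps)
  finally show ?thesis
    unfolding sine.coeff_def by (simp only: integral_mult_right_zero) simp
qed

lemma cosine_coeff_0: "cosine.coeff f 0 = (\<integral>x. f x \<partial>I01)"
  by (simp add: cosine.coeff_def cos_basis_def)

text \<open>Parseval applied to the derivative and the kernel gives every term but k = 0, which is
  the mean value. Both functions lie in L_2, so convergence is absolute; the unordered form of the
  sum is what products over several coordinates require.\<close>

lemma sobolev1_expansion:
  assumes f: "f \<in> sobolev1" and y: "y \<in> {0..1}"
  shows "((\<lambda>k. cosine.coeff f k * cos_basis k y) has_sum f y) UNIV"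
proof -
  have eq: "sine.coeff (deriv f) k * sine.coeff (peano_kernel y) k =
      cosine.coeff f (Suc k) * cos_basis (Suc k) y" for k
  proof -
    have "sine.coeff (deriv f) k * sine.coeff (peano_kernel y) k =
        - cosine.coeff f (Suc k) * (pi * real (Suc k) * sine.coeff (peano_kernel y) k)"
      by (simp only: sine_coeff_deriv[OF f]) (simp add: ac_simps)
    also have "\<dots> = cosine.coeff f (Suc k) * cos_basis (Suc k) y"
      unfolding sine_coeff_peano_kernel[OF y] by simp
    finally show ?thesis .
  qed
  note s = sobolev1_deriv_sq_integrable[OF f] peano_kernel_sq_integrable[of y]
  have "(\<lambda>k. cosine.coeff f (Suc k) * cos_basis (Suc k) y) sums
      (\<integral>x. deriv f x * peano_kernel y x \<partial>I01)"
    using sine.parseval[OF s] by (simp only: eq)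
  then have sums: "(\<lambda>k. cosine.coeff f k * cos_basis k y) sums f y"
    by (subst (asm) sums_Suc_iff)
      (simp add: sobolev1_peano[OF f y] cosine_coeff_0 cos_basis_def[of 0] add.commute)
  have "summable (\<lambda>k. norm (cosine.coeff f (Suc k) * cos_basis (Suc k) y))"
    using sine.summable_coeff_product[OF s] by (simp only: eq real_norm_def)
  then have summable: "summable (\<lambda>k. norm (cosine.coeff f k * cos_basis k y))"
    by (subst (asm) summable_Suc_iff)
  show "((\<lambda>k. cosine.coeff f k * cos_basis k y) has_sum f y) UNIV"
    using norm_summable_imp_has_sum[OF summable sums] .
qed

definition basis_weight :: "real \<Rightarrow> nat \<Rightarrow> real" where
  "basis_weight c k = 1 + (pi * real k)\<^sup>2 / c"

text \<open>Parseval in the cosines for the functions plus Parseval in the sines for the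
  derivatives. The factor (pi k)^2 vanishes at k = 0, which absorbs the index shift between the two
  systems.\<close>

lemma sobolev1_inner_expansion:
  assumes f: "f \<in> sobolev1" and g: "g \<in> sobolev1"
  shows "((\<lambda>k. basis_weight c k * (cosine.coeff f k * cosine.coeff g k)) has_sum sobolev1_inner c f g) UNIV"
proof -
  note s = sobolev1_sq_integrable[OF f] sobolev1_sq_integrable[OF g]
  note d = sobolev1_deriv_sq_integrable[OF f] sobolev1_deriv_sq_integrable[OF g]
  let ?p = "\<lambda>k. (pi * real k)\<^sup>2 * (cosine.coeff f k * cosine.coeff g k)"
  have eq: "sine.coeff (deriv f) k * sine.coeff (deriv g) k = ?p (Suc k)" for k
    unfolding sine_coeff_deriv[OF f] sine_coeff_deriv[OF g] by (simp add: power2_eq_square ac_simps)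
  have "(\<lambda>k. ?p (Suc k)) sums (\<integral>x. deriv f x * deriv g x \<partial>I01)"
    using sine.parseval[OF d] by (simp only: eq)
  then have "?p sums (\<integral>x. deriv f x * deriv g x \<partial>I01)"
    by (subst (asm) sums_Suc_iff) simp
  from sums_add[OF cosine.parseval[OF s] sums_mult[OF this, of "1 / c"]]
  have sums: "(\<lambda>k. basis_weight c k * (cosine.coeff f k * cosine.coeff g k)) sums sobolev1_inner c f g"
    by (simp add: sobolev1_inner_def basis_weight_def distrib_right)
  have "summable (\<lambda>k. \<bar>?p (Suc k)\<bar>)"
    using sine.summable_coeff_product[OF d] by (simp only: eq)
  then have "summable (\<lambda>k. \<bar>?p k\<bar>)" by (subst (asm) summable_Suc_iff)
  then have "summable (\<lambda>k. \<bar>cosine.coeff f k * cosine.coeff g k\<bar> + \<bar>1 / c\<bar> * \<bar>?p k\<bar>)"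
    by (intro summable_add summable_mult cosine.summable_coeff_product s)
  then have summable: "summable (\<lambda>k. norm (basis_weight c k * (cosine.coeff f k * cosine.coeff g k)))"
  proof (rule summable_comparison_test[rotated], intro exI allI impI)
    fix k
    have "basis_weight c k * (cosine.coeff f k * cosine.coeff g k) =
        cosine.coeff f k * cosine.coeff g k + 1 / c * ?p k"
      by (simp add: basis_weight_def distrib_right)
    then show "norm (norm (basis_weight c k * (cosine.coeff f k * cosine.coeff g k))) \<le>
        \<bar>cosine.coeff f k * cosine.coeff g k\<bar> + \<bar>1 / c\<bar> * \<bar>?p k\<bar>"
      using abs_triangle_ineq[of "cosine.coeff f k * cosine.coeff g k" "1 / c * ?p k"]
      by (simp only: real_norm_def abs_idempotent abs_mult[of "1 / c"])
  qed
  show "((\<lambda>k. basis_weight c k * (cosine.coeff f k * cosine.coeff g k)) has_sum sobolev1_inner c f g) UNIV"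
    using norm_summable_imp_has_sum[OF summable sums] .
qed

text \<open>Unordered summability of reals is absolute and the cosines are uniformly bounded, so the
  series may be integrated term by term against \<open>cos_basis l\<close>; orthonormality isolates
  the coefficient.\<close>

lemma cos_series_zero:
  assumes s: "c summable_on (UNIV :: nat set)"
    and z: "\<And>x. x \<in> {0..1} \<Longrightarrow> (\<Sum>\<^sub>\<infinity>k. c k * cos_basis k x) = (0::real)"
  shows "c l = 0"
proof -
  have cb: "\<bar>cos_basis k x\<bar> \<le> sqrt 2" for k x
    by (auto simp: cos_basis_def abs_mult mult_left_le)
  have sc: "summable (\<lambda>k. \<bar>c k\<bar>)"
    proof -
    have "(\<lambda>k. norm (c k)) summable_on UNIV"
      using s by (subst (asm) summable_on_iff_abs_summable_on_real)
    then show ?thesis by (subst (asm) summable_on_UNIV_nonneg_real_iff) simp_all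
  qed
  have bound: "norm (c k * cos_basis k x * cos_basis l x) \<le> 2 * \<bar>c k\<bar>" for k x
  proof -
    have "\<bar>cos_basis k x * cos_basis l x\<bar> \<le> sqrt 2 * sqrt 2"
      unfolding abs_mult by (intro mult_mono cb) auto
    then have "\<bar>c k\<bar> * \<bar>cos_basis k x * cos_basis l x\<bar> \<le> \<bar>c k\<bar> * (sqrt 2 * sqrt 2)"
      by (intro mult_left_mono) auto
    then show ?thesis by (simp add: abs_mult mult.assoc)
  qed
  have int: "integrable I01 (\<lambda>x. c k * cos_basis k x * cos_basis l x)" for k
    by (intro continuous_integrable_I01 continuous_intros)
  interpret prob_space I01 by (rule prob_space_I01)
  have ss: "summable (\<lambda>k. norm (c k * cos_basis k x * cos_basis l x))" for x
    by (rule summable_comparison_test[OF _ summable_mult[OF sc, of 2]]) (use bound in auto)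
  have "(\<lambda>k. \<integral>x. c k * cos_basis k x * cos_basis l x \<partial>I01) sums
      (\<integral>x. (\<Sum>k. c k * cos_basis k x * cos_basis l x) \<partial>I01)"
  proof (rule sums_integral[OF int])
    show "summable (\<lambda>k. \<integral>x. norm (c k * cos_basis k x * cos_basis l x) \<partial>I01)"
    proof (rule summable_comparison_test[OF _ summable_mult[OF sc, of 2]], intro exI allI impI)
      fix k
      have "(\<integral>x. norm (c k * cos_basis k x * cos_basis l x) \<partial>I01) \<le> (\<integral>x. 2 * \<bar>c k\<bar> \<partial>I01)"
        using int bound by (intro Bochner_Integration.integral_mono) auto
      then show "norm (\<integral>x. norm (c k * cos_basis k x * cos_basis l x) \<partial>I01) \<le> 2 * \<bar>c k\<bar>"
        using prob_space by (simp add: space_I01)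
    qed
  qed (use ss in auto)
  also have "(\<integral>x. (\<Sum>k. c k * cos_basis k x * cos_basis l x) \<partial>I01) = (\<integral>x. 0 \<partial>I01)"
  proof (rule Bochner_Integration.integral_cong[OF refl])
    fix x assume "x \<in> space I01"
    then have x: "x \<in> {0..1}" by (simp add: space_I01)
    have "summable (\<lambda>k. norm (c k * cos_basis k x))"
    proof (rule summable_comparison_test[OF _ summable_mult[OF sc, of "sqrt 2"]], intro exI allI impI)
      show "norm (norm (c k * cos_basis k x)) \<le> sqrt 2 * \<bar>c k\<bar>" for k
        using mult_left_mono[OF cb, of "\<bar>c k\<bar>"] by (simp add: abs_mult mult.commute)
    qed
    then have "((\<lambda>k. c k * cos_basis k x) has_sum (\<Sum>k. c k * cos_basis k x)) UNIV"
      by (intro norm_summable_imp_has_sum summable_sums) (auto intro: summable_rabs_cancel)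
    then have "(\<Sum>k. c k * cos_basis k x) = 0" using z[OF x] by (simp add: infsumI)
    moreover have "summable (\<lambda>k. c k * cos_basis k x)"
      by (rule summable_norm_cancel) fact
    ultimately show "(\<Sum>k. c k * cos_basis k x * cos_basis l x) = 0"
      by (simp add: suminf_mult2[symmetric])
  qed
  finally have "(\<lambda>k. \<integral>x. c k * cos_basis k x * cos_basis l x \<partial>I01) sums 0" by simp
  moreover have "(\<integral>x. c k * cos_basis k x * cos_basis l x \<partial>I01) = (if k = l then c k else 0)" for k
    using cosine.orthonormal[of k l] by (simp add: mult.assoc)
  ultimately have "(\<lambda>k. if k = l then c k else 0) sums 0" by (simp only:)
  then show "c l = 0" using sums_unique2[OF sums_single[of l c]] by blast
qed

section \<open>Square-summable families\<close>

text \<open>Both families are absolutely summable, hence so is their product family, and the double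
  sum may be taken iteratively.\<close>

lemma has_sum_times:
  fixes f :: "'a \<Rightarrow> real" and g :: "'b \<Rightarrow> real"
  assumes f: "(f has_sum a) A" and g: "(g has_sum b) B"
  shows "((\<lambda>(x, y). f x * g y) has_sum a * b) (A \<times> B)"
proof (rule has_sum_SigmaI)
  show "((\<lambda>y. case (x, y) of (x, y) \<Rightarrow> f x * g y) has_sum f x * b) B" for x
    using has_sum_cmult_right[OF g] by simp
  show "((\<lambda>x. f x * b) has_sum a * b) A"
    by (rule has_sum_cmult_left[OF f])
  have nf: "(\<lambda>x. \<bar>f x\<bar>) summable_on A"
    using has_sum_imp_summable[OF f] by (subst (asm) summable_on_iff_abs_summable_on_real) simp
  have ng: "(\<lambda>x. \<bar>g x\<bar>) summable_on B"
    using has_sum_imp_summable[OF g] by (subst (asm) summable_on_iff_abs_summable_on_real) simp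
  have "(\<lambda>(x, y). norm (f x) * norm (g y)) summable_on A \<times> B"
    by (rule summable_on_SigmaI[where g = "\<lambda>x. norm (f x) * infsum (\<lambda>y. norm (g y)) B"])
      (auto intro!: has_sum_cmult_right has_sum_infsum ng summable_on_cmult_left nf)
  then have "(\<lambda>z. norm (case z of (x, y) \<Rightarrow> f x * g y)) summable_on A \<times> B"
    by (simp add: case_prod_unfold abs_mult)
  then show "(\<lambda>(x, y). f x * g y) summable_on A \<times> B" by (rule abs_summable_summable)
qed

lemma has_sum_PiE_insert:
  assumes "i \<notin> I"
  shows "(f has_sum s) (PiE (insert i I) B) \<longleftrightarrow>
    ((\<lambda>(n, k). f (k(i := n))) has_sum s) (B i \<times> PiE I B)"
proof -
  have "(f has_sum s) (PiE (insert i I) B) \<longleftrightarrow>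
      ((f \<circ> (\<lambda>(n, k). k(i := n))) has_sum s) (B i \<times> PiE I B)"
    unfolding PiE_insert_eq by (rule has_sum_reindex[OF inj_combinator[OF assms]])
  also have "f \<circ> (\<lambda>(n, k). k(i := n)) = (\<lambda>(n, k). f (k(i := n)))" by auto
  finally show ?thesis .
qed

text \<open>Distributivity of a finite product over infinite sums. This carries the univariate
  expansions over to elementary tensors.\<close>

lemma has_sum_prod_PiE:
  fixes f :: "'a \<Rightarrow> 'b \<Rightarrow> real"
  assumes "finite I" "\<And>i. i \<in> I \<Longrightarrow> (f i has_sum s i) (B i)"
  shows "((\<lambda>k. \<Prod>i\<in>I. f i (k i)) has_sum (\<Prod>i\<in>I. s i)) (PiE I B)"
  using assms
proof (induction I rule: finite_induct)
  case empty
  show ?case by (simp add: has_sum_finiteI)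
next
  case (insert i I)
  have "((\<lambda>(n, k). f i n * (\<Prod>j\<in>I. f j (k j))) has_sum s i * (\<Prod>j\<in>I. s j)) (B i \<times> PiE I B)"
    using insert by (intro has_sum_times) auto
  moreover have "(\<Prod>j\<in>I. f j ((k(i := n)) j)) = (\<Prod>j\<in>I. f j (k j))" for n k
    using insert(2) by (intro prod.cong) auto
  ultimately show ?case
    using insert(1,2) by (simp add: has_sum_PiE_insert)
qed

lemma has_sum_sum_list:
  "(\<And>\<phi>. \<phi> \<in> set u \<Longrightarrow> (f \<phi> has_sum s \<phi>) A) \<Longrightarrow>
    ((\<lambda>k. \<Sum>\<phi>\<leftarrow>u. f \<phi> k) has_sum (\<Sum>\<phi>\<leftarrow>u. s \<phi> :: real)) A"
  by (induction u) (auto intro: has_sum_add)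

lemma infsum_cauchy_schwarz:
  fixes f g :: "'a \<Rightarrow> real"
  assumes f: "(\<lambda>k. (f k)\<^sup>2) summable_on A" and g: "(\<lambda>k. (g k)\<^sup>2) summable_on A"
  shows "(\<lambda>k. f k * g k) summable_on A"
    and "\<bar>\<Sum>\<^sub>\<infinity>k\<in>A. f k * g k\<bar> \<le> sqrt (\<Sum>\<^sub>\<infinity>k\<in>A. (f k)\<^sup>2) * sqrt (\<Sum>\<^sub>\<infinity>k\<in>A. (g k)\<^sup>2)"
proof -
  have "(\<Sum>k\<in>F. norm (f k * g k)) \<le> sqrt (\<Sum>\<^sub>\<infinity>k\<in>A. (f k)\<^sup>2) * sqrt (\<Sum>\<^sub>\<infinity>k\<in>A. (g k)\<^sup>2)"
    if F: "finite F" "F \<subseteq> A" for F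
  proof -
    have "(\<Sum>k\<in>F. \<bar>f k\<bar> * \<bar>g k\<bar>)\<^sup>2 \<le> (\<Sum>k\<in>F. \<bar>f k\<bar>\<^sup>2) * (\<Sum>k\<in>F. \<bar>g k\<bar>\<^sup>2)"
      by (rule Cauchy_Schwarz_ineq_sum)
    also have "\<dots> \<le> (\<Sum>\<^sub>\<infinity>k\<in>A. (f k)\<^sup>2) * (\<Sum>\<^sub>\<infinity>k\<in>A. (g k)\<^sup>2)"
      using F by (intro mult_mono) (auto intro!: finite_sum_le_infsum f g sum_nonneg infsum_nonneg)
    finally have "(\<Sum>k\<in>F. \<bar>f k\<bar> * \<bar>g k\<bar>) \<le> sqrt ((\<Sum>\<^sub>\<infinity>k\<in>A. (f k)\<^sup>2) * (\<Sum>\<^sub>\<infinity>k\<in>A. (g k)\<^sup>2))"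
      by (rule real_le_rsqrt)
    then show ?thesis by (simp add: abs_mult real_sqrt_mult)
  qed
  note bound = this
  have abs: "(\<lambda>k. norm (f k * g k)) summable_on A"
    by (rule nonneg_bdd_above_summable_on) (use bound in \<open>auto intro!: bdd_aboveI2\<close>)
  then show "(\<lambda>k. f k * g k) summable_on A" by (rule abs_summable_summable)
  have "norm (\<Sum>\<^sub>\<infinity>k\<in>A. f k * g k) \<le> (\<Sum>\<^sub>\<infinity>k\<in>A. norm (f k * g k))"
    using abs by (rule norm_infsum_bound)
  also have "\<dots> \<le> sqrt (\<Sum>\<^sub>\<infinity>k\<in>A. (f k)\<^sup>2) * sqrt (\<Sum>\<^sub>\<infinity>k\<in>A. (g k)\<^sup>2)"
    by (rule infsum_le_finite_sums[OF abs bound])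
  finally show "\<bar>\<Sum>\<^sub>\<infinity>k\<in>A. f k * g k\<bar> \<le> sqrt (\<Sum>\<^sub>\<infinity>k\<in>A. (f k)\<^sup>2) * sqrt (\<Sum>\<^sub>\<infinity>k\<in>A. (g k)\<^sup>2)"
    by simp
qed

lemma summable_square_add:
  fixes f g :: "'a \<Rightarrow> real"
  assumes f: "(\<lambda>k. (f k)\<^sup>2) summable_on A" and g: "(\<lambda>k. (g k)\<^sup>2) summable_on A"
  shows "(\<lambda>k. (f k + g k)\<^sup>2) summable_on A"
proof -
  have "(\<lambda>k. (f k)\<^sup>2 + (g k)\<^sup>2 + 2 * (f k * g k)) summable_on A"
    by (intro summable_on_add summable_on_cmult_right f g infsum_cauchy_schwarz)
  then show ?thesis by (simp add: power2_sum mult.assoc)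
qed

lemma summable_square_diff:
  fixes f g :: "'a \<Rightarrow> real"
  assumes f: "(\<lambda>k. (f k)\<^sup>2) summable_on A" and g: "(\<lambda>k. (g k)\<^sup>2) summable_on A"
  shows "(\<lambda>k. (f k - g k)\<^sup>2) summable_on A"
  using summable_square_add[OF f, of "\<lambda>k. - g k"] g by simp

lemma infsum_square_diff:
  fixes f g :: "'a \<Rightarrow> real"
  assumes f: "(\<lambda>k. (f k)\<^sup>2) summable_on A" and g: "(\<lambda>k. (g k)\<^sup>2) summable_on A"
  shows "(\<Sum>\<^sub>\<infinity>k\<in>A. (f k - g k)\<^sup>2) =
    (\<Sum>\<^sub>\<infinity>k\<in>A. f k * f k) - 2 * (\<Sum>\<^sub>\<infinity>k\<in>A. f k * g k) + (\<Sum>\<^sub>\<infinity>k\<in>A. g k * g k)"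
proof -
  have "((\<lambda>k. (f k)\<^sup>2 + - 2 * (f k * g k) + (g k)\<^sup>2) has_sum
      (\<Sum>\<^sub>\<infinity>k\<in>A. (f k)\<^sup>2) + - 2 * (\<Sum>\<^sub>\<infinity>k\<in>A. f k * g k) + (\<Sum>\<^sub>\<infinity>k\<in>A. (g k)\<^sup>2)) A"
    by (intro has_sum_add has_sum_cmult_right has_sum_infsum f g infsum_cauchy_schwarz)
  moreover have "(f k)\<^sup>2 + - 2 * (f k * g k) + (g k)\<^sup>2 = (f k - g k)\<^sup>2" for k
    by (simp add: power2_diff)
  ultimately show ?thesis
    by (simp add: infsumI power2_eq_square)
qed

text \<open>Completeness of l^2(A). The limit v is taken coordinatewise; the Cauchy estimate is
  passed to it on finite subsets of A, where limits and sums commute, and only afterwards is v known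
  to be square summable.\<close>

lemma square_summable_complete:
  fixes u :: "nat \<Rightarrow> 'a \<Rightarrow> real"
  assumes u: "\<And>n. (\<lambda>k. (u n k)\<^sup>2) summable_on A"
    and cauchy: "\<And>\<epsilon>. \<epsilon> > 0 \<Longrightarrow> \<exists>N. \<forall>m\<ge>N. \<forall>n\<ge>N. (\<Sum>\<^sub>\<infinity>k\<in>A. (u m k - u n k)\<^sup>2) < \<epsilon>"
  obtains v where "(\<lambda>k. (v k)\<^sup>2) summable_on A"
    and "(\<lambda>n. \<Sum>\<^sub>\<infinity>k\<in>A. (u n k - v k)\<^sup>2) \<longlonglongrightarrow> 0"
proof -
  have fin: "(\<Sum>k\<in>F. (u m k - u n k)\<^sup>2) \<le> (\<Sum>\<^sub>\<infinity>k\<in>A. (u m k - u n k)\<^sup>2)"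
    if "finite F" "F \<subseteq> A" for F m n
    using that by (intro finite_sum_le_infsum summable_square_diff u) auto
  have "\<exists>l. (\<lambda>n. u n k) \<longlonglongrightarrow> l" if k: "k \<in> A" for k
  proof -
    have "Cauchy (\<lambda>n. u n k)"
      unfolding Cauchy_def
    proof (intro allI impI)
      fix e :: real assume "e > 0"
      then obtain N where N: "\<forall>m\<ge>N. \<forall>n\<ge>N. (\<Sum>\<^sub>\<infinity>k\<in>A. (u m k - u n k)\<^sup>2) < e\<^sup>2"
        using cauchy[of "e\<^sup>2"] by auto
      have "dist (u m k) (u n k) < e" if mn: "m \<ge> N" "n \<ge> N" for m n
      proof -
        have "(u m k - u n k)\<^sup>2 < e\<^sup>2"
          using fin[of "{k}" m n] k N mn by (simp add: order.strict_trans1)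
        then have "\<bar>u m k - u n k\<bar>\<^sup>2 < e\<^sup>2" by simp
        then have "\<bar>u m k - u n k\<bar> < e"
          using \<open>e > 0\<close> by (intro power_less_imp_less_base[of _ 2 e]) auto
        then show ?thesis by (simp add: dist_real_def)
      qed
      then show "\<exists>M. \<forall>m\<ge>M. \<forall>n\<ge>M. dist (u m k) (u n k) < e" by blast
    qed
    then show ?thesis using Cauchy_convergent convergent_def by blast
  qed
  then obtain v where v: "\<And>k. k \<in> A \<Longrightarrow> (\<lambda>n. u n k) \<longlonglongrightarrow> v k" by metis
  have close: "\<exists>N. \<forall>m\<ge>N. (\<forall>F. finite F \<and> F \<subseteq> A \<longrightarrow> (\<Sum>k\<in>F. (u m k - v k)\<^sup>2) \<le> \<epsilon>)"
    if \<epsilon>: "\<epsilon> > 0" for \<epsilon>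
  proof -
    obtain N where N: "\<forall>m\<ge>N. \<forall>n\<ge>N. (\<Sum>\<^sub>\<infinity>k\<in>A. (u m k - u n k)\<^sup>2) < \<epsilon>"
      using cauchy[OF \<epsilon>] by blast
    have "(\<Sum>k\<in>F. (u m k - v k)\<^sup>2) \<le> \<epsilon>" if m: "m \<ge> N" and F: "finite F" "F \<subseteq> A" for m F
    proof (rule LIMSEQ_le_const2)
      show "(\<lambda>n. \<Sum>k\<in>F. (u m k - u n k)\<^sup>2) \<longlonglongrightarrow> (\<Sum>k\<in>F. (u m k - v k)\<^sup>2)"
        using F by (intro tendsto_intros v) auto
      show "\<exists>N. \<forall>n\<ge>N. (\<Sum>k\<in>F. (u m k - u n k)\<^sup>2) \<le> \<epsilon>"
        using N m fin[OF F] by (meson less_imp_le order_trans)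
    qed
    then show ?thesis by blast
  qed
  obtain N where N: "\<And>F. finite F \<Longrightarrow> F \<subseteq> A \<Longrightarrow> (\<Sum>k\<in>F. (u N k - v k)\<^sup>2) \<le> 1"
    using close[of 1] by auto
  have d: "(\<lambda>k. (u N k - v k)\<^sup>2) summable_on A"
    by (rule nonneg_bdd_above_summable_on) (use N in \<open>auto intro!: bdd_aboveI2\<close>)
  from summable_square_diff[OF u[of N] this] have vs: "(\<lambda>k. (v k)\<^sup>2) summable_on A" by simp
  have "(\<lambda>n. \<Sum>\<^sub>\<infinity>k\<in>A. (u n k - v k)\<^sup>2) \<longlonglongrightarrow> 0"
  proof (rule LIMSEQ_I)
    fix r :: real assume "r > 0"
    then obtain M where M: "\<forall>m\<ge>M. \<forall>F. finite F \<and> F \<subseteq> A \<longrightarrow> (\<Sum>k\<in>F. (u m k - v k)\<^sup>2) \<le> r / 2"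
      using close[of "r / 2"] by auto
    have "norm ((\<Sum>\<^sub>\<infinity>k\<in>A. (u m k - v k)\<^sup>2) - 0) < r" if "m \<ge> M" for m
    proof -
      have "(\<Sum>\<^sub>\<infinity>k\<in>A. (u m k - v k)\<^sup>2) \<le> r / 2"
        using M that by (intro infsum_le_finite_sums summable_square_diff u vs) auto
      moreover have "0 \<le> (\<Sum>\<^sub>\<infinity>k\<in>A. (u m k - v k)\<^sup>2)" by (intro infsum_nonneg) simp
      ultimately show ?thesis using \<open>r > 0\<close> by simp
    qed
    then show "\<exists>no. \<forall>n\<ge>no. norm ((\<Sum>\<^sub>\<infinity>k\<in>A. (u n k - v k)\<^sup>2) - 0) < r" by blast
  qed
  with vs show thesis by (rule that)
qed

lemma infsum_square_tendsto:
  fixes u :: "nat \<Rightarrow> 'a \<Rightarrow> real"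
  assumes u: "\<And>n. (\<lambda>k. (u n k)\<^sup>2) summable_on A" and v: "(\<lambda>k. (v k)\<^sup>2) summable_on A"
    and lim: "(\<lambda>n. \<Sum>\<^sub>\<infinity>k\<in>A. (u n k - v k)\<^sup>2) \<longlonglongrightarrow> 0"
  shows "(\<lambda>k. (g k)\<^sup>2) summable_on A \<Longrightarrow>
      (\<lambda>n. \<Sum>\<^sub>\<infinity>k\<in>A. u n k * g k) \<longlonglongrightarrow> (\<Sum>\<^sub>\<infinity>k\<in>A. v k * g k)"
    and "(\<lambda>n. \<Sum>\<^sub>\<infinity>k\<in>A. u n k * u n k) \<longlonglongrightarrow> (\<Sum>\<^sub>\<infinity>k\<in>A. v k * v k)"
proof -
  have main: "(\<lambda>n. \<Sum>\<^sub>\<infinity>k\<in>A. u n k * g k) \<longlonglongrightarrow> (\<Sum>\<^sub>\<infinity>k\<in>A. v k * g k)"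
    if g: "(\<lambda>k. (g k)\<^sup>2) summable_on A" for g
  proof -
    have "(\<lambda>n. sqrt (\<Sum>\<^sub>\<infinity>k\<in>A. (u n k - v k)\<^sup>2) * sqrt (\<Sum>\<^sub>\<infinity>k\<in>A. (g k)\<^sup>2)) \<longlonglongrightarrow>
        sqrt 0 * sqrt (\<Sum>\<^sub>\<infinity>k\<in>A. (g k)\<^sup>2)"
      by (intro tendsto_intros lim)
    then have lim0: "(\<lambda>n. sqrt (\<Sum>\<^sub>\<infinity>k\<in>A. (u n k - v k)\<^sup>2) * sqrt (\<Sum>\<^sub>\<infinity>k\<in>A. (g k)\<^sup>2)) \<longlonglongrightarrow> 0"
      by simp
    have eq: "(\<Sum>\<^sub>\<infinity>k\<in>A. u n k * g k) - (\<Sum>\<^sub>\<infinity>k\<in>A. v k * g k) = (\<Sum>\<^sub>\<infinity>k\<in>A. (u n k - v k) * g k)" for n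
      proof -
      have "((\<lambda>k. u n k * g k + - 1 * (v k * g k)) has_sum
          (\<Sum>\<^sub>\<infinity>k\<in>A. u n k * g k) + - 1 * (\<Sum>\<^sub>\<infinity>k\<in>A. v k * g k)) A"
        by (intro has_sum_add has_sum_cmult_right has_sum_infsum infsum_cauchy_schwarz u v g)
      then show ?thesis by (simp add: infsumI left_diff_distrib)
    qed
    have "(\<lambda>n. (\<Sum>\<^sub>\<infinity>k\<in>A. u n k * g k) - (\<Sum>\<^sub>\<infinity>k\<in>A. v k * g k)) \<longlonglongrightarrow> 0"
      by (rule Lim_null_comparison[OF _ lim0])
        (simp add: eq infsum_cauchy_schwarz summable_square_diff u v g)
    then show ?thesis by (rule LIM_zero_cancel)
  qed
  then show "(\<lambda>k. (g k)\<^sup>2) summable_on A \<Longrightarrow>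
      (\<lambda>n. \<Sum>\<^sub>\<infinity>k\<in>A. u n k * g k) \<longlonglongrightarrow> (\<Sum>\<^sub>\<infinity>k\<in>A. v k * g k)" .
  \<comment> \<open>Expanding the squared distance expresses the squared norm of \<open>u n\<close>
    by that distance and the pairing with v, whose limits are known.\<close>
  have "(\<lambda>n. (\<Sum>\<^sub>\<infinity>k\<in>A. (u n k - v k)\<^sup>2) + 2 * (\<Sum>\<^sub>\<infinity>k\<in>A. u n k * v k) - (\<Sum>\<^sub>\<infinity>k\<in>A. v k * v k)) \<longlonglongrightarrow>
      0 + 2 * (\<Sum>\<^sub>\<infinity>k\<in>A. v k * v k) - (\<Sum>\<^sub>\<infinity>k\<in>A. v k * v k)"
    by (intro tendsto_intros lim main v)
  then show "(\<lambda>n. \<Sum>\<^sub>\<infinity>k\<in>A. u n k * u n k) \<longlonglongrightarrow> (\<Sum>\<^sub>\<infinity>k\<in>A. v k * v k)"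
    by (simp add: infsum_square_diff u v)
qed

section \<open>Orthonormal expansions of tensors\<close>

definition ortho_basis :: "real \<Rightarrow> nat \<Rightarrow> real \<Rightarrow> real" where
  "ortho_basis c k x = cos_basis k x / sqrt (basis_weight c k)"

text \<open>The Sobolev inner product of f with \<open>ortho_basis c k\<close>: the cosine
  coefficient is divided by the square root of the weight and multiplied by the weight.\<close>

definition ortho_coeff :: "real \<Rightarrow> (real \<Rightarrow> real) \<Rightarrow> nat \<Rightarrow> real" where
  "ortho_coeff c f k = sqrt (basis_weight c k) * cosine.coeff f k"

lemma basis_weight_ge_1: "0 < c \<Longrightarrow> 1 \<le> basis_weight c k"
  by (simp add: basis_weight_def)

lemma sobolev1_inner_has_sum:
  assumes "0 < c" "f \<in> sobolev1" "g \<in> sobolev1"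
  shows "((\<lambda>k. ortho_coeff c f k * ortho_coeff c g k) has_sum sobolev1_inner c f g) UNIV"
proof -
  have "ortho_coeff c f k * ortho_coeff c g k =
      basis_weight c k * (cosine.coeff f k * cosine.coeff g k)" for k
    using basis_weight_ge_1[OF assms(1), of k] by (simp add: ortho_coeff_def)
  then show ?thesis using sobolev1_inner_expansion[OF assms(2,3)] by simp
qed

lemma sobolev1_eval_has_sum:
  assumes "0 < c" "f \<in> sobolev1" "y \<in> {0..1}"
  shows "((\<lambda>k. ortho_coeff c f k * ortho_basis c k y) has_sum f y) UNIV"
proof -
  have "ortho_coeff c f k * ortho_basis c k y = cosine.coeff f k * cos_basis k y" for k
    using basis_weight_ge_1[OF assms(1), of k] by (simp add: ortho_coeff_def ortho_basis_def)
  then show ?thesis using sobolev1_expansion[OF assms(2,3)] by simp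
qed

text \<open>The factor \<open>2\<close> is the square of the sup norm of \<open>\<surd>2 cos (\<pi> k x)\<close>; it is absent for \<open>k = 0\<close>, so
  that the sum over \<open>k\<close> is \<open>1 + O(c)\<close> and products over many small weights stay bounded.\<close>

definition basis_rate :: "real \<Rightarrow> nat \<Rightarrow> real" where
  "basis_rate c k = (if k = 0 then 1 else 2 / basis_weight c k)"

lemma basis_rate_pos: "0 < c \<Longrightarrow> 0 < basis_rate c k"
  using basis_weight_ge_1[of c k] by (simp add: basis_rate_def)

lemma ortho_basis_square_le:
  assumes "0 < c" shows "(ortho_basis c k y)\<^sup>2 \<le> basis_rate c k"
proof (cases "k = 0")
  case True
  then show ?thesis by (simp add: ortho_basis_def basis_rate_def cos_basis_def basis_weight_def)
next
  case False
  have w: "1 \<le> basis_weight c k" by (rule basis_weight_ge_1[OF assms])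
  have "(cos_basis k y)\<^sup>2 \<le> 2"
    using False by (simp add: cos_basis_def power_mult_distrib abs_square_le_1)
  then show ?thesis
    using w False by (simp add: ortho_basis_def basis_rate_def power_divide divide_right_mono)
qed

text \<open>For s > 1/2 this is (2 / pi^2)^s times the Riemann zeta function at 2 s. The summand at
  k = 0 is 0, by the values of division by 0 and of \<open>0 powr s\<close>.\<close>

definition zeta_const :: "real \<Rightarrow> real" where
  "zeta_const s = (\<Sum>\<^sub>\<infinity>k. (2 / (pi * real k)\<^sup>2) powr s)"

lemma zeta_const_summable:
  assumes "1 / 2 < s" shows "(\<lambda>k. (2 / (pi * real k)\<^sup>2) powr s) summable_on UNIV"
proof -
  have "(2 / (pi * real k)\<^sup>2) powr s = (2 / pi\<^sup>2) powr s * real k powr (- 2 * s)" for k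
  proof (cases "k = 0")
    case False
    then have "real k powr (- 2 * s) = inverse ((real k)\<^sup>2 powr s)"
      by (simp add: powr_minus powr_powr[symmetric])
    then show ?thesis
      using False by (simp add: power_mult_distrib powr_divide powr_mult field_simps)
  qed simp
  moreover have "summable (\<lambda>k. real k powr (- 2 * s))"
    using assms by (simp add: summable_real_powr_iff)
  ultimately have "summable (\<lambda>k. (2 / (pi * real k)\<^sup>2) powr s)"
    by (simp add: summable_mult)
  then show ?thesis by (simp add: summable_on_UNIV_nonneg_real_iff)
qed

lemma zeta_const_nonneg: "0 \<le> zeta_const s"
  unfolding zeta_const_def by (intro infsum_nonneg) simp

text \<open>Dropping the 1 in \<open>basis_weight\<close> bounds the rate for k > 0 by c times a
  multiple of k^(-2), and k = 0 contributes 1. Passing from 1 + x to exp x turns the later product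
  over coordinates into a sum of powers of the weights.\<close>

lemma basis_rate_powr_summable:
  assumes c: "0 < c" and s: "1 / 2 < s"
  shows "(\<lambda>k. basis_rate c k powr s) summable_on UNIV"
    and "(\<Sum>\<^sub>\<infinity>k. basis_rate c k powr s) \<le> exp (zeta_const s * c powr s)"
proof -
  let ?z = "\<lambda>k. c powr s * (2 / (pi * real k)\<^sup>2) powr s"
  have le: "basis_rate c k powr s \<le> ?z k" if "k \<noteq> 0" for k
  proof -
    have pk: "0 < (pi * real k)\<^sup>2" using that by simp
    then have "0 < (pi * real k)\<^sup>2 / c" using c by (rule divide_pos_pos)
    then have "2 / basis_weight c k \<le> 2 / ((pi * real k)\<^sup>2 / c)"
      by (intro frac_le) (simp_all add: basis_weight_def)
    then have "basis_rate c k \<le> c * (2 / (pi * real k)\<^sup>2)"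
      using that by (simp add: basis_rate_def field_simps)
    then have "basis_rate c k powr s \<le> (c * (2 / (pi * real k)\<^sup>2)) powr s"
      using s basis_rate_pos[OF c, of k] by (intro powr_mono2) auto
    also have "\<dots> = ?z k" by (rule powr_mult)
    finally show ?thesis .
  qed
  have zs: "?z summable_on UNIV"
    by (intro summable_on_cmult_right zeta_const_summable s)
  have zsum: "infsum ?z UNIV = c powr s * zeta_const s"
    unfolding zeta_const_def by (rule infsum_cmult_right) (use zeta_const_summable[OF s] in simp)
  define h where "h k = (if k = 0 then 1 else 0 :: real) + ?z k" for k :: nat
  have ind: "((\<lambda>k. if k = 0 then 1 else 0 :: real) has_sum 1) (UNIV :: nat set)"
    by (rule has_sum_finite_neutralI[of "{0}"]) auto
  have h: "(h has_sum 1 + c powr s * zeta_const s) UNIV"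
    unfolding h_def using has_sum_add[OF ind has_sum_infsum[OF zs]] by (simp only: zsum)
  have leh: "basis_rate c k powr s \<le> h k" for k
    using le[of k] by (cases "k = 0") (simp_all add: h_def basis_rate_def)
  show summ: "(\<lambda>k. basis_rate c k powr s) summable_on UNIV"
    by (rule summable_on_comparison_test[OF has_sum_imp_summable[OF h]]) (simp_all add: leh)
  have "(\<Sum>\<^sub>\<infinity>k. basis_rate c k powr s) \<le> infsum h UNIV"
    by (rule infsum_mono[OF summ has_sum_imp_summable[OF h] leh])
  also have "\<dots> = 1 + zeta_const s * c powr s" using infsumI[OF h] by simp
  also have "\<dots> \<le> exp (zeta_const s * c powr s)"
    by (rule exp_ge_add_one_self)
  finally show "(\<Sum>\<^sub>\<infinity>k. basis_rate c k powr s) \<le> exp (zeta_const s * c powr s)" .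
qed

section \<open>Product bases and coefficients in d variables\<close>

abbreviation multi_indices :: "nat \<Rightarrow> (nat \<Rightarrow> nat) set" where
  "multi_indices d \<equiv> {1..d} \<rightarrow>\<^sub>E UNIV"

definition multi_basis :: "(nat \<Rightarrow> real) \<Rightarrow> nat \<Rightarrow> (nat \<Rightarrow> nat) \<Rightarrow> (nat \<Rightarrow> real) \<Rightarrow> real" where
  "multi_basis \<gamma> d k x = (\<Prod>j=1..d. ortho_basis (\<gamma> j) (k j) (x j))"

definition multi_rate :: "(nat \<Rightarrow> real) \<Rightarrow> nat \<Rightarrow> (nat \<Rightarrow> nat) \<Rightarrow> real" where
  "multi_rate \<gamma> d k = (\<Prod>j=1..d. basis_rate (\<gamma> j) (k j))"

definition tensor_coeff :: "(nat \<Rightarrow> real) \<Rightarrow> nat \<Rightarrow> tensor \<Rightarrow> (nat \<Rightarrow> nat) \<Rightarrow> real" where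
  "tensor_coeff \<gamma> d u k = (\<Sum>\<phi>\<leftarrow>u. \<Prod>j=1..d. ortho_coeff (\<gamma> j) (\<phi> j) (k j))"

locale positive_weights =
  fixes \<gamma> :: "nat \<Rightarrow> real" and d :: nat
  assumes weight_pos: "\<And>j. j \<in> {1..d} \<Longrightarrow> 0 < \<gamma> j"
begin

lemma multi_rate_pos: "0 < multi_rate \<gamma> d k"
  unfolding multi_rate_def by (intro prod_pos ballI basis_rate_pos weight_pos)

lemma multi_basis_square_le: "(multi_basis \<gamma> d k x)\<^sup>2 \<le> multi_rate \<gamma> d k"
  unfolding multi_basis_def multi_rate_def prod_power_distrib
  by (intro prod_mono conjI zero_le_power2 ortho_basis_square_le weight_pos)

lemma multi_rate_powr_summable:
  assumes s: "1 / 2 < s"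
  shows "(\<lambda>k. multi_rate \<gamma> d k powr s) summable_on multi_indices d"
    and "(\<Sum>\<^sub>\<infinity>k\<in>multi_indices d. multi_rate \<gamma> d k powr s) \<le> exp (zeta_const s * (\<Sum>j=1..d. \<gamma> j powr s))"
proof -
  have eq: "multi_rate \<gamma> d k powr s = (\<Prod>j=1..d. basis_rate (\<gamma> j) (k j) powr s)" for k
    unfolding multi_rate_def
    by (rule prod_powr_distrib)
  have h: "((\<lambda>k. multi_rate \<gamma> d k powr s) has_sum
      (\<Prod>j=1..d. \<Sum>\<^sub>\<infinity>k. basis_rate (\<gamma> j) k powr s)) (multi_indices d)"
    unfolding eq by (intro has_sum_prod_PiE has_sum_infsum basis_rate_powr_summable s weight_pos) auto
  then show "(\<lambda>k. multi_rate \<gamma> d k powr s) summable_on multi_indices d" by (rule has_sum_imp_summable)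
  have "(\<Prod>j=1..d. \<Sum>\<^sub>\<infinity>k. basis_rate (\<gamma> j) k powr s) \<le> (\<Prod>j=1..d. exp (zeta_const s * \<gamma> j powr s))"
    by (intro prod_mono conjI infsum_nonneg basis_rate_powr_summable s weight_pos) auto
  then show "(\<Sum>\<^sub>\<infinity>k\<in>multi_indices d. multi_rate \<gamma> d k powr s) \<le> exp (zeta_const s * (\<Sum>j=1..d. \<gamma> j powr s))"
    by (simp add: infsumI[OF h] exp_sum sum_distrib_left del: One_nat_def)
qed

lemma multi_rate_summable: "(\<lambda>k. multi_rate \<gamma> d k) summable_on multi_indices d"
  using multi_rate_powr_summable(1)[of 1] by (simp add: less_imp_le[OF multi_rate_pos])

lemma multi_basis_square_summable: "(\<lambda>k. (multi_basis \<gamma> d k x)\<^sup>2) summable_on multi_indices d"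
  by (rule summable_on_comparison_test[OF multi_rate_summable]) (simp_all add: multi_basis_square_le)

text \<open>For elementary tensors this multiplies the univariate expansions; bilinearity over the
  two lists does the rest. In particular the inner product depends on the representing lists only
  through their coefficients.\<close>

lemma tensor_inner_has_sum:
  assumes "u \<in> algebraic_tensors d" "v \<in> algebraic_tensors d"
  shows "((\<lambda>k. tensor_coeff \<gamma> d u k * tensor_coeff \<gamma> d v k) has_sum tensor_inner \<gamma> d u v) (multi_indices d)"
proof -
  have "tensor_coeff \<gamma> d u k * tensor_coeff \<gamma> d v k = (\<Sum>\<phi>\<leftarrow>u. \<Sum>\<psi>\<leftarrow>v.
      \<Prod>j=1..d. ortho_coeff (\<gamma> j) (\<phi> j) (k j) * ortho_coeff (\<gamma> j) (\<psi> j) (k j))" for k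
    unfolding tensor_coeff_def prod.distrib
    by (simp add: sum_list_const_mult sum_list_mult_const)
  then show ?thesis
    using assms unfolding tensor_inner_def
    by (simp only:) (intro has_sum_sum_list has_sum_prod_PiE sobolev1_inner_has_sum weight_pos;
      auto simp: algebraic_tensors_def)
qed

lemma tensor_eval_has_sum:
  assumes "u \<in> algebraic_tensors d" "x \<in> cube d"
  shows "((\<lambda>k. tensor_coeff \<gamma> d u k * multi_basis \<gamma> d k x) has_sum tensor_eval d u x) (multi_indices d)"
proof -
  have x: "x j \<in> {0..1}" if "j \<in> {1..d}" for j using assms(2) that by (auto simp: cube_def)
  have "tensor_coeff \<gamma> d u k * multi_basis \<gamma> d k x = (\<Sum>\<phi>\<leftarrow>u.
      \<Prod>j=1..d. ortho_coeff (\<gamma> j) (\<phi> j) (k j) * ortho_basis (\<gamma> j) (k j) (x j))" for k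
    unfolding tensor_coeff_def multi_basis_def prod.distrib
    by (simp add: sum_list_mult_const)
  then show ?thesis
    using assms(1) unfolding tensor_eval_def
    by (simp only:) (intro has_sum_sum_list has_sum_prod_PiE sobolev1_eval_has_sum weight_pos x;
      auto simp: algebraic_tensors_def)
qed

lemma tensor_coeff_square_summable:
  assumes "u \<in> algebraic_tensors d"
  shows "(\<lambda>k. (tensor_coeff \<gamma> d u k)\<^sup>2) summable_on multi_indices d"
  using has_sum_imp_summable[OF tensor_inner_has_sum[OF assms assms]] by (simp add: power2_eq_square)

lemma tensor_dist_eq:
  assumes u: "u \<in> algebraic_tensors d" and v: "v \<in> algebraic_tensors d"
  shows "tensor_dist \<gamma> d u v =
    sqrt (\<Sum>\<^sub>\<infinity>k\<in>multi_indices d. (tensor_coeff \<gamma> d u k - tensor_coeff \<gamma> d v k)\<^sup>2)"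
  unfolding tensor_dist_def
  by (simp add: infsum_square_diff tensor_coeff_square_summable u v infsumI[OF tensor_inner_has_sum]
      del: One_nat_def)

text \<open>Nothing is required of b outside \<open>multi_indices d\<close> or of f off the cube, so
  coefficients can be unique only on \<open>multi_indices d\<close>.\<close>

definition expansion :: "((nat \<Rightarrow> real) \<Rightarrow> real) \<Rightarrow> ((nat \<Rightarrow> nat) \<Rightarrow> real) \<Rightarrow> bool" where
  "expansion f b \<longleftrightarrow> (\<lambda>k. (b k)\<^sup>2) summable_on multi_indices d \<and>
    (\<forall>x\<in>cube d. f x = (\<Sum>\<^sub>\<infinity>k\<in>multi_indices d. b k * multi_basis \<gamma> d k x))"

text \<open>The coefficient map is isometric by \<open>tensor_dist_eq\<close>, so coefficients of a
  Cauchy sequence converge in l^2. The basis values at a point are square summable, hence pairing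
  with them passes this convergence to the point values.\<close>

lemma tensor_approximates_expansion:
  assumes ap: "tensor_approximates \<gamma> d u f"
  obtains b where "expansion f b"
    and "(\<lambda>n. sqrt (tensor_inner \<gamma> d (u n) (u n))) \<longlonglongrightarrow> sqrt (\<Sum>\<^sub>\<infinity>k\<in>multi_indices d. (b k)\<^sup>2)"
proof -
  have u: "u n \<in> algebraic_tensors d" for n using ap by (simp add: tensor_approximates_def)
  let ?c = "\<lambda>n. tensor_coeff \<gamma> d (u n)"
  have s: "(\<lambda>k. (?c n k)\<^sup>2) summable_on multi_indices d" for n
    by (rule tensor_coeff_square_summable[OF u])
  have "\<exists>N. \<forall>m\<ge>N. \<forall>n\<ge>N. (\<Sum>\<^sub>\<infinity>k\<in>multi_indices d. (?c m k - ?c n k)\<^sup>2) < \<epsilon>" if \<epsilon>: "\<epsilon> > 0" for \<epsilon>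
  proof -
    have "sqrt \<epsilon> > 0" using \<epsilon> by simp
    then obtain N where "\<forall>m\<ge>N. \<forall>n\<ge>N. tensor_dist \<gamma> d (u m) (u n) < sqrt \<epsilon>"
      using ap unfolding tensor_approximates_def by blast
    then show ?thesis unfolding tensor_dist_eq[OF u u] by (simp only: real_sqrt_less_iff) blast
  qed
  note cauchy = this
  obtain b where
    b: "(\<lambda>k. (b k)\<^sup>2) summable_on multi_indices d"
    and lim: "(\<lambda>n. \<Sum>\<^sub>\<infinity>k\<in>multi_indices d. (?c n k - b k)\<^sup>2) \<longlonglongrightarrow> 0"
    by (rule square_summable_complete[OF s cauchy])
  have "f x = (\<Sum>\<^sub>\<infinity>k\<in>multi_indices d. b k * multi_basis \<gamma> d k x)" if x: "x \<in> cube d" for x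
  proof (rule LIMSEQ_unique)
    show "(\<lambda>n. tensor_eval d (u n) x) \<longlonglongrightarrow> f x"
      using ap x by (simp add: tensor_approximates_def)
    show "(\<lambda>n. tensor_eval d (u n) x) \<longlonglongrightarrow> (\<Sum>\<^sub>\<infinity>k\<in>multi_indices d. b k * multi_basis \<gamma> d k x)"
      using infsum_square_tendsto(1)[OF s b lim multi_basis_square_summable[of x]]
      by (simp add: infsumI[OF tensor_eval_has_sum[OF u x]] del: One_nat_def)
  qed
  then have "expansion f b" using b by (simp add: expansion_def)
  moreover have "(\<lambda>n. sqrt (tensor_inner \<gamma> d (u n) (u n))) \<longlonglongrightarrow> sqrt (\<Sum>\<^sub>\<infinity>k\<in>multi_indices d. (b k)\<^sup>2)"
    using tendsto_real_sqrt[OF infsum_square_tendsto(2)[OF s b lim]]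
    by (simp add: infsumI[OF tensor_inner_has_sum[OF u u]] power2_eq_square del: One_nat_def)
  ultimately show thesis by (rule that)
qed

end

text \<open>Induction on the coordinates: with the other coordinates fixed at x, the series is a
  univariate cosine series in the new coordinate with coefficients \<open>D n\<close>. These vanish,
  and each of them is a cosine series over the remaining coordinates.\<close>

lemma multi_cos_series_zero:
  fixes c :: "('i \<Rightarrow> nat) \<Rightarrow> real"
  assumes "finite I" and "c summable_on (I \<rightarrow>\<^sub>E UNIV)"
    and "\<And>x. x \<in> I \<rightarrow>\<^sub>E {0..1} \<Longrightarrow> (\<Sum>\<^sub>\<infinity>k\<in>I \<rightarrow>\<^sub>E UNIV. c k * (\<Prod>i\<in>I. cos_basis (k i) (x i))) = 0"
    and "k \<in> I \<rightarrow>\<^sub>E UNIV"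
  shows "c k = 0"
  using assms
proof (induction I arbitrary: c k rule: finite_induct)
  case empty
  then show ?case by simp
next
  case (insert i I)
  let ?K = "I \<rightarrow>\<^sub>E (UNIV :: nat set)"
  let ?E = "\<lambda>k x. \<Prod>j\<in>I. cos_basis (k j) (x j)"
  have E_upd: "(\<Prod>j\<in>I. cos_basis ((k(i := n)) j) ((x(i := y)) j)) = ?E k x" for k n x y
    using insert(2) by (intro prod.cong) auto
  have cb: "\<bar>cos_basis k x\<bar> \<le> sqrt 2" for k x
    by (auto simp: cos_basis_def abs_mult mult_left_le)
  have "\<bar>?E k x\<bar> \<le> sqrt 2 ^ card I" for k x
    unfolding abs_prod using prod_mono[of I "\<lambda>j. \<bar>cos_basis (k j) (x j)\<bar>" "\<lambda>j. sqrt 2"] cb by simp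
  note Eb = this
  have sC: "(\<lambda>(n, k). c (k(i := n))) summable_on UNIV \<times> ?K"
    using insert.prems(1) has_sum_PiE_insert[OF insert(2), where f = c and B = "\<lambda>_. UNIV"]
    unfolding summable_on_def by simp
  have sCabs: "(\<lambda>(n, k). \<bar>c (k(i := n))\<bar>) summable_on UNIV \<times> ?K"
    using sC by (subst (asm) summable_on_iff_abs_summable_on_real) (simp add: case_prod_unfold)
  \<comment> \<open>A bounded multiplier preserves absolute summability. It is used with the product
    of the old cosines, and with the new cosine included, where it justifies regrouping the
    sum.\<close>
  have sCE: "(\<lambda>(n, k). c (k(i := n)) * g n k) summable_on UNIV \<times> ?K"
    if g: "\<And>n k. \<bar>g n k\<bar> \<le> B" for g :: "nat \<Rightarrow> ('i \<Rightarrow> nat) \<Rightarrow> real" and B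
  proof (rule abs_summable_summable)
    show "(\<lambda>z. norm (case z of (n, k) \<Rightarrow> c (k(i := n)) * g n k)) summable_on UNIV \<times> ?K"
    proof (rule summable_on_comparison_test)
      show "(\<lambda>z. B * (case z of (n, k) \<Rightarrow> \<bar>c (k(i := n))\<bar>)) summable_on UNIV \<times> ?K"
        by (rule summable_on_cmult_right[OF sCabs])
      show "norm (case z of (n, k) \<Rightarrow> c (k(i := n)) * g n k) \<le>
          B * (case z of (n, k) \<Rightarrow> \<bar>c (k(i := n))\<bar>)" for z
        using mult_right_mono[OF g, of "\<bar>c ((snd z)(i := fst z))\<bar>" "fst z" "snd z"]
        by (simp add: case_prod_unfold abs_mult mult.commute)
    qed simp
  qed
  define l where "l = k i"
  \<comment> \<open>The value \<open>undefined\<close> at i makes k' a member of the extensional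
    function space over I.\<close>
  define k' where "k' = k(i := undefined)"
  have k: "k = k'(i := l)" "k' \<in> ?K"
    using insert.prems(3) insert(2) by (auto simp: l_def k'_def PiE_def extensional_def)
  have "c (k'(i := l)) = 0"
  proof (rule insert.IH[of "\<lambda>k. c (k(i := l))", OF _ _ k(2)])
    show "(\<lambda>k. c (k(i := l))) summable_on ?K"
      using summable_on_SigmaD1[OF sC, of l] by simp
    fix x :: "'i \<Rightarrow> real" assume x: "x \<in> I \<rightarrow>\<^sub>E {0..1}"
    define D where "D n = (\<Sum>\<^sub>\<infinity>k\<in>?K. c (k(i := n)) * ?E k x)" for n
    have "D l = 0"
    proof (rule cos_series_zero)
      show "D summable_on UNIV"
        unfolding D_def by (rule summable_on_Sigma_banach[OF sCE[OF Eb]])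
      fix y :: real assume y: "y \<in> {0..1}"
      have xy: "x(i := y) \<in> insert i I \<rightarrow>\<^sub>E {0..1}"
        using x y by (auto simp: PiE_def extensional_def)
      have b: "\<bar>?E k x * cos_basis n y\<bar> \<le> sqrt 2 ^ card I * sqrt 2" for n k
        unfolding abs_mult by (intro mult_mono Eb cb) auto
      have pe: "(\<Prod>j\<in>insert i I. cos_basis ((k(i := n)) j) ((x(i := y)) j)) = ?E k x * cos_basis n y" for k n
        unfolding prod.insert[OF insert(1,2)] E_upd by simp
      note sm = sCE[of "\<lambda>n k. ?E k x * cos_basis n y", OF b]
      have "(\<Sum>\<^sub>\<infinity>n. D n * cos_basis n y) =
          (\<Sum>\<^sub>\<infinity>n. \<Sum>\<^sub>\<infinity>k\<in>?K. c (k(i := n)) * (?E k x * cos_basis n y))"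
        unfolding D_def by (simp add: infsum_cmult_left'[symmetric] mult.assoc)
      also have "\<dots> = (\<Sum>\<^sub>\<infinity>(n, k)\<in>UNIV \<times> ?K. c (k(i := n)) * (?E k x * cos_basis n y))"
        by (rule infsum_Sigma'_banach[OF sm])
      also have "\<dots> = (\<Sum>\<^sub>\<infinity>k\<in>insert i I \<rightarrow>\<^sub>E UNIV. c k * (\<Prod>j\<in>insert i I. cos_basis (k j) ((x(i := y)) j)))"
      proof (rule infsumI[symmetric], subst has_sum_PiE_insert[OF insert(2)])
        show "((\<lambda>(n, k). c (k(i := n)) * (\<Prod>j\<in>insert i I. cos_basis ((k(i := n)) j) ((x(i := y)) j))) has_sum
            (\<Sum>\<^sub>\<infinity>(n, k)\<in>UNIV \<times> ?K. c (k(i := n)) * (?E k x * cos_basis n y))) (UNIV \<times> ?K)"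
          unfolding pe by (rule has_sum_infsum[OF sm])
      qed
      also have "\<dots> = 0" by (rule insert.prems(2)[OF xy])
      finally show "(\<Sum>\<^sub>\<infinity>n. D n * cos_basis n y) = 0" .
    qed
    then show "(\<Sum>\<^sub>\<infinity>k\<in>?K. c (k(i := l)) * ?E k x) = 0" by (simp add: D_def)
  qed
  then show "c k = 0" by (simp add: k(1)[symmetric])
qed

section \<open>Approximation by truncated expansions\<close>

context positive_weights
begin

text \<open>The coefficients b are merely square summable, whereas uniqueness for cosine series asks
  for absolute summability. The normalising factors v of the basis are square summable too, so
  Cauchy-Schwarz makes b v summable, and v never vanishes.\<close>

lemma expansion_zero:
  assumes b: "(\<lambda>k. (b k)\<^sup>2) summable_on multi_indices d"
    and z: "\<And>x. x \<in> cube d \<Longrightarrow> (\<Sum>\<^sub>\<infinity>k\<in>multi_indices d. b k * multi_basis \<gamma> d k x) = 0"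
    and k: "k \<in> multi_indices d"
  shows "b k = 0"
proof -
  define v where "v k = (\<Prod>j=1..d. 1 / sqrt (basis_weight (\<gamma> j) (k j)))" for k :: "nat \<Rightarrow> nat"
  have w: "1 \<le> basis_weight (\<gamma> j) n" if "j \<in> {1..d}" for j n
    using weight_pos[OF that] by (rule basis_weight_ge_1)
  have v_pos: "0 < v k" for k
    unfolding v_def by (intro prod_pos ballI) (use w in \<open>fastforce intro: less_le_trans[of 0 1]\<close>)
  have "(v k)\<^sup>2 \<le> multi_rate \<gamma> d k" for k
    unfolding v_def multi_rate_def prod_power_distrib
  proof (intro prod_mono conjI zero_le_power2)
    fix j assume "j \<in> {1..d}"
    from w[OF this, of "k j"] show "(1 / sqrt (basis_weight (\<gamma> j) (k j)))\<^sup>2 \<le> basis_rate (\<gamma> j) (k j)"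
      by (simp add: basis_rate_def basis_weight_def power_divide divide_right_mono)
  qed
  then have vs: "(\<lambda>k. (v k)\<^sup>2) summable_on multi_indices d"
    by (intro summable_on_comparison_test[OF multi_rate_summable]) simp_all
  have mb: "multi_basis \<gamma> d k x = v k * (\<Prod>j=1..d. cos_basis (k j) (x j))" for k x
    unfolding multi_basis_def v_def ortho_basis_def by (simp add: prod.distrib[symmetric])
  have "b k * v k = 0"
  proof (rule multi_cos_series_zero[of "{1..d}" "\<lambda>k. b k * v k", OF _ _ _ k])
    show "(\<lambda>k. b k * v k) summable_on multi_indices d"
      by (rule infsum_cauchy_schwarz[OF b vs])
    show "(\<Sum>\<^sub>\<infinity>k\<in>multi_indices d. b k * v k * (\<Prod>i=1..d. cos_basis (k i) (x i))) = 0"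
      if "x \<in> {1..d} \<rightarrow>\<^sub>E {0..1}" for x
      using z[of x] that by (simp add: mb cube_def mult.assoc)
  qed simp
  then show "b k = 0" using v_pos[of k] by simp
qed

lemma expansion_summable:
  assumes "expansion f b"
  shows "(\<lambda>k. b k * multi_basis \<gamma> d k x) summable_on multi_indices d"
  using assms multi_basis_square_summable by (auto simp: expansion_def intro: infsum_cauchy_schwarz)

lemma expansion_add:
  assumes f: "expansion f b" and g: "expansion g c"
  shows "expansion (\<lambda>x. f x + g x) (\<lambda>k. b k + c k)"
  using assms summable_square_add[of b "multi_indices d" c]
    infsum_add[OF expansion_summable[OF f] expansion_summable[OF g]]
  by (simp add: expansion_def distrib_right)

lemma expansion_cmult:
  assumes f: "expansion f b"
  shows "expansion (\<lambda>x. a * f x) (\<lambda>k. a * b k)"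
proof -
  have "(\<lambda>k. a\<^sup>2 * (b k)\<^sup>2) summable_on multi_indices d"
    using f by (intro summable_on_cmult_right) (simp add: expansion_def)
  moreover have "(\<Sum>\<^sub>\<infinity>k\<in>multi_indices d. a * (b k * multi_basis \<gamma> d k x)) =
      a * (\<Sum>\<^sub>\<infinity>k\<in>multi_indices d. b k * multi_basis \<gamma> d k x)" for x
    by (rule infsum_cmult_right) (rule expansion_summable[OF f])
  ultimately show ?thesis using f by (simp add: expansion_def power_mult_distrib mult.assoc)
qed

lemma expansion_unique:
  assumes f: "expansion f b" and g: "expansion f c" and k: "k \<in> multi_indices d"
  shows "b k = c k"
proof -
  have e: "expansion (\<lambda>x. f x + - 1 * f x) (\<lambda>k. b k + - 1 * c k)"
    by (rule expansion_add[OF f expansion_cmult[OF g]])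
  have "b k + - 1 * c k = 0"
    by (rule expansion_zero[OF _ _ k]) (use e in \<open>simp_all add: expansion_def\<close>)
  then show ?thesis by simp
qed

text \<open>By \<open>expansion_unique\<close> the choice is determined on
  \<open>multi_indices d\<close> whenever f has an expansion; linearity in f rests on this.\<close>

definition coeffs :: "((nat \<Rightarrow> real) \<Rightarrow> real) \<Rightarrow> (nat \<Rightarrow> nat) \<Rightarrow> real" where
  "coeffs f = (SOME b. expansion f b)"

lemma expansion_coeffs:
  assumes "f \<in> sobolev \<gamma> d" shows "expansion f (coeffs f)"
proof -
  obtain u where "tensor_approximates \<gamma> d u f" using assms by (auto simp: sobolev_def)
  then obtain b where "expansion f b" by (rule tensor_approximates_expansion)
  then show ?thesis unfolding coeffs_def by (rule someI[of "expansion f" b])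
qed

text \<open>Every approximating sequence leads to the same coefficients, hence to the same limit of
  norms, so the definite description has exactly one candidate.\<close>

lemma sobolev_norm_eq:
  assumes f: "f \<in> sobolev \<gamma> d"
  shows "sobolev_norm \<gamma> d f = sqrt (\<Sum>\<^sub>\<infinity>k\<in>multi_indices d. (coeffs f k)\<^sup>2)"
proof -
  have lim: "(\<lambda>n. sqrt (tensor_inner \<gamma> d (u n) (u n))) \<longlonglongrightarrow>
      sqrt (\<Sum>\<^sub>\<infinity>k\<in>multi_indices d. (coeffs f k)\<^sup>2)" if u: "tensor_approximates \<gamma> d u f" for u
  proof -
    obtain b where b: "expansion f b"
      and l: "(\<lambda>n. sqrt (tensor_inner \<gamma> d (u n) (u n))) \<longlonglongrightarrow> sqrt (\<Sum>\<^sub>\<infinity>k\<in>multi_indices d. (b k)\<^sup>2)"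
      by (rule tensor_approximates_expansion[OF u])
    have "(\<Sum>\<^sub>\<infinity>k\<in>multi_indices d. (b k)\<^sup>2) = (\<Sum>\<^sub>\<infinity>k\<in>multi_indices d. (coeffs f k)\<^sup>2)"
      by (rule infsum_cong) (simp only: expansion_unique[OF b expansion_coeffs[OF f]])
    with l show ?thesis by simp
  qed
  obtain u where u: "tensor_approximates \<gamma> d u f" using f by (auto simp: sobolev_def)
  show ?thesis
    unfolding sobolev_norm_def
  proof (rule the_equality)
    show "\<exists>u. tensor_approximates \<gamma> d u f \<and> (\<lambda>n. sqrt (tensor_inner \<gamma> d (u n) (u n)))
        \<longlonglongrightarrow> sqrt (\<Sum>\<^sub>\<infinity>k\<in>multi_indices d. (coeffs f k)\<^sup>2)"
      using u lim[OF u] by blast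
    fix r assume "\<exists>u. tensor_approximates \<gamma> d u f \<and> (\<lambda>n. sqrt (tensor_inner \<gamma> d (u n) (u n))) \<longlonglongrightarrow> r"
    then show "r = sqrt (\<Sum>\<^sub>\<infinity>k\<in>multi_indices d. (coeffs f k)\<^sup>2)"
      using lim LIMSEQ_unique by blast
  qed
qed

lemma coeffs_add:
  assumes "f \<in> sobolev \<gamma> d" "g \<in> sobolev \<gamma> d" "(\<lambda>x. f x + g x) \<in> sobolev \<gamma> d" "k \<in> multi_indices d"
  shows "coeffs (\<lambda>x. f x + g x) k = coeffs f k + coeffs g k"
  by (rule expansion_unique[OF expansion_coeffs[OF assms(3)] _ assms(4)])
    (intro expansion_add expansion_coeffs assms)

lemma coeffs_cmult:
  assumes "f \<in> sobolev \<gamma> d" "(\<lambda>x. a * f x) \<in> sobolev \<gamma> d" "k \<in> multi_indices d"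
  shows "coeffs (\<lambda>x. a * f x) k = a * coeffs f k"
  by (rule expansion_unique[OF expansion_coeffs[OF assms(2)] _ assms(3)])
    (intro expansion_cmult expansion_coeffs assms)

lemma abs_coeffs_le:
  assumes f: "f \<in> sobolev \<gamma> d" and k: "k \<in> multi_indices d"
  shows "\<bar>coeffs f k\<bar> \<le> sobolev_norm \<gamma> d f"
proof -
  have "(\<Sum>k\<in>{k}. (coeffs f k)\<^sup>2) \<le> (\<Sum>\<^sub>\<infinity>k\<in>multi_indices d. (coeffs f k)\<^sup>2)"
    using expansion_coeffs[OF f] k by (intro finite_sum_le_infsum) (auto simp: expansion_def)
  then have "sqrt ((coeffs f k)\<^sup>2) \<le> sobolev_norm \<gamma> d f"
    unfolding sobolev_norm_eq[OF f] by (intro real_sqrt_le_mono) simp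
  then show ?thesis by simp
qed

lemma truncation_error:
  assumes f: "f \<in> sobolev \<gamma> d" and A: "finite A" "A \<subseteq> multi_indices d" and x: "x \<in> cube d"
  shows "\<bar>f x - (\<Sum>k\<in>A. coeffs f k * multi_basis \<gamma> d k x)\<bar> \<le>
    sobolev_norm \<gamma> d f * sqrt (\<Sum>\<^sub>\<infinity>k\<in>multi_indices d - A. multi_rate \<gamma> d k)"
proof -
  let ?R = "multi_indices d - A"
  have e: "expansion f (coeffs f)" by (rule expansion_coeffs[OF f])
  then have bs: "(\<lambda>k. (coeffs f k)\<^sup>2) summable_on multi_indices d" by (simp add: expansion_def)
  have bsR: "(\<lambda>k. (coeffs f k)\<^sup>2) summable_on ?R" by (rule summable_on_subset[OF bs]) auto
  have msR: "(\<lambda>k. (multi_basis \<gamma> d k x)\<^sup>2) summable_on ?R"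
    by (rule summable_on_subset[OF multi_basis_square_summable]) auto
  have rsR: "(\<lambda>k. multi_rate \<gamma> d k) summable_on ?R"
    by (rule summable_on_subset[OF multi_rate_summable]) auto
  have "(\<Sum>\<^sub>\<infinity>k\<in>?R. coeffs f k * multi_basis \<gamma> d k x) =
      (\<Sum>\<^sub>\<infinity>k\<in>multi_indices d. coeffs f k * multi_basis \<gamma> d k x) - (\<Sum>\<^sub>\<infinity>k\<in>A. coeffs f k * multi_basis \<gamma> d k x)"
    using A by (intro infsum_Diff expansion_summable[OF e]) auto
  then have "f x - (\<Sum>k\<in>A. coeffs f k * multi_basis \<gamma> d k x) = (\<Sum>\<^sub>\<infinity>k\<in>?R. coeffs f k * multi_basis \<gamma> d k x)"
    using e x A by (simp add: expansion_def)
  also have "\<bar>\<dots>\<bar> \<le> sqrt (\<Sum>\<^sub>\<infinity>k\<in>?R. (coeffs f k)\<^sup>2) * sqrt (\<Sum>\<^sub>\<infinity>k\<in>?R. (multi_basis \<gamma> d k x)\<^sup>2)"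
    by (rule infsum_cauchy_schwarz[OF bsR msR])
  also have "\<dots> \<le> sobolev_norm \<gamma> d f * sqrt (\<Sum>\<^sub>\<infinity>k\<in>?R. multi_rate \<gamma> d k)"
  proof (intro mult_mono)
    show "sqrt (\<Sum>\<^sub>\<infinity>k\<in>?R. (coeffs f k)\<^sup>2) \<le> sobolev_norm \<gamma> d f"
      unfolding sobolev_norm_eq[OF f]
      by (intro real_sqrt_le_mono infsum_mono_neutral bs bsR) auto
    show "sqrt (\<Sum>\<^sub>\<infinity>k\<in>?R. (multi_basis \<gamma> d k x)\<^sup>2) \<le> sqrt (\<Sum>\<^sub>\<infinity>k\<in>?R. multi_rate \<gamma> d k)"
      by (intro real_sqrt_le_mono infsum_mono msR rsR multi_basis_square_le)
    show "0 \<le> sobolev_norm \<gamma> d f"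
      unfolding sobolev_norm_eq[OF f] by (intro real_sqrt_ge_zero infsum_nonneg) simp
  qed (intro real_sqrt_ge_zero infsum_nonneg; simp)
  finally show ?thesis .
qed

end

section \<open>Measurability and essential bounds on the cube\<close>

lemma space_cube_measure: "space (cube_measure d) = cube d"
  by (simp add: cube_measure_def cube_def space_PiM space_restrict_space)

lemma measurable_cube_product:
  fixes h :: "nat \<Rightarrow> real \<Rightarrow> real"
  assumes "\<And>j. j \<in> {1..d} \<Longrightarrow> continuous_on {0..1} (h j)"
  shows "(\<lambda>x. \<Prod>j=1..d. h j (x j)) \<in> borel_measurable (cube_measure d)"
proof -
  have "h j \<in> borel_measurable (restrict_space lborel {0..1})" if "j \<in> {1..d}" for j
    using borel_measurable_continuous_on_restrict[OF assms[OF that]]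
    by (simp add: measurable_def sets_restrict_space space_restrict_space)
  then have "(\<lambda>x. h j (x j)) \<in> borel_measurable (\<Pi>\<^sub>M k\<in>{1..d}. restrict_space lborel {0..1})"
    if "j \<in> {1..d}" for j
    using that by (intro measurable_compose[OF measurable_component_singleton[of j]]) auto
  then have "(\<lambda>x. \<Prod>j=1..d. h j (x j)) \<in> borel_measurable (\<Pi>\<^sub>M k\<in>{1..d}. restrict_space lborel {0..1})"
    by (rule borel_measurable_prod)
  then show ?thesis unfolding cube_measure_def by (rule measurable_completion)
qed

lemma measurable_tensor_eval:
  assumes "u \<in> algebraic_tensors d"
  shows "tensor_eval d u \<in> borel_measurable (cube_measure d)"
proof -
  have "(\<lambda>x. \<Sum>\<phi>\<leftarrow>u. \<Prod>k=1..d. \<phi> k (x k)) \<in> borel_measurable (cube_measure d)"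
    using assms unfolding algebraic_tensors_def
    by (induction u) (auto intro!: borel_measurable_add measurable_cube_product sobolev1_continuous
        simp del: One_nat_def)
  then show ?thesis by (simp add: tensor_eval_def[abs_def])
qed

lemma measurable_sobolev:
  assumes "f \<in> sobolev \<gamma> d" shows "f \<in> borel_measurable (cube_measure d)"
proof -
  obtain u where u: "tensor_approximates \<gamma> d u f" using assms by (auto simp: sobolev_def)
  show ?thesis
    by (rule borel_measurable_LIMSEQ_metric[of "\<lambda>n. tensor_eval d (u n)"])
      (use u in \<open>auto simp: tensor_approximates_def space_cube_measure intro: measurable_tensor_eval\<close>)
qed

lemma Linfty_norm_le:
  assumes "f \<in> borel_measurable (cube_measure d)" "\<And>x. x \<in> cube d \<Longrightarrow> \<bar>f x\<bar> \<le> c"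
  shows "Linfty_norm d f \<le> ereal c"
  unfolding Linfty_norm_def
proof (rule esssup_I)
  show "(\<lambda>x. ereal \<bar>f x\<bar>) \<in> borel_measurable (cube_measure d)" using assms(1) by measurable
  show "AE x in cube_measure d. ereal \<bar>f x\<bar> \<le> ereal c"
    using assms(2) by (intro AE_I2) (simp add: space_cube_measure)
qed

context positive_weights
begin

lemma measurable_multi_basis: "multi_basis \<gamma> d k \<in> borel_measurable (cube_measure d)"
proof -
  have "continuous_on {0..1} (ortho_basis c n)" for c n
    unfolding ortho_basis_def
    by (cases "sqrt (basis_weight c n) = 0") (auto intro!: continuous_intros)
  then show ?thesis
    unfolding multi_basis_def[abs_def] by (rule measurable_cube_product)
qed

lemma multi_basis_Linfty: "multi_basis \<gamma> d k \<in> Linfty d"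
proof -
  have "Linfty_norm d (multi_basis \<gamma> d k) \<le> ereal (sqrt (multi_rate \<gamma> d k))"
    using multi_basis_square_le by (intro Linfty_norm_le measurable_multi_basis real_le_rsqrt) simp
  then show ?thesis using measurable_multi_basis by (auto simp: Linfty_def)
qed

text \<open>The algorithm reads off the coefficients with index in A. They are continuous on F since
  the Sobolev norm bounds them; that uses some embedding constant B, while the error is measured
  with the bound C on the embedding norm.\<close>

lemma minimal_error_le:
  assumes bfs: "banach_function_space (cube d) F N"
    and emb: "continuously_embedded F N (sobolev \<gamma> d) (sobolev_norm \<gamma> d)"
    and C: "embedding_norm F N (sobolev_norm \<gamma> d) \<le> ereal C"
    and A: "finite A" "A \<subseteq> multi_indices d"
  shows "minimal_error d F N (card A) \<le> ereal (C * sqrt (\<Sum>\<^sub>\<infinity>k\<in>multi_indices d - A. multi_rate \<gamma> d k))"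
proof -
  obtain h where h: "bij_betw h {1..card A} A" using ex_bij_betw_nat_finite_1[OF A(1)] by blast
  have hA: "h j \<in> multi_indices d" if "j \<in> {1..card A}" for j
    using bij_betwE[OF h] that A by blast
  have Fs: "F \<subseteq> sobolev \<gamma> d" using emb by (simp add: continuously_embedded_def)
  obtain B where B: "\<And>f. f \<in> F \<Longrightarrow> sobolev_norm \<gamma> d f \<le> B * N f"
    using emb by (auto simp: continuously_embedded_def)
  let ?A = "\<lambda>f x. \<Sum>j=1..card A. coeffs f (h j) * multi_basis \<gamma> d (h j) x"
  have Aeq: "?A f x = (\<Sum>k\<in>A. coeffs f k * multi_basis \<gamma> d k x)" for f x
    by (rule sum.reindex_bij_betw[OF h])
  have clf: "continuous_linear_functional F N (\<lambda>f. coeffs f (h j))" if j: "j \<in> {1..card A}" for j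
    unfolding continuous_linear_functional_def
  proof (intro conjI ballI allI exI[of _ B])
    fix f g assume fg: "f \<in> F" "g \<in> F"
    then have "(\<lambda>x. f x + g x) \<in> F" using bfs by (simp add: banach_function_space_def)
    then show "coeffs (\<lambda>x. f x + g x) (h j) = coeffs f (h j) + coeffs g (h j)"
      using fg Fs hA[OF j] by (intro coeffs_add) auto
  next
    fix c f assume f: "f \<in> F"
    then have "(\<lambda>x. c * f x) \<in> F" using bfs by (simp add: banach_function_space_def)
    then show "coeffs (\<lambda>x. c * f x) (h j) = c * coeffs f (h j)"
      using f Fs hA[OF j] by (intro coeffs_cmult) auto
  next
    fix f assume f: "f \<in> F"
    show "\<bar>coeffs f (h j)\<bar> \<le> B * N f"
      using abs_coeffs_le[OF _ hA[OF j], of f] B[OF f] f Fs by (auto intro: order_trans)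
  qed
  have mem: "?A \<in> linear_algorithms d F N (card A)"
    unfolding linear_algorithms_def mem_Collect_eq
    by (rule exI[of _ "\<lambda>j f. coeffs f (h j)"], rule exI[of _ "\<lambda>j. multi_basis \<gamma> d (h j)"])
      (use clf multi_basis_Linfty in simp)
  have "worst_case_error d F N ?A \<le> ereal (C * sqrt (\<Sum>\<^sub>\<infinity>k\<in>multi_indices d - A. multi_rate \<gamma> d k))"
    unfolding worst_case_error_def
  proof (rule SUP_least)
    fix f assume "f \<in> {f \<in> F. N f \<le> 1}"
    then have f: "f \<in> F" "N f \<le> 1" and fs: "f \<in> sobolev \<gamma> d" using Fs by auto
    have "ereal (sobolev_norm \<gamma> d f) \<le> embedding_norm F N (sobolev_norm \<gamma> d)"
      unfolding embedding_norm_def using f by (intro SUP_upper) simp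
    then have fC: "sobolev_norm \<gamma> d f \<le> C" using C order_trans by fastforce
    show "Linfty_norm d (\<lambda>x. f x - ?A f x) \<le> ereal (C * sqrt (\<Sum>\<^sub>\<infinity>k\<in>multi_indices d - A. multi_rate \<gamma> d k))"
    proof (rule Linfty_norm_le)
      show "(\<lambda>x. f x - ?A f x) \<in> borel_measurable (cube_measure d)"
        using measurable_sobolev[OF fs] measurable_multi_basis by measurable
      fix x assume x: "x \<in> cube d"
      have "\<bar>f x - ?A f x\<bar> \<le> sobolev_norm \<gamma> d f * sqrt (\<Sum>\<^sub>\<infinity>k\<in>multi_indices d - A. multi_rate \<gamma> d k)"
        unfolding Aeq by (rule truncation_error[OF fs A x])
      also have "\<dots> \<le> C * sqrt (\<Sum>\<^sub>\<infinity>k\<in>multi_indices d - A. multi_rate \<gamma> d k)"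
        by (intro mult_right_mono fC real_sqrt_ge_zero infsum_nonneg less_imp_le[OF multi_rate_pos])
      finally show "\<bar>f x - ?A f x\<bar> \<le> C * sqrt (\<Sum>\<^sub>\<infinity>k\<in>multi_indices d - A. multi_rate \<gamma> d k)" .
    qed
  qed
  then show ?thesis
    unfolding minimal_error_def by (rule INF_lower2[OF mem])
qed

text \<open>Both bounds compare a rate with its s-th power. On A that power exceeds \<delta>^s, as
  in Markov's inequality; off A the remaining factor, the power 1 - s, is at most \<delta>^(1 -
  s).\<close>

lemma rate_threshold:
  assumes s: "1 / 2 < s" "s < 1" and \<delta>: "0 < \<delta>"
  defines "A \<equiv> {k \<in> multi_indices d. \<delta> < multi_rate \<gamma> d k}"
    and "S \<equiv> exp (zeta_const s * (\<Sum>j=1..d. \<gamma> j powr s))"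
  shows "finite A" and "real (card A) \<le> \<delta> powr (- s) * S"
    and "(\<Sum>\<^sub>\<infinity>k\<in>multi_indices d - A. multi_rate \<gamma> d k) \<le> \<delta> powr (1 - s) * S"
proof -
  note sm = multi_rate_powr_summable[OF s(1)]
  have card: "real (card B) \<le> \<delta> powr (- s) * S" if B: "finite B" "B \<subseteq> A" for B
  proof -
    have "real (card B) * \<delta> powr s = (\<Sum>k\<in>B. \<delta> powr s)" by simp
    also have "\<dots> \<le> (\<Sum>k\<in>B. multi_rate \<gamma> d k powr s)"
      using B s \<delta> by (intro sum_mono powr_mono2) (auto simp: A_def)
    also have "\<dots> \<le> (\<Sum>\<^sub>\<infinity>k\<in>multi_indices d. multi_rate \<gamma> d k powr s)"
      using B by (intro finite_sum_le_infsum sm(1)) (auto simp: A_def)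
    also have "\<dots> \<le> S" unfolding S_def by (rule sm(2))
    finally show ?thesis using \<delta> by (simp add: powr_minus field_simps)
  qed
  \<comment> \<open>An infinite set has finite subsets of every size, contrary to the cardinality
    bound just shown for all finite subsets.\<close>
  show fin: "finite A"
  proof (rule ccontr)
    assume inf: "infinite A"
    obtain n :: nat where n: "\<delta> powr (- s) * S < real n" using reals_Archimedean2 by blast
    obtain B where "finite B" "card B = n" "B \<subseteq> A" using infinite_arbitrarily_large[OF inf] by blast
    with card[of B] n show False by simp
  qed
  show "real (card A) \<le> \<delta> powr (- s) * S" by (rule card[OF fin order_refl])
  let ?R = "multi_indices d - A"
  have sR: "(\<lambda>k. multi_rate \<gamma> d k powr s) summable_on ?R"
    by (rule summable_on_subset[OF sm(1)]) auto
  have "(\<Sum>\<^sub>\<infinity>k\<in>?R. multi_rate \<gamma> d k) \<le> (\<Sum>\<^sub>\<infinity>k\<in>?R. \<delta> powr (1 - s) * multi_rate \<gamma> d k powr s)"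
  proof (rule infsum_mono)
    show "(\<lambda>k. multi_rate \<gamma> d k) summable_on ?R" by (rule summable_on_subset[OF multi_rate_summable]) auto
    show "(\<lambda>k. \<delta> powr (1 - s) * multi_rate \<gamma> d k powr s) summable_on ?R"
      by (rule summable_on_cmult_right[OF sR])
    fix k assume k: "k \<in> ?R"
    have "multi_rate \<gamma> d k = multi_rate \<gamma> d k powr (1 - s) * multi_rate \<gamma> d k powr s"
      using multi_rate_pos[of k] by (simp add: powr_add[symmetric])
    also have "\<dots> \<le> \<delta> powr (1 - s) * multi_rate \<gamma> d k powr s"
      using k s multi_rate_pos[of k] by (intro mult_right_mono powr_mono2) (auto simp: A_def)
    finally show "multi_rate \<gamma> d k \<le> \<delta> powr (1 - s) * multi_rate \<gamma> d k powr s" .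
  qed
  also have "\<dots> = \<delta> powr (1 - s) * (\<Sum>\<^sub>\<infinity>k\<in>?R. multi_rate \<gamma> d k powr s)"
    by (rule infsum_cmult_right) (use sR in simp)
  also have "\<dots> \<le> \<delta> powr (1 - s) * S"
  proof (rule mult_left_mono)
    have "(\<Sum>\<^sub>\<infinity>k\<in>?R. multi_rate \<gamma> d k powr s) \<le> (\<Sum>\<^sub>\<infinity>k\<in>multi_indices d. multi_rate \<gamma> d k powr s)"
      by (intro infsum_mono_neutral sR sm(1)) auto
    then show "(\<Sum>\<^sub>\<infinity>k\<in>?R. multi_rate \<gamma> d k powr s) \<le> S" unfolding S_def using sm(2) by simp
  qed simp
  finally show "(\<Sum>\<^sub>\<infinity>k\<in>?R. multi_rate \<gamma> d k) \<le> \<delta> powr (1 - s) * S" .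
qed

lemma minimal_error_threshold:
  assumes bfs: "banach_function_space (cube d) F N"
    and emb: "continuously_embedded F N (sobolev \<gamma> d) (sobolev_norm \<gamma> d)"
    and C: "embedding_norm F N (sobolev_norm \<gamma> d) \<le> ereal C" "0 < C"
    and s: "1 / 2 < s" "s < 1" and \<epsilon>: "0 < \<epsilon>"
  defines "S \<equiv> exp (zeta_const s * (\<Sum>j=1..d. \<gamma> j powr s))"
  shows "\<exists>n. minimal_error d F N n \<le> ereal \<epsilon> \<and> real n \<le> S * (C\<^sup>2 * S / \<epsilon>\<^sup>2) powr (s / (1 - s))"
proof -
  have S: "0 < S" by (simp add: S_def)
  \<comment> \<open>The solution of
    \<open>C\<^sup>2 * (\<delta> powr (1 - s) * S) = \<epsilon>\<^sup>2\<close>, which makes the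
    bound on the squared error equal to the tolerance.\<close>
  define \<delta> where "\<delta> = (\<epsilon>\<^sup>2 / (C\<^sup>2 * S)) powr (1 / (1 - s))"
  have base: "0 < \<epsilon>\<^sup>2 / (C\<^sup>2 * S)" using \<epsilon> C S by simp
  then have \<delta>: "0 < \<delta>" unfolding \<delta>_def by (simp only: powr_gt_zero)
  define A where "A = {k \<in> multi_indices d. \<delta> < multi_rate \<gamma> d k}"
  note A = rate_threshold[OF s \<delta>, folded A_def S_def]
  have d1: "\<delta> powr (1 - s) = \<epsilon>\<^sup>2 / (C\<^sup>2 * S)"
    proof -
    have "1 / (1 - s) * (1 - s) = 1" using s by simp
    then show ?thesis unfolding \<delta>_def powr_powr using base by (simp only: powr_one less_imp_le)
  qed
  have d2: "\<delta> powr (- s) = (C\<^sup>2 * S / \<epsilon>\<^sup>2) powr (s / (1 - s))"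
  proof -
    have "\<delta> powr (- s) = (\<epsilon>\<^sup>2 / (C\<^sup>2 * S)) powr (- (s / (1 - s)))"
      by (simp add: \<delta>_def powr_powr)
    also have "\<dots> = inverse (\<epsilon>\<^sup>2 / (C\<^sup>2 * S)) powr (s / (1 - s))"
      using base by (simp only: powr_minus inverse_powr)
    finally show ?thesis by (simp add: inverse_eq_divide)
  qed
  have "minimal_error d F N (card A) \<le>
      ereal (C * sqrt (\<Sum>\<^sub>\<infinity>k\<in>multi_indices d - A. multi_rate \<gamma> d k))"
    by (rule minimal_error_le[OF bfs emb C(1) A(1)]) (auto simp: A_def)
  also have "C * sqrt (\<Sum>\<^sub>\<infinity>k\<in>multi_indices d - A. multi_rate \<gamma> d k) \<le> C * sqrt ((\<epsilon> / C)\<^sup>2)"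
  proof (intro mult_left_mono real_sqrt_le_mono)
    have "(\<Sum>\<^sub>\<infinity>k\<in>multi_indices d - A. multi_rate \<gamma> d k) \<le> \<epsilon>\<^sup>2 / (C\<^sup>2 * S) * S"
      using A(3) unfolding d1 .
    then show "(\<Sum>\<^sub>\<infinity>k\<in>multi_indices d - A. multi_rate \<gamma> d k) \<le> (\<epsilon> / C)\<^sup>2"
      using S by (simp add: power_divide)
  qed (use C in simp)
  also have "C * sqrt ((\<epsilon> / C)\<^sup>2) = \<epsilon>" using C \<epsilon> by simp
  finally have "minimal_error d F N (card A) \<le> ereal \<epsilon>" by simp
  moreover have "real (card A) \<le> S * (C\<^sup>2 * S / \<epsilon>\<^sup>2) powr (s / (1 - s))"
    using A(2) unfolding d2 by (simp only: mult.commute)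
  ultimately show ?thesis by blast
qed

end

section \<open>Tractability\<close>

lemma limsup_finite_imp_bounded:
  fixes x :: "nat \<Rightarrow> real"
  assumes "limsup (\<lambda>d. ereal (x d)) < \<infinity>"
  obtains M where "0 \<le> M" "\<And>d. x d \<le> M"
proof -
  obtain z :: real where "limsup (\<lambda>d. ereal (x d)) < ereal z"
    using assms less_PInf_Ex_of_nat by (metis ereal_dense2)
  then have "eventually (\<lambda>d. ereal (x d) < ereal z) sequentially" by (rule Limsup_lessD)
  then obtain n where n: "\<And>d. d \<ge> n \<Longrightarrow> x d < z" by (auto simp: eventually_sequentially)
  define M where "M = max 0 (max z (Max (insert 0 (x ` {..<n}))))"
  have "x d \<le> M" for d
  proof (cases "d < n")
    case True
    then have "x d \<le> Max (insert 0 (x ` {..<n}))" by (intro Max_ge) auto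
    then show ?thesis by (simp add: M_def)
  next
    case False
    then show ?thesis using n[of d] by (simp add: M_def)
  qed
  then show thesis by (rule that[rotated]) (simp add: M_def)
qed

lemma information_complexity_le:
  assumes "minimal_error d (F d) (N d) n \<le> ereal \<epsilon>" "real n \<le> r"
  shows "ereal_of_enat (information_complexity F N \<epsilon> d) \<le> ereal r"
proof -
  have "information_complexity F N \<epsilon> d \<le> enat n"
    unfolding information_complexity_def using assms(1) by (intro INF_lower) simp
  then have "ereal_of_enat (information_complexity F N \<epsilon> d) \<le> ereal_of_enat (enat n)"
    by (simp only: ereal_of_enat_le_iff)
  also have "\<dots> = ereal (real n)" by simp
  finally show ?thesis using assms(2) order_trans by fastforce
qed

text \<open>Both implications follow from this one estimate, with h d = ln (d + 1) for polynomial
  and h d = 1 for strong polynomial tractability; K, p and Q depend on neither d nor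
  \<epsilon>.\<close>

lemma information_complexity_exp_bound:
  fixes \<gamma> :: "nat \<Rightarrow> nat \<Rightarrow> real"
    and C\<^sub>\<gamma> a b t \<kappa> M :: real
    and F :: "nat \<Rightarrow> ((nat \<Rightarrow> real) \<Rightarrow> real) set"
    and N :: "nat \<Rightarrow> ((nat \<Rightarrow> real) \<Rightarrow> real) \<Rightarrow> real"
    and h :: "nat \<Rightarrow> real"
  assumes weights_bounded: "\<And>d. 1 \<le> d \<Longrightarrow> \<gamma> d 1 \<le> C\<^sub>\<gamma>"
    and weights_decreasing: "\<And>d i j. 1 \<le> i \<Longrightarrow> i \<le> j \<Longrightarrow> j \<le> d \<Longrightarrow> \<gamma> d j \<le> \<gamma> d i"
    and weights_positive: "\<And>d. 1 \<le> d \<Longrightarrow> 0 < \<gamma> d d"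
    and banach: "\<And>d. 1 \<le> d \<Longrightarrow> banach_function_space (cube d) (F d) (N d)"
    and constants: "0 < a" "0 \<le> b" "0 < t" "t \<le> 1"
    and embedded: "\<And>d. 1 \<le> d \<Longrightarrow>
      continuously_embedded (F d) (N d) (sobolev (\<gamma> d) d) (sobolev_norm (\<gamma> d) d)"
    and embedding_bound: "\<And>d. 1 \<le> d \<Longrightarrow>
      embedding_norm (F d) (N d) (sobolev_norm (\<gamma> d) d)
        \<le> ereal (a * exp (b * (\<Sum>j=1..d. \<gamma> d j powr t)))"
    and \<kappa>: "0 \<le> \<kappa>" "\<kappa> < t" and M: "0 \<le> M"
    and sum_bound: "\<And>d. 1 \<le> d \<Longrightarrow> (\<Sum>j=1..d. \<gamma> d j powr \<kappa>) \<le> M * h d"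
    and h: "\<And>d. 1 \<le> d \<Longrightarrow> 0 \<le> h d"
  shows "\<exists>K>0. \<exists>p>0. \<exists>Q\<ge>0. \<forall>\<epsilon>>0. \<forall>d\<ge>1.
    ereal_of_enat (information_complexity F N \<epsilon> d) \<le> ereal (K * \<epsilon> powr (- p) * exp (Q * h d))"
proof -
  \<comment> \<open>The midpoint between 1 and the larger of \<kappa> and 1/2; both lie below 1
    because \<kappa> < t \<le> 1.\<close>
  define s where "s = (max \<kappa> (1 / 2) + 1) / 2"
  have s: "1 / 2 < s" "s < 1" "\<kappa> < s" using \<kappa> constants by (auto simp: s_def max_def)
  have pos: "0 < \<gamma> d j" if "j \<in> {1..d}" for d j
    using weights_decreasing[of j d d] weights_positive[of d] that by fastforce
  have le: "\<gamma> d j \<le> C\<^sub>\<gamma>" if "j \<in> {1..d}" for d j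
    using weights_decreasing[of 1 j d] weights_bounded[of d] that by fastforce
  \<comment> \<open>Raising the exponent from \<kappa> to v costs at most the factor
    \<open>C\<^sub>\<gamma> powr (v - \<kappa>)\<close> per weight. Used with v = s for the basis
    rates and v = t for the embedding norm.\<close>
  have powr_sum: "(\<Sum>j=1..d. \<gamma> d j powr v) \<le> C\<^sub>\<gamma> powr (v - \<kappa>) * (M * h d)" if v: "\<kappa> \<le> v" and d: "1 \<le> d" for v d
  proof -
    have "(\<Sum>j=1..d. \<gamma> d j powr v) \<le> (\<Sum>j=1..d. C\<^sub>\<gamma> powr (v - \<kappa>) * \<gamma> d j powr \<kappa>)"
    proof (rule sum_mono)
      fix j assume j: "j \<in> {1..d}"
      have "\<gamma> d j powr v = \<gamma> d j powr (v - \<kappa>) * \<gamma> d j powr \<kappa>" by (simp add: powr_add[symmetric])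
      also have "\<dots> \<le> C\<^sub>\<gamma> powr (v - \<kappa>) * \<gamma> d j powr \<kappa>"
        using v le[OF j] pos[OF j] by (intro mult_right_mono powr_mono2) auto
      finally show "\<gamma> d j powr v \<le> C\<^sub>\<gamma> powr (v - \<kappa>) * \<gamma> d j powr \<kappa>" .
    qed
    also have "\<dots> = C\<^sub>\<gamma> powr (v - \<kappa>) * (\<Sum>j=1..d. \<gamma> d j powr \<kappa>)" by (simp add: sum_distrib_left)
    also have "\<dots> \<le> C\<^sub>\<gamma> powr (v - \<kappa>) * (M * h d)" by (intro mult_left_mono sum_bound d) simp
    finally show ?thesis .
  qed
  define r where "r = s / (1 - s)"
  have r: "0 < r" using s by (simp add: r_def)
  define U where "U = zeta_const s * (C\<^sub>\<gamma> powr (s - \<kappa>) * M)"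
  define V where "V = b * (C\<^sub>\<gamma> powr (t - \<kappa>) * M)"
  have UV: "0 \<le> U" "0 \<le> V" using M constants by (auto simp: U_def V_def zeta_const_nonneg)
  \<comment> \<open>In \<open>S * (C\<^sup>2 * S / \<epsilon>\<^sup>2) powr r\<close> the powers of
    S and C are 1 + r and 2 r, and these quantities are at most \<open>exp (U * h d)\<close> and
    \<open>a * exp (V * h d)\<close>.\<close>
  define Q where "Q = (1 + r) * U + 2 * r * V"
  have Q: "0 \<le> Q" using UV r by (simp add: Q_def)
  have "ereal_of_enat (information_complexity F N \<epsilon> d) \<le>
      ereal (a powr (2 * r) * \<epsilon> powr (- (2 * r)) * exp (Q * h d))"
    if \<epsilon>: "\<epsilon> > 0" and d: "d \<ge> 1" for \<epsilon> d
  proof -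
    define C where "C = a * exp (b * (\<Sum>j=1..d. \<gamma> d j powr t))"
    define S where "S = exp (zeta_const s * (\<Sum>j=1..d. \<gamma> d j powr s))"
    have C: "0 < C" and S: "0 < S" using constants by (auto simp: C_def S_def)
    interpret positive_weights "\<gamma> d" d by unfold_locales (rule pos)
    obtain n where n: "minimal_error d (F d) (N d) n \<le> ereal \<epsilon>"
      "real n \<le> S * (C\<^sup>2 * S / \<epsilon>\<^sup>2) powr r"
      using minimal_error_threshold[OF banach[OF d] embedded[OF d] embedding_bound[OF d, folded C_def]
          C s(1,2) \<epsilon>] unfolding S_def r_def by blast
    have Cle: "C \<le> a * exp (V * h d)"
    proof -
      have "b * (\<Sum>j=1..d. \<gamma> d j powr t) \<le> b * (C\<^sub>\<gamma> powr (t - \<kappa>) * (M * h d))"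
        using \<kappa> constants by (intro mult_left_mono powr_sum d) auto
      then show ?thesis using constants by (simp add: C_def V_def mult.assoc)
    qed
    have Sle: "S \<le> exp (U * h d)"
    proof -
      have "zeta_const s * (\<Sum>j=1..d. \<gamma> d j powr s) \<le> zeta_const s * (C\<^sub>\<gamma> powr (s - \<kappa>) * (M * h d))"
        using s by (intro mult_left_mono powr_sum d zeta_const_nonneg) auto
      then show ?thesis by (simp add: S_def U_def mult.assoc)
    qed
    have "C\<^sup>2 \<le> (a * exp (V * h d))\<^sup>2" using Cle C by (intro power_mono) auto
    then have "C\<^sup>2 * S \<le> (a * exp (V * h d))\<^sup>2 * exp (U * h d)"
      using Sle S by (intro mult_mono) auto
    then have "C\<^sup>2 * S / \<epsilon>\<^sup>2 \<le> (a * exp (V * h d))\<^sup>2 * exp (U * h d) / \<epsilon>\<^sup>2"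
      by (intro divide_right_mono) auto
    then have "S * (C\<^sup>2 * S / \<epsilon>\<^sup>2) powr r \<le>
        exp (U * h d) * ((a * exp (V * h d))\<^sup>2 * exp (U * h d) / \<epsilon>\<^sup>2) powr r"
      using Sle S C r by (intro mult_mono powr_mono2) auto
    also have "\<dots> = a powr (2 * r) * \<epsilon> powr (- (2 * r)) * exp (Q * h d)"
    proof -
      let ?B = "(a * exp (V * h d))\<^sup>2 * exp (U * h d) / \<epsilon>\<^sup>2"
      have "0 < ?B" using constants \<epsilon> by simp
      then have "exp (U * h d) * ?B powr r = exp (U * h d + r * ln ?B)"
        using constants \<epsilon> by (simp add: powr_def exp_add)
      also have "ln ?B = 2 * ln a + 2 * (V * h d) + U * h d - 2 * ln \<epsilon>"
        using constants \<epsilon> by (simp add: ln_mult ln_div ln_realpow)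
      also have "U * h d + r * (2 * ln a + 2 * (V * h d) + U * h d - 2 * ln \<epsilon>) =
          2 * r * ln a + - (2 * r) * ln \<epsilon> + Q * h d"
        by (simp add: Q_def algebra_simps)
      also have "exp \<dots> = a powr (2 * r) * \<epsilon> powr (- (2 * r)) * exp (Q * h d)"
        using constants \<epsilon> by (simp only: powr_def exp_add) simp
      finally show ?thesis .
    qed
    finally have "real n \<le> a powr (2 * r) * \<epsilon> powr (- (2 * r)) * exp (Q * h d)" using n(2) by simp
    then show ?thesis by (rule information_complexity_le[where n = n and d = d and F = F and N = N, OF n(1)])
  qed
  moreover have "0 < a powr (2 * r)" using constants by simp
  ultimately show ?thesis using r Q by (meson mult_pos_pos zero_less_numeral)
qed

theorem proposition4p7:
  fixes \<gamma> :: "nat \<Rightarrow> nat \<Rightarrow> real"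
    and C\<^sub>\<gamma> a b t :: real
    and F :: "nat \<Rightarrow> ((nat \<Rightarrow> real) \<Rightarrow> real) set"
    and N :: "nat \<Rightarrow> ((nat \<Rightarrow> real) \<Rightarrow> real) \<Rightarrow> real"
  assumes weights_bounded: "\<And>d. 1 \<le> d \<Longrightarrow> \<gamma> d 1 \<le> C\<^sub>\<gamma>"
    and weights_decreasing: "\<And>d i j. 1 \<le> i \<Longrightarrow> i \<le> j \<Longrightarrow> j \<le> d \<Longrightarrow> \<gamma> d j \<le> \<gamma> d i"
    and weights_positive: "\<And>d. 1 \<le> d \<Longrightarrow> 0 < \<gamma> d d"
    and banach: "\<And>d. 1 \<le> d \<Longrightarrow> banach_function_space (cube d) (F d) (N d)"
    and constants: "0 < a" "0 \<le> b" "0 < t" "t \<le> 1"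
    and embedded: "\<And>d. 1 \<le> d \<Longrightarrow>
      continuously_embedded (F d) (N d) (sobolev (\<gamma> d) d) (sobolev_norm (\<gamma> d) d)"
    and embedding_bound: "\<And>d. 1 \<le> d \<Longrightarrow>
      embedding_norm (F d) (N d) (sobolev_norm (\<gamma> d) d)
        \<le> ereal (a * exp (b * (\<Sum>j=1..d. \<gamma> d j powr t)))"
  shows "(sum_exponent_q \<gamma> < ereal t \<longrightarrow> polynomially_tractable F N) \<and>
    (sum_exponent_p \<gamma> < ereal t \<longrightarrow> strongly_polynomially_tractable F N)"
proof -
  have bound: "\<exists>K>0. \<exists>p>0. \<exists>Q\<ge>0. \<forall>\<epsilon>>0. \<forall>d\<ge>1.
      ereal_of_enat (information_complexity F N \<epsilon> d) \<le> ereal (K * \<epsilon> powr (- p) * exp (Q * h d))"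
    if "0 \<le> \<kappa>" "\<kappa> < t" "0 \<le> M"
      and "\<And>d. 1 \<le> d \<Longrightarrow> (\<Sum>j=1..d. \<gamma> d j powr \<kappa>) \<le> M * h d"
      and "\<And>d. 1 \<le> d \<Longrightarrow> 0 \<le> h d" for \<kappa> M and h :: "nat \<Rightarrow> real"
    by (rule information_complexity_exp_bound[OF weights_bounded weights_decreasing weights_positive
      banach constants embedded embedding_bound that])
  have "polynomially_tractable F N" if "sum_exponent_q \<gamma> < ereal t"
  proof -
    from that obtain \<kappa> where \<kappa>: "0 \<le> \<kappa>" "\<kappa> < t"
      and ls: "limsup (\<lambda>d. ereal ((\<Sum>j=1..d. \<gamma> d j powr \<kappa>) / ln (real d + 1))) < \<infinity>"
      unfolding sum_exponent_q_def Inf_less_iff by auto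
    obtain M where M: "0 \<le> M" "\<And>d. (\<Sum>j=1..d. \<gamma> d j powr \<kappa>) / ln (real d + 1) \<le> M"
      using limsup_finite_imp_bounded[OF ls] by blast
    have sum_le: "(\<Sum>j=1..d. \<gamma> d j powr \<kappa>) \<le> M * ln (real d + 1)" if "1 \<le> d" for d
    proof -
      have "0 < ln (real d + 1)" using that by simp
      then show ?thesis using M(2)[of d] by (simp add: pos_divide_le_eq)
    qed
    have ln_nonneg: "0 \<le> ln (real d + 1)" for d by simp
    obtain K p Q where K: "0 < K" and p: "0 < p" and Q: "0 \<le> Q"
      and *: "\<And>\<epsilon> d. \<epsilon> > 0 \<Longrightarrow> d \<ge> 1 \<Longrightarrow> ereal_of_enat (information_complexity F N \<epsilon> d) \<le>
        ereal (K * \<epsilon> powr (- p) * exp (Q * ln (real d + 1)))"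
      using bound[OF \<kappa> M(1) sum_le ln_nonneg] by blast
    have "ereal_of_enat (information_complexity F N \<epsilon> d) \<le>
        ereal ((K * 2 powr Q) * \<epsilon> powr (- p) * real d powr Q)" if "\<epsilon> \<in> {0<..1}" "d \<ge> 1" for \<epsilon> d
    proof -
      \<comment> \<open>The exponential of the logarithm is a power of d + 1, at most 2 d since d
        \<ge> 1; the factor \<open>2 powr Q\<close> joins the constant.\<close>
      have "exp (Q * ln (real d + 1)) = (real d + 1) powr Q" by (simp add: powr_def)
      also have "\<dots> \<le> (2 * real d) powr Q" using that Q by (intro powr_mono2) auto
      also have "\<dots> = 2 powr Q * real d powr Q" by (rule powr_mult)
      finally have "K * \<epsilon> powr (- p) * exp (Q * ln (real d + 1)) \<le>
          K * \<epsilon> powr (- p) * (2 powr Q * real d powr Q)"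
        using K by (intro mult_left_mono) auto
      also have "\<dots> = (K * 2 powr Q) * \<epsilon> powr (- p) * real d powr Q" by simp
      finally show ?thesis using *[of \<epsilon> d] that by (meson ereal_less_eq(3) greaterThanAtMost_iff order_trans)
    qed
    moreover have "0 < K * 2 powr Q" using K by simp
    ultimately show ?thesis
      using p Q unfolding polynomially_tractable_def polynomially_bounded_def by blast
  qed
  moreover have "strongly_polynomially_tractable F N" if "sum_exponent_p \<gamma> < ereal t"
  proof -
    from that obtain \<kappa> where \<kappa>: "0 \<le> \<kappa>" "\<kappa> < t"
      and ls: "limsup (\<lambda>d. ereal (\<Sum>j=1..d. \<gamma> d j powr \<kappa>)) < \<infinity>"
      unfolding sum_exponent_p_def Inf_less_iff by auto
    \<comment> \<open>The factor 1 is the value of the constant function h.\<close>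
    obtain M where M: "0 \<le> M" "\<And>d. (\<Sum>j=1..d. \<gamma> d j powr \<kappa>) \<le> M * 1"
      using limsup_finite_imp_bounded[OF ls] by auto
    obtain K p Q where K: "0 < K" and p: "0 < p"
      and *: "\<And>\<epsilon> d. \<epsilon> > 0 \<Longrightarrow> d \<ge> 1 \<Longrightarrow> ereal_of_enat (information_complexity F N \<epsilon> d) \<le>
        ereal (K * \<epsilon> powr (- p) * exp (Q * 1))"
      using bound[OF \<kappa> M(1) M(2) zero_le_one] by blast
    have "ereal_of_enat (information_complexity F N \<epsilon> d) \<le>
        ereal ((K * exp Q) * \<epsilon> powr (- p) * real d powr 0)" if "\<epsilon> \<in> {0<..1}" "d \<ge> 1" for \<epsilon> d
      using *[of \<epsilon> d] that by (simp add: mult_ac)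
    moreover have "0 < K * exp Q" using K by simp
    ultimately show ?thesis
      using p unfolding strongly_polynomially_tractable_def polynomially_bounded_def by blast
  qed
  ultimately show ?thesis by blast
qed

end
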